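(* Let $T\subset\mathbb{R}^3$ be a tetrahedron. Then $P^0(T;\mathbb{S})\subset\mathbb{X}(T)$ and $\dim\mathbb{X}(T)=30$, and the functionals $$\tau\mapsto|F|\,\langle n\cdot\tau n,q\rangle_F\quad(q\in P^1(F),\ F\in\mathcal{F}(T)),$$ $$\tau\mapsto(\tau,c)_T\quad(c\in P^0(T;\mathbb{S})),$$ $$\tau\mapsto(\mathrm{div}\,\tau,v)_T\quad(v\in P^1(T;\mathbb{R}^3))$$ (with $q$, $c$, $v$ running through bases of the respective spaces) are degrees of freedom of $\mathbb{X}(T)$ for a finite element in the sense of Ciarlet, that is, they form a basis of the dual space of $\mathbb{X}(T)$.
   Context: $\mathbb{S}\subset\mathbb{R}^{3\times3}$ is the space of symmetric matrices. For a tetrahedron $T$ or one of its faces $K$, $P^k(K;U)$ is the space of polynomials on $K$ of degree at most $k$ with values in $U$ ($U$ omitted if $U=\mathbb{R}$). $(\cdot,\cdot)_T$ is the $L_2(T)$ inner product, $\langle\cdot,\cdot\rangle_F$ the $L_2(F)$ inner product, $|F|$ the area of $F$; $\mathrm{div}$ of a tensor is taken row-wise. $\mathcal{F}(T)$ is the set of the four faces of $T$. $T$ has (numbered) vertices $x_1,\dots,x_4$, faces $F_i$ opposite to $x_i$, and unit exterior normal vectors $n_i$ on $F_i$ (generically $n$). For $i\ne j$, $e_{i,j}=e_{j,i}$ is a unit vector parallel to the edge $\overline F_i\cap\overline F_j$ (in some fixed direction). Indices are taken modulo $4$ in $\{1,2,3,4\}$. For $a,b\in\mathbb{R}^3$,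 $a\odot b:=(ab^\top+ba^\top)/2\in\mathbb{S}$. Define the constant tensors $$T_i:=\frac{e_{i+1,i+2}\odot e_{i+1,i+3}}{(n_i\cdot e_{i+1,i+2})(n_i\cdot e_{i+1,i+3})}\ (i=1,\dots,4),\quad T_5:=e_{1,2}\odot e_{3,4},\quad T_6:=e_{1,3}\odot e_{2,4},$$ and the spaces $$P^0_{nn}(T;\mathbb{S}):=\mathrm{span}\{T_1,\dots,T_4\},\quad P^0_0(T;\mathbb{S}):=\mathrm{span}\{T_5,T_6\},$$ $$P^{2,1}(T,\mathbb{S}):=\{\tau\in P^2(T;\mathbb{S}): n\cdot\tau n|_F\in P^1(F)\ \forall F\in\mathcal{F}(T)\},$$ $$\mathbb{X}(T):=\big(P^2(T)P^0_{nn}(T;\mathbb{S})\cap P^{2,1}(T,\mathbb{S})\big)\oplus P^0_0(T;\mathbb{S}),$$ where $P^2(T)P^0_{nn}(T;\mathbb{S})=T_1P^2(T)\oplus\cdots\oplus T_4P^2(T)$. *)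

theory Defs
  imports "HOL-Analysis.Analysis" "HOL-Library.Function_Algebras"
begin

section \<open>Function spaces as real vector spaces\<close>

instantiation "fun" :: (type, real_vector) real_vector
begin

definition scaleR_fun_def: "scaleR c f = (\<lambda>x. c *\<^sub>R f x)"

instance
  by standard (simp_all add: scaleR_fun_def fun_eq_iff scaleR_add_left scaleR_add_right)

end

text \<open>
  A function on a set \<open>K\<close> is represented by its extension by zero outside \<open>K\<close>, so that
  functions on \<open>K\<close> are equal iff they agree on \<open>K\<close>, and dimension, span and linear
  independence refer to functions on \<open>K\<close>.
\<close>

definition zext :: "'a set \<Rightarrow> ('a \<Rightarrow> 'b::zero) \<Rightarrow> 'a \<Rightarrow> 'b" where
  "zext K f = (\<lambda>x. if x \<in> K then f x else 0)"

text \<open>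
  \<open>P^k(K;U)\<close>: spanned by the monomials of total degree at most \<open>k\<close> times elements of \<open>U\<close>.
  For a face \<open>K\<close> these are the restrictions of polynomials in three variables, i.e. the
  polynomials in the two coordinates of the plane of \<open>K\<close>.
\<close>

definition poly_space :: "nat \<Rightarrow> (real^3) set \<Rightarrow> 'u::real_vector set \<Rightarrow> (real^3 \<Rightarrow> 'u) set" where
  "poly_space k K U = span {zext K (\<lambda>x. (\<Prod>i\<in>UNIV. (x $ i) ^ \<alpha> i) *\<^sub>R u) | \<alpha> u.
     (\<Sum>i\<in>UNIV. \<alpha> i) \<le> k \<and> u \<in> U}"

definition is_basis :: "'v::real_vector set \<Rightarrow> 'v set \<Rightarrow> bool" where
  "is_basis B V \<longleftrightarrow> independent B \<and> span B = V"

definition is_basis_family :: "('i \<Rightarrow> 'v::real_vector) \<Rightarrow> 'i set \<Rightarrow> 'v set \<Rightarrow> bool" where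
  "is_basis_family f I V \<longleftrightarrow> inj_on f I \<and> is_basis (f ` I) V"

definition dual_space :: "'v::real_vector set \<Rightarrow> ('v \<Rightarrow> real) set" where
  "dual_space V = {\<phi>. (\<forall>v\<in>V. \<forall>w\<in>V. \<phi> (v + w) = \<phi> v + \<phi> w) \<and>
     (\<forall>c. \<forall>v\<in>V. \<phi> (c *\<^sub>R v) = c * \<phi> v) \<and> (\<forall>v. v \<notin> V \<longrightarrow> \<phi> v = 0)}"


section \<open>The tetrahedron\<close>

text \<open>
  Vertices, faces and normals are indexed by the type \<open>4\<close> of integers modulo 4, whose
  numeral \<open>4\<close> equals \<open>0\<close>. The tetrahedron and its faces are taken closed.
\<close>

definition nondegenerate :: "(4 \<Rightarrow> real^3) \<Rightarrow> bool" where
  "nondegenerate x \<longleftrightarrow> inj x \<and> \<not> affine_dependent (range x)"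

definition tetra :: "(4 \<Rightarrow> real^3) \<Rightarrow> (real^3) set" where
  "tetra x = convex hull (range x)"

definition face :: "(4 \<Rightarrow> real^3) \<Rightarrow> 4 \<Rightarrow> (real^3) set" where
  "face x i = convex hull (x ` (- {i}))"

definition unit_outer_normal :: "(4 \<Rightarrow> real^3) \<Rightarrow> 4 \<Rightarrow> real^3 \<Rightarrow> bool" where
  "unit_outer_normal x i v \<longleftrightarrow> norm v = 1 \<and>
     (\<forall>y\<in>face x i. \<forall>z\<in>face x i. v \<bullet> (y - z) = 0) \<and> (\<forall>y\<in>face x i. v \<bullet> (y - x i) > 0)"

definition unit_edge_vector :: "(4 \<Rightarrow> real^3) \<Rightarrow> 4 \<Rightarrow> 4 \<Rightarrow> real^3 \<Rightarrow> bool" where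
  "unit_edge_vector x i j v \<longleftrightarrow> norm v = 1 \<and>
     v \<in> span {y - z | y z. y \<in> face x i \<inter> face x j \<and> z \<in> face x i \<inter> face x j}"

text \<open>
  The surface integral over \<open>F\<^sub>i\<close> is computed from the affine parametrization of the face
  by the reference triangle; the norm of the cross product is its surface element.
\<close>

definition reference_triangle :: "(real \<times> real) set" where
  "reference_triangle = {(s, t). 0 \<le> s \<and> 0 \<le> t \<and> s + t \<le> 1}"

definition face_param :: "(4 \<Rightarrow> real^3) \<Rightarrow> 4 \<Rightarrow> real \<times> real \<Rightarrow> real^3" where
  "face_param x i = (\<lambda>(s, t). x (i + 1) + s *\<^sub>R (x (i + 2) - x (i + 1)) + t *\<^sub>R (x (i + 3) - x (i + 1)))"

definition face_integral :: "(4 \<Rightarrow> real^3) \<Rightarrow> 4 \<Rightarrow> (real^3 \<Rightarrow> real) \<Rightarrow> real" where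
  "face_integral x i f =
     (LINT p|lebesgue_on reference_triangle.
        f (face_param x i p) * norm (cross3 (x (i + 2) - x (i + 1)) (x (i + 3) - x (i + 1))))"

definition face_area :: "(4 \<Rightarrow> real^3) \<Rightarrow> 4 \<Rightarrow> real" where
  "face_area x i = face_integral x i (\<lambda>_. 1)"

definition face_inner :: "(4 \<Rightarrow> real^3) \<Rightarrow> 4 \<Rightarrow> (real^3 \<Rightarrow> real) \<Rightarrow> (real^3 \<Rightarrow> real) \<Rightarrow> real" where
  "face_inner x i f g = face_integral x i (\<lambda>y. f y * g y)"

definition L2_inner :: "(real^3) set \<Rightarrow> (real^3 \<Rightarrow> 'u::euclidean_space) \<Rightarrow> (real^3 \<Rightarrow> 'u) \<Rightarrow> real" where
  "L2_inner K f g = (LINT y|lebesgue_on K. f y \<bullet> g y)"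


section \<open>The tensor spaces\<close>

definition sym_matrices :: "(real^3^3) set" where
  "sym_matrices = {A. transpose A = A}"

definition sym_prod :: "real^3 \<Rightarrow> real^3 \<Rightarrow> real^3^3" (infixl \<open>\<odot>\<close> 70) where
  "a \<odot> b = (\<chi> i j. (a $ i * b $ j + b $ i * a $ j) / 2)"

definition T_nn :: "(4 \<Rightarrow> real^3) \<Rightarrow> (4 \<Rightarrow> 4 \<Rightarrow> real^3) \<Rightarrow> 4 \<Rightarrow> real^3^3" where
  "T_nn n e i = (1 / ((n i \<bullet> e (i + 1) (i + 2)) * (n i \<bullet> e (i + 1) (i + 3)))) *\<^sub>R
     (e (i + 1) (i + 2) \<odot> e (i + 1) (i + 3))"

definition T5 :: "(4 \<Rightarrow> 4 \<Rightarrow> real^3) \<Rightarrow> real^3^3" where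
  "T5 e = e 1 2 \<odot> e 3 4"

definition T6 :: "(4 \<Rightarrow> 4 \<Rightarrow> real^3) \<Rightarrow> real^3^3" where
  "T6 e = e 1 3 \<odot> e 2 4"

definition nn_component :: "real^3 \<Rightarrow> (real^3 \<Rightarrow> real^3^3) \<Rightarrow> real^3 \<Rightarrow> real" where
  "nn_component v \<tau> = (\<lambda>y. v \<bullet> (\<tau> y *v v))"

text \<open>\<open>P^{2,1}(T,S)\<close>\<close>

definition P21 :: "(4 \<Rightarrow> real^3) \<Rightarrow> (4 \<Rightarrow> real^3) \<Rightarrow> (real^3 \<Rightarrow> real^3^3) set" where
  "P21 x n = {\<tau> \<in> poly_space 2 (tetra x) sym_matrices.
     \<forall>i. zext (face x i) (nn_component (n i) \<tau>) \<in> poly_space 1 (face x i) UNIV}"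

text \<open>\<open>P^2(T) P^0_{nn}(T;S) = T\<^sub>1 P^2(T) + ... + T\<^sub>4 P^2(T)\<close>\<close>

definition P2_P0nn ::
  "(4 \<Rightarrow> real^3) \<Rightarrow> (4 \<Rightarrow> real^3) \<Rightarrow> (4 \<Rightarrow> 4 \<Rightarrow> real^3) \<Rightarrow> (real^3 \<Rightarrow> real^3^3) set" where
  "P2_P0nn x n e = {(\<lambda>y. \<Sum>i\<in>UNIV. p i y *\<^sub>R T_nn n e i) | p.
     \<forall>i. p i \<in> poly_space 2 (tetra x) UNIV}"

text \<open>\<open>P^0_0(T;S)\<close>, as functions on the tetrahedron\<close>

definition P00 :: "(4 \<Rightarrow> real^3) \<Rightarrow> (4 \<Rightarrow> 4 \<Rightarrow> real^3) \<Rightarrow> (real^3 \<Rightarrow> real^3^3) set" where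
  "P00 x e = poly_space 0 (tetra x) (span {T5 e, T6 e})"

definition X_space ::
  "(4 \<Rightarrow> real^3) \<Rightarrow> (4 \<Rightarrow> real^3) \<Rightarrow> (4 \<Rightarrow> 4 \<Rightarrow> real^3) \<Rightarrow> (real^3 \<Rightarrow> real^3^3) set" where
  "X_space x n e = {\<sigma> + \<rho> | \<sigma> \<rho>. \<sigma> \<in> P2_P0nn x n e \<inter> P21 x n \<and> \<rho> \<in> P00 x e}"


lemma inner_sym_prod: "v \<bullet> ((a \<odot> b) *v v) = (v \<bullet> a) * (v \<bullet> b)"
  by (simp add: sym_prod_def matrix_vector_mult_def inner_vec_def sum_3 add_divide_distrib algebra_simps)

lemma orthogonal_edge:
  assumes "unit_outer_normal x i v" and "unit_edge_vector x i j w \<or> unit_edge_vector x j i w"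
  shows "v \<bullet> w = 0"
proof -
  have "w \<in> span {y - z | y z. y \<in> face x i \<inter> face x j \<and> z \<in> face x i \<inter> face x j}"
    using assms(2) by (auto simp: unit_edge_vector_def Int_commute)
  then have "w \<in> {u. v \<bullet> u = 0}"
    using assms(1) by (elim span_induct) (auto simp: unit_outer_normal_def subspace_hyperplane)
  then show ?thesis by simp
qed

lemma nn_components:
  assumes n: "\<And>i. unit_outer_normal x i (n i)"
    and e: "\<And>i j. i \<noteq> j \<Longrightarrow> unit_edge_vector x i j (e i j)"
  shows "i \<noteq> j \<Longrightarrow> n j \<bullet> (T_nn n e i *v n j) = 0"
    and "n j \<bullet> (T5 e *v n j) = 0" and "n j \<bullet> (T6 e *v n j) = 0"
    and "n i \<bullet> (T_nn n e i *v n i) = 0 \<Longrightarrow> T_nn n e i = 0"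
proof -
  have o: "n j \<bullet> e j k = 0" "n j \<bullet> e k j = 0" if "j \<noteq> k" for j k
    using e[of j k] e[of k j] that by (auto intro: orthogonal_edge[OF n, of j k])
  have mod4: "(5::4) = 1" "(6::4) = 2" "(7::4) = 3"
    by simp_all
  have "\<forall>i j. i \<noteq> j \<longrightarrow> n j \<bullet> (T_nn n e i *v n j) = 0"
    by (simp add: forall_4 T_nn_def scaleR_matrix_vector_assoc[symmetric] inner_sym_prod o mod4)
  then show "i \<noteq> j \<Longrightarrow> n j \<bullet> (T_nn n e i *v n j) = 0" by blast
  have "\<forall>j. n j \<bullet> (T5 e *v n j) = 0" "\<forall>j. n j \<bullet> (T6 e *v n j) = 0"
    unfolding forall_4 by (simp_all add: T5_def T6_def inner_sym_prod o)
  then show "n j \<bullet> (T5 e *v n j) = 0" "n j \<bullet> (T6 e *v n j) = 0" by blast+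
  show "n i \<bullet> (T_nn n e i *v n i) = 0 \<Longrightarrow> T_nn n e i = 0"
    by (auto simp: T_nn_def scaleR_matrix_vector_assoc[symmetric] inner_sym_prod split: if_splits)
qed

text \<open>The sums defining \<open>P2_P0nn\<close> and \<open>X_space\<close> are direct.\<close>

lemma X_space_direct_sum:
  assumes n: "\<And>i. unit_outer_normal x i (n i)"
    and e: "\<And>i j. i \<noteq> j \<Longrightarrow> unit_edge_vector x i j (e i j)"
    and \<rho>: "\<rho> \<in> P00 x e"
    and zero: "(\<lambda>y. \<Sum>i\<in>UNIV. p i y *\<^sub>R T_nn n e i) + \<rho> = 0"
  shows "(\<lambda>y. p i y *\<^sub>R T_nn n e i) = 0" and "\<rho> = 0"
proof -
  note nn = nn_components[of x n e, OF n e]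
  have span: "n j \<bullet> (B *v n j) = 0" if "B \<in> span {T5 e, T6 e}" for B j
  proof -
    have "B \<in> {B. n j \<bullet> (B *v n j) = 0}"
      using that by (elim span_induct)
        (auto simp: subspace_def matrix_vector_mult_add_rdistrib inner_right_distrib
          scaleR_matrix_vector_assoc[symmetric] nn)
    then show ?thesis by simp
  qed
  have \<rho>0: "n j \<bullet> (\<rho> y *v n j) = 0" for j y
  proof -
    have "\<rho> \<in> {r. n j \<bullet> (r y *v n j) = 0}"
      using \<rho> unfolding P00_def poly_space_def
      by (elim span_induct)
        (auto simp: subspace_def zext_def scaleR_fun_def matrix_vector_mult_add_rdistrib
          inner_right_distrib scaleR_matrix_vector_assoc[symmetric] span)
    then show ?thesis by simp
  qed
  have sum_mv: "(\<Sum>i\<in>UNIV. f i) *v w = (\<Sum>i\<in>UNIV. f i *v w)"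
    for f :: "4 \<Rightarrow> real^3^3" and w :: "real^3"
    by (simp add: sum_4 matrix_vector_mult_add_rdistrib)
  have all0: "p j y *\<^sub>R T_nn n e j = 0" for j y
  proof -
    have "(\<Sum>i\<in>UNIV. p i y *\<^sub>R T_nn n e i) + \<rho> y = 0"
      using zero by (simp add: fun_eq_iff)
    then have "0 = n j \<bullet> (((\<Sum>i\<in>UNIV. p i y *\<^sub>R T_nn n e i) + \<rho> y) *v n j)" by simp
    also have "\<dots> = (\<Sum>i\<in>UNIV. p i y * (n j \<bullet> (T_nn n e i *v n j)))"
      by (simp add: matrix_vector_mult_add_rdistrib inner_right_distrib \<rho>0 sum_mv
          scaleR_matrix_vector_assoc[symmetric] inner_sum_right)
    also have "\<dots> = (\<Sum>i\<in>{j}. p i y * (n j \<bullet> (T_nn n e i *v n j)))"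
      by (rule sum.mono_neutral_right) (auto simp: nn(1))
    finally show ?thesis using nn(4)[of j] by auto
  qed
  then show "(\<lambda>y. p i y *\<^sub>R T_nn n e i) = 0" by (simp add: fun_eq_iff)
  show "\<rho> = 0" using zero all0 by (simp add: fun_eq_iff)
qed


section \<open>The degrees of freedom\<close>

text \<open>
  Row-wise divergence on \<open>K\<close>. The derivative is taken within \<open>K\<close> because functions on \<open>K\<close>
  are extended by zero.
\<close>

definition div_on :: "(real^3) set \<Rightarrow> (real^3 \<Rightarrow> real^3^3) \<Rightarrow> real^3 \<Rightarrow> real^3" where
  "div_on K \<tau> = (\<lambda>y. \<chi> i. \<Sum>j\<in>UNIV. frechet_derivative \<tau> (at y within K) (axis j 1) $ i $ j)"

datatype dof =
    Face_Moment 4 "real^3 \<Rightarrow> real"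
  | Const_Moment "real^3 \<Rightarrow> real^3^3"
  | Div_Moment "real^3 \<Rightarrow> real^3"

definition dof_index ::
  "(4 \<Rightarrow> (real^3 \<Rightarrow> real) set) \<Rightarrow> (real^3 \<Rightarrow> real^3^3) set \<Rightarrow> (real^3 \<Rightarrow> real^3) set \<Rightarrow> dof set" where
  "dof_index Q C V = {Face_Moment i q | i q. q \<in> Q i} \<union> Const_Moment ` C \<union> Div_Moment ` V"

fun dof_value :: "(4 \<Rightarrow> real^3) \<Rightarrow> (4 \<Rightarrow> real^3) \<Rightarrow> dof \<Rightarrow> (real^3 \<Rightarrow> real^3^3) \<Rightarrow> real" where
  "dof_value x n (Face_Moment i q) \<tau> = face_area x i * face_inner x i (nn_component (n i) \<tau>) q"
| "dof_value x n (Const_Moment c) \<tau> = L2_inner (tetra x) \<tau> c"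
| "dof_value x n (Div_Moment v) \<tau> = L2_inner (tetra x) (div_on (tetra x) \<tau>) v"

end

theory Submission
  imports Defs
begin

text \<open>
  Writing the normal-normal traces of \<open>\<tau> = \<Sum>\<^sub>i p\<^sub>i T\<^sub>i + \<rho>\<close> as \<open>n\<^sub>j \<cdot> \<tau> n\<^sub>j = p\<^sub>j\<close>, membership in the
  space says that each \<open>p\<^sub>i\<close> is affine up to a multiple of the barycentric coordinate \<open>\<lambda>\<^sub>i\<close>. This leaves
  \<open>7\<close> coefficients for each \<open>p\<^sub>i\<close> and \<open>2\<close> for \<open>\<rho>\<close>, as many as there are functionals, so it suffices to show that
  \<open>\<tau> = 0\<close> if all functionals vanish. The face moments give \<open>p\<^sub>i = \<lambda>\<^sub>i q\<^sub>i\<close> with \<open>q\<^sub>i\<close> affine. Now \<open>div \<tau>\<close> is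
  affine, hence zero, and the mean of \<open>\<tau>\<close> is zero, hence \<open>\<rho> = 0\<close> and \<open>\<integral> \<lambda>\<^sub>i q\<^sub>i = 0\<close> for all \<open>i\<close>. In barycentric
  coordinates these conditions form a linear system for the \<open>16\<close> coefficients of the \<open>q\<^sub>i\<close> that does not depend
  on the tetrahedron, because \<open>\<integral> \<lambda>\<^sub>i\<^sup>2 = 2 \<integral> \<lambda>\<^sub>i \<lambda>\<^sub>j\<close>; it is invariant under cyclic shifts of the vertices
  and nonsingular.
\<close>

subsection \<open>Bases of dual spaces\<close>

text \<open>The count uses only inequalities: 30 independent elements of the space, and spanning
  sets that bound the number of functionals by 30. Injectivity of the evaluation map turns both into
  equalities and gives the dimension together with the dual basis. A face trace, the mean and the
  divergence each lie in the space of their own test functions, so each is tested against itself;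
  this turns vanishing moments into pointwise vanishing. In the final system, four equations are the
  means, and the other twelve pair the divergence at a vertex \<open>x k\<close> with the gradients
  of the three other barycentric coordinates. The tensor \<open>T\<^sub>i\<close> is a product of
  the edges from \<open>x i\<close> to \<open>x (i + 2)\<close> and \<open>x (i + 3)\<close> divided
  by the squared height over face \<open>i\<close>, and a gradient pairs with an edge to 0, 1 or -1.
  Hence dividing the coefficients of \<open>q\<^sub>i\<close> by the squared height removes the
  geometry. Since \<open>T\<^sub>i\<close> omits the edge to \<open>x (i + 1)\<close>, the symmetry
  is cyclic only.\<close>

lemma sum_fun_apply: "(\<Sum>i\<in>I. f i) x = (\<Sum>i\<in>I. f i x)"
  for f :: "'i \<Rightarrow> 'a \<Rightarrow> 'b::comm_monoid_add"
  by (induction I rule: infinite_finite_induct) auto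

lemma span_elem_subspace:
  assumes "v \<in> span S" and "\<And>u. u \<in> S \<Longrightarrow> u \<in> A" and "subspace A"
  shows "v \<in> A"
  using span_minimal[of S A] assms by blast

text \<open>A repeated vector would give the nontrivial relation \<open>f i - f j = 0\<close>, so
  injectivity comes with the independence of a family.\<close>

lemma independent_family:
  fixes f :: "'i \<Rightarrow> 'v::real_vector"
  assumes "finite I" and zero: "\<forall>c. (\<Sum>i\<in>I. c i *\<^sub>R f i) = 0 \<longrightarrow> (\<forall>i\<in>I. c i = 0)"
  shows "inj_on f I" and "independent (f ` I)"
proof -
  show inj: "inj_on f I"
  proof (rule inj_onI, rule ccontr)
    fix i j assume ij: "i \<in> I" "j \<in> I" "f i = f j" "i \<noteq> j"
    define c :: "'i \<Rightarrow> real" where "c k = of_bool (k = i) - of_bool (k = j)" for k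
    have "(\<Sum>k\<in>I. c k *\<^sub>R f k) = (\<Sum>k\<in>I. (if k = i then f i else 0) - (if k = j then f j else 0))"
      by (rule sum.cong) (auto simp: c_def)
    also have "\<dots> = 0"
      using \<open>finite I\<close> ij by (simp add: sum_subtractf)
    finally have "c i = 0" using zero ij by blast
    then show False using ij by (simp add: c_def)
  qed
  show "independent (f ` I)"
    unfolding dependent_finite[OF finite_imageI[OF \<open>finite I\<close>]]
  proof (rule notI, elim exE conjE bexE)
    fix u v assume "v \<in> f ` I" "u v \<noteq> 0" and 0: "(\<Sum>v\<in>f ` I. u v *\<^sub>R v) = 0"
    then obtain i where i: "i \<in> I" "u (f i) \<noteq> 0" by blast
    from 0 have "(\<Sum>k\<in>I. (u \<circ> f) k *\<^sub>R f k) = 0"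
      by (simp add: sum.reindex[OF inj] o_def)
    with zero i show False by (auto simp: o_def)
  qed
qed

lemma linear_on_sum:
  fixes \<phi> :: "'v::real_vector \<Rightarrow> real"
  assumes V: "subspace V" and \<phi>: "\<phi> \<in> dual_space V" and "\<And>i. i \<in> J \<Longrightarrow> f i \<in> V"
  shows "\<phi> (\<Sum>i\<in>J. c i *\<^sub>R f i) = (\<Sum>i\<in>J. c i * \<phi> (f i))"
proof -
  have 0: "\<phi> 0 = 0"
  proof -
    have "\<phi> (0 *\<^sub>R 0) = 0 * \<phi> 0" using \<phi> subspace_0[OF V] unfolding dual_space_def by blast
    then show ?thesis by simp
  qed
  show ?thesis using assms(3)
  proof (induction J rule: infinite_finite_induct)
    case (insert j J)
    have "(\<Sum>i\<in>J. c i *\<^sub>R f i) \<in> V" "c j *\<^sub>R f j \<in> V"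
      using insert by (auto intro!: subspace_sum[OF V] subspace_scale[OF V])
    then have "\<phi> (c j *\<^sub>R f j + (\<Sum>i\<in>J. c i *\<^sub>R f i)) = \<phi> (c j *\<^sub>R f j) + \<phi> (\<Sum>i\<in>J. c i *\<^sub>R f i)"
      using \<phi> unfolding dual_space_def by blast
    moreover have "\<phi> (c j *\<^sub>R f j) = c j * \<phi> (f j)"
      using \<phi> insert.prems unfolding dual_space_def by blast
    ultimately show ?case using insert by simp
  qed (simp_all add: 0)
qed

text \<open>By \<open>ker\<close> the evaluation map into \<open>R^I\<close> is injective, so no
  independent subset of \<open>V\<close> exceeds \<open>card I\<close>; with
  \<open>card I \<le> card B\<close> it is bijective, and the preimages of the unit vectors are dual
  to \<open>\<phi>\<close>. Asking only for an inequality spares the exact dimensions of the test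
  spaces.\<close>

lemma dual_basis_family:
  fixes \<phi> :: "'i \<Rightarrow> 'v::real_vector \<Rightarrow> real"
  assumes V: "subspace V" and I: "finite I" and \<phi>: "\<And>i. i \<in> I \<Longrightarrow> \<phi> i \<in> dual_space V"
    and ker: "\<And>v. v \<in> V \<Longrightarrow> (\<And>i. i \<in> I \<Longrightarrow> \<phi> i v = 0) \<Longrightarrow> v = 0"
    and B: "B \<subseteq> V" "independent B" "finite B" "card I \<le> card B"
  shows "is_basis_family \<phi> I (dual_space V)" and "dim V = card B"
proof -
  \<comment> \<open>\<open>E i\<close> are the unit vectors of \<open>R^I\<close>, encoded as
    functions vanishing outside \<open>I\<close>, and \<open>L\<close> is the evaluation
    map.\<close>
  define E :: "'i \<Rightarrow> 'i \<Rightarrow> real" where "E i = (\<lambda>j. of_bool (j = i))" for i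
  define L where "L v = (\<lambda>i. if i \<in> I then \<phi> i v else 0)" for v
  have expand: "f = (\<Sum>i\<in>I. f i *\<^sub>R E i)" if "\<And>j. j \<notin> I \<Longrightarrow> f j = 0" for f
  proof
    fix j
    have "(\<Sum>i\<in>I. f i *\<^sub>R E i) j = (\<Sum>i\<in>I. if j = i then f i else 0)"
      unfolding sum_fun_apply by (rule sum.cong) (auto simp: E_def scaleR_fun_def)
    then show "f j = (\<Sum>i\<in>I. f i *\<^sub>R E i) j"
      using that I by simp
  qed
  have in_span: "f \<in> span (E ` I)" if "\<And>j. j \<notin> I \<Longrightarrow> f j = 0" for f
    by (subst expand[OF that]) (simp, intro span_sum span_scale span_base imageI)
  have L_sum: "L (\<Sum>v\<in>A. c v *\<^sub>R v) = (\<Sum>v\<in>A. c v *\<^sub>R L v)" if "A \<subseteq> V" for A c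
    using that by (auto simp: L_def fun_eq_iff sum_fun_apply scaleR_fun_def
        intro!: linear_on_sum[OF V \<phi>])
  have L_0: "v = 0" if "v \<in> V" "L v = 0" for v
  proof (rule ker[OF that(1)])
    fix i assume "i \<in> I"
    then have "\<phi> i v = L v i" by (simp add: L_def)
    then show "\<phi> i v = 0" using that(2) by simp
  qed
  have indep: "inj_on L A \<and> independent (L ` A)" if "A \<subseteq> V" "independent A" "finite A" for A
  proof -
    have "c v = 0" if "(\<Sum>v\<in>A. c v *\<^sub>R L v) = 0" "v \<in> A" for c v
    proof -
      have "(\<Sum>v\<in>A. c v *\<^sub>R v) = 0"
        using that \<open>A \<subseteq> V\<close> by (intro L_0) (auto simp: L_sum intro!: subspace_sum[OF V] subspace_scale[OF V])
      then show ?thesis using \<open>independent A\<close> that(2) unfolding dependent_finite[OF \<open>finite A\<close>] by blast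
    qed
    then have "\<forall>c. (\<Sum>v\<in>A. c v *\<^sub>R L v) = 0 \<longrightarrow> (\<forall>v\<in>A. c v = 0)" by blast
    from independent_family[OF \<open>finite A\<close> this] show ?thesis by blast
  qed
  have L_span: "L ` A \<subseteq> span (E ` I)" for A
    by (auto intro!: in_span simp: L_def)
  have card_E: "card (E ` I) \<le> card I" using I by (rule card_image_le)
  have bound: "card A \<le> card I" if "A \<subseteq> V" "independent A" "finite A" for A
  proof -
    have "card (L ` A) \<le> card (E ` I)"
      using independent_span_bound[of "E ` I" "L ` A"] indep[OF that] L_span[of A] I by simp
    then show ?thesis using card_image[of L A] indep[OF that] card_E by linarith
  qed
  \<comment> \<open>The two bounds meet, so \<open>B\<close> cannot be enlarged within
    \<open>V\<close> and must span it.\<close>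
  have card_B: "card B = card I" using bound[OF B(1-3)] B(4) by simp
  have V_span: "V \<subseteq> span B"
  proof (rule ccontr)
    assume "\<not> V \<subseteq> span B"
    then obtain v where v: "v \<in> V" "v \<notin> span B" by blast
    then have "v \<notin> B" using span_base[of v B] by blast
    have "card (insert v B) \<le> card I"
      using v B by (intro bound) (auto simp: independent_insert)
    then show False using card_B \<open>v \<notin> B\<close> B(3) by simp
  qed
  show "dim V = card B" using B V_span by (intro dim_unique) auto
  have onto: "E i \<in> span (L ` B)" if "i \<in> I" for i
  proof (rule ccontr)
    assume not: "E i \<notin> span (L ` B)"
    have "card (insert (E i) (L ` B)) \<le> card (E ` I)"
    proof -
      have "independent (insert (E i) (L ` B))"
        using not indep[OF B(1-3)] by (intro independent_insertI) auto
      moreover have "insert (E i) (L ` B) \<subseteq> span (E ` I)"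
        using L_span[of B] that by (intro insert_subsetI span_base imageI)
      ultimately show ?thesis
        using independent_span_bound[OF finite_imageI[OF I]] by blast
    qed
    moreover have "E i \<notin> L ` B" using not span_base[of "E i" "L ` B"] by blast
    moreover have "card (L ` B) = card B" using indep[OF B(1-3)] card_image[of L B] by blast
    ultimately show False using card_E card_B B(3) by simp
  qed
  have "\<exists>v\<in>V. \<forall>j\<in>I. \<phi> j v = of_bool (j = i)" if i: "i \<in> I" for i
  proof -
    obtain u where u: "E i = (\<Sum>f\<in>L ` B. u f *\<^sub>R f)"
      using onto[OF i] B(3) by (auto simp: span_finite)
    have "E i = (\<Sum>v\<in>B. u (L v) *\<^sub>R L v)"
      using u sum.reindex[of L B "\<lambda>f. u f *\<^sub>R f"] indep[OF B(1-3)] unfolding o_def by metis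
    also have "\<dots> = L (\<Sum>v\<in>B. u (L v) *\<^sub>R v)" using B(1) by (rule L_sum[symmetric])
    finally have "L (\<Sum>v\<in>B. u (L v) *\<^sub>R v) = E i" ..
    moreover have "(\<Sum>v\<in>B. u (L v) *\<^sub>R v) \<in> V"
      using B(1) by (auto intro!: subspace_sum[OF V] subspace_scale[OF V])
    moreover have "\<phi> j w = of_bool (j = i)" if "L w = E i" "j \<in> I" for j w
      using fun_cong[OF that(1), of j] that(2) by (simp add: L_def E_def)
    ultimately show ?thesis by blast
  qed
  \<comment> \<open>\<open>w\<close> is the basis of \<open>V\<close> dual to \<open>\<phi>\<close>:
    it yields the independence of \<open>\<phi>\<close> and the coefficients
    \<open>\<psi> (w i)\<close> of any functional \<open>\<psi>\<close>.\<close>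
  then obtain w where w: "\<And>i. i \<in> I \<Longrightarrow> w i \<in> V"
    "\<And>i j. i \<in> I \<Longrightarrow> j \<in> I \<Longrightarrow> \<phi> j (w i) = of_bool (j = i)" by metis
  have "c i = 0" if "(\<Sum>i\<in>I. c i *\<^sub>R \<phi> i) = 0" "i \<in> I" for c i
  proof -
    have "0 = (\<Sum>j\<in>I. c j *\<^sub>R \<phi> j) (w i)" using that by simp
    also have "\<dots> = (\<Sum>j\<in>I. if i = j then c j else 0)"
      unfolding sum_fun_apply using that w by (intro sum.cong) (auto simp: scaleR_fun_def)
    also have "\<dots> = c i" using I that by simp
    finally show ?thesis by simp
  qed
  then have "\<forall>c. (\<Sum>i\<in>I. c i *\<^sub>R \<phi> i) = 0 \<longrightarrow> (\<forall>i\<in>I. c i = 0)" by blast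
  note ind = independent_family[OF I this]
  have "\<psi> \<in> span (\<phi> ` I)" if \<psi>: "\<psi> \<in> dual_space V" for \<psi>
  proof -
    have "\<psi> v = (\<Sum>i\<in>I. \<psi> (w i) *\<^sub>R \<phi> i) v" for v
    proof (cases "v \<in> V")
      case True
      \<comment> \<open>\<open>v'\<close> is the expansion of \<open>v\<close> in the dual basis;
        all \<open>\<phi> j\<close> agree on both vectors, so \<open>ker\<close> identifies
        them.\<close>
      define v' where "v' = (\<Sum>i\<in>I. \<phi> i v *\<^sub>R w i)"
      have v': "v' \<in> V" unfolding v'_def using w by (auto intro!: subspace_sum[OF V] subspace_scale[OF V])
      have eq: "\<phi> j v' = \<phi> j v" if "j \<in> I" for j
      proof -
        have "\<phi> j v' = (\<Sum>i\<in>I. \<phi> i v * \<phi> j (w i))"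
          unfolding v'_def using w that by (intro linear_on_sum[OF V \<phi>]) auto
        also have "\<dots> = (\<Sum>i\<in>I. if j = i then \<phi> i v else 0)"
          using w that by (intro sum.cong) auto
        finally show ?thesis using I that by simp
      qed
      have "v - v' = 0"
      proof (rule ker)
        show "v - v' \<in> V" using True v' subspace_diff[OF V] by blast
        fix j assume j: "j \<in> I"
        have "\<phi> j (v + (-1) *\<^sub>R v') = \<phi> j v + \<phi> j ((-1) *\<^sub>R v')"
          using \<phi>[OF j] True v' subspace_scale[OF V v'] unfolding dual_space_def by blast
        also have "\<phi> j ((-1) *\<^sub>R v') = (-1) * \<phi> j v'"
          using \<phi>[OF j] v' unfolding dual_space_def by blast
        finally show "\<phi> j (v - v') = 0" using eq[OF j] by simp
      qed
      then have "\<psi> v = \<psi> (\<Sum>i\<in>I. \<phi> i v *\<^sub>R w i)" by (simp add: v'_def)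
      also have "\<dots> = (\<Sum>i\<in>I. \<phi> i v * \<psi> (w i))"
        using w by (intro linear_on_sum[OF V \<psi>]) auto
      finally show ?thesis by (simp add: sum_fun_apply scaleR_fun_def mult.commute)
    next
      case False
      then have "\<psi> v = 0" "\<And>i. i \<in> I \<Longrightarrow> \<phi> i v = 0"
        using \<psi> \<phi> unfolding dual_space_def by blast+
      then show ?thesis by (simp add: sum_fun_apply scaleR_fun_def)
    qed
    then have "\<psi> = (\<Sum>i\<in>I. \<psi> (w i) *\<^sub>R \<phi> i)" by blast
    also have "\<dots> \<in> span (\<phi> ` I)" by (intro span_sum span_scale span_base imageI)
    finally show ?thesis .
  qed
  moreover have "subspace (dual_space V)"
    unfolding subspace_def by (auto simp: dual_space_def scaleR_fun_def algebra_simps)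
  moreover have "\<phi> ` I \<subseteq> dual_space V" using \<phi> by blast
  ultimately have "span (\<phi> ` I) = dual_space V" by (intro subset_antisym span_minimal) auto
  then show "is_basis_family \<phi> I (dual_space V)"
    using ind by (simp add: is_basis_family_def is_basis_def)
qed

lemma is_basis_exists:
  assumes "subspace V"
  shows "\<exists>B. is_basis B V"
proof -
  obtain B where "B \<subseteq> V" "independent B" "V \<subseteq> span B" using maximal_independent_subset[of V] .
  then show ?thesis using span_minimal[OF _ assms, of B] by (auto simp: is_basis_def)
qed

lemma basis_card_le:
  assumes "is_basis B V" "V \<subseteq> span S" "finite S" "card S \<le> N"
  shows "finite B \<and> card B \<le> N"
proof -
  have "B \<subseteq> span S" using assms(1,2) span_superset[of B] by (auto simp: is_basis_def)
  then show ?thesis using independent_span_bound[OF assms(3), of B] assms(1,4) by (auto simp: is_basis_def)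
qed

subsection \<open>Integrals of continuous functions\<close>

lemma integrable_continuous_on_compact:
  fixes f :: "'a::euclidean_space \<Rightarrow> 'b::euclidean_space"
  assumes "compact K" "continuous_on K f"
  shows "integrable (lebesgue_on K) f"
proof -
  have K: "K \<in> sets lebesgue" using assms(1) by (simp add: lmeasurable_compact fmeasurableD)
  have "integrable lborel (\<lambda>x. indicator K x *\<^sub>R f x)"
    using borel_integrable_compact[OF assms] by simp
  then have "integrable lebesgue (\<lambda>x. indicator K x *\<^sub>R f x)"
    by (simp add: integrable_completion)
  then show ?thesis using K by (simp add: integrable_restrict_space)
qed

text \<open>The interior points with \<open>f y \<noteq> 0\<close> form an open null set, hence none
  exist; convexity makes the interior dense in \<open>K\<close>, and continuity carries the zero to
  the boundary. Boundary points matter because the result is applied at vertices.\<close>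

lemma integral_continuous_nonneg_eq_0:
  fixes f :: "'a::euclidean_space \<Rightarrow> real"
  assumes K: "compact K" "convex K" "interior K \<noteq> {}" and f: "continuous_on K f"
    and nonneg: "\<And>y. y \<in> K \<Longrightarrow> f y \<ge> 0" and zero: "(LINT y|lebesgue_on K. f y) = 0" and y: "y \<in> K"
  shows "f y = 0"
proof -
  have meas: "K \<in> sets lebesgue" using K(1) by (simp add: lmeasurable_compact fmeasurableD)
  have "AE y in lebesgue_on K. f y = 0"
  proof -
    have "AE y in lebesgue_on K. 0 \<le> f y" using nonneg by (intro AE_I2) simp
    then show ?thesis
      using zero integral_nonneg_eq_0_iff_AE[OF integrable_continuous_on_compact[OF K(1) f]] by blast
  qed
  then have "AE y in lebesgue. y \<in> K \<longrightarrow> f y = 0"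
    using meas by (subst (asm) AE_restrict_space_iff) auto
  then obtain N where N: "N \<in> null_sets lebesgue" "{y. \<not> (y \<in> K \<longrightarrow> f y = 0)} \<subseteq> N"
    by (auto simp: eventually_ae_filter)
  define O' where "O' = {y \<in> interior K. f y \<in> - {0}}"
  have "negligible N" using N(1) by (simp add: negligible_iff_null_sets)
  moreover have "O' \<subseteq> N" using N(2) interior_subset by (force simp: O'_def)
  ultimately have "negligible O'" by (rule negligible_subset)
  moreover have "open O'"
  proof -
    have "continuous_on (interior K) f" using f interior_subset by (rule continuous_on_subset)
    then have "open (interior K \<inter> f -` (- {0}))"
      by (intro continuous_open_preimage) auto
    also have "interior K \<inter> f -` (- {0}) = O'" by (auto simp: O'_def)
    finally show ?thesis .
  qed
  ultimately have "O' = {}" using open_not_negligible by blast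
  then have "interior K \<subseteq> K \<inter> f -` {0}" using interior_subset by (auto simp: O'_def)
  moreover have "closed (K \<inter> f -` {0})"
    using f K(1) by (intro continuous_closed_preimage) (auto simp: compact_imp_closed)
  ultimately have "closure (interior K) \<subseteq> K \<inter> f -` {0}" by (rule closure_minimal)
  then show ?thesis
    using convex_closure_interior[OF K(2,3)] y closure_subset[of K] by blast
qed

text \<open>The boundary of a convex set is a null set, so the divergence has to be computed only at
  interior points.\<close>

lemma AE_interior_convex:
  fixes K :: "'a::euclidean_space set"
  assumes "compact K" "convex K"
  shows "AE y in lebesgue_on K. y \<in> interior K"
proof -
  have meas: "K \<in> sets lebesgue" using assms(1) by (simp add: lmeasurable_compact fmeasurableD)
  have "frontier K \<in> null_sets lebesgue"
    using negligible_convex_frontier[OF assms(2)] by (simp add: negligible_iff_null_sets)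
  then have "AE y in lebesgue. y \<notin> frontier K" by (rule AE_not_in)
  then have "AE y in lebesgue. y \<in> K \<longrightarrow> y \<in> interior K"
    by (rule AE_mp) (use closure_subset in \<open>auto simp: frontier_def intro!: AE_I2\<close>)
  then show ?thesis using meas by (subst AE_restrict_space_iff) auto
qed

lemma integral_continuous_on_compact:
  fixes f :: "'a::euclidean_space \<Rightarrow> real"
  assumes "compact K" "continuous_on K f"
  shows "f absolutely_integrable_on K" "integral K f = (LINT y|lebesgue_on K. f y)"
proof -
  have K: "K \<in> sets lebesgue" using assms(1) by (simp add: lmeasurable_compact fmeasurableD)
  note int = integrable_continuous_on_compact[OF assms]
  then show "f absolutely_integrable_on K" using K by (simp add: set_integrable_def integrable_restrict_space)
  show "integral K f = (LINT y|lebesgue_on K. f y)" using lebesgue_integral_eq_integral[OF int K] by simp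
qed

lemma integral_affine_image:
  fixes g :: "real^3 \<Rightarrow> real^3" and f :: "real^3 \<Rightarrow> real"
  assumes S: "compact S" and g: "\<And>y. (g has_derivative g') (at y)" and inj: "inj_on g S"
    and f: "continuous_on (g ` S) f"
  shows "integral (g ` S) f = \<bar>det (matrix g')\<bar> * integral S (\<lambda>y. f (g y))"
proof -
  have gc: "continuous_on S g"
    using g by (intro continuous_at_imp_continuous_on ballI has_derivative_continuous)
  have "compact (g ` S)" using compact_continuous_image[OF gc S] .
  then have "f absolutely_integrable_on (g ` S)" using f by (rule integral_continuous_on_compact(1))
  \<comment> \<open>The change of variables formula concerns vector-valued integrands, so
    \<open>f\<close> is viewed as a map into \<open>real^1\<close>.\<close>
  then have int: "(\<lambda>y. vec (f y) :: real^1) absolutely_integrable_on (g ` S)"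
    by (simp add: absolutely_integrable_on_1_iff)
  have "S \<in> sets lebesgue" using S by (simp add: lmeasurable_compact fmeasurableD)
  from integral_change_of_variables[OF this has_derivative_at_withinI[OF g] inj disjI1[OF int]]
  have "integral (g ` S) (\<lambda>y. vec (f y) :: real^1) = integral S (\<lambda>y. \<bar>det (matrix g')\<bar> *\<^sub>R (vec (f (g y)) :: real^1))"
    by simp
  then show ?thesis by (simp add: integral_on_1_eq vec_eq_iff)
qed

text \<open>Determinant of the identity plus a rank-one matrix; it supplies the volume factor of
  \<open>halving\<close>.\<close>

lemma det_rank_one:
  fixes u w :: "real^3"
  shows "det (matrix (\<lambda>v. v + (w \<bullet> v) *\<^sub>R u)) = 1 + w \<bullet> u"
  by (simp add: det_3 matrix_def inner_axis axis_def inner_vec_def sum_3) (simp add: algebra_simps)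

text \<open>Completeness of Lebesgue measure. It makes the divergence measurable on the closed
  tetrahedron although its values are computed in the interior only.\<close>

lemma borel_measurable_AE_cong_lebesgue_on:
  fixes f g :: "'a::euclidean_space \<Rightarrow> 'b::topological_space"
  assumes S: "S \<in> sets lebesgue" and f: "f \<in> borel_measurable (lebesgue_on S)"
    and ae: "AE y in lebesgue_on S. f y = g y"
  shows "g \<in> borel_measurable (lebesgue_on S)"
proof (rule measurableI)
  fix A :: "'b set" assume A: "A \<in> sets borel"
  have iff: "B \<in> sets (lebesgue_on S) \<longleftrightarrow> B \<subseteq> S \<and> B \<in> sets lebesgue" for B
    using S by (subst sets_restrict_space_iff) simp_all
  have "f -` A \<inter> space (lebesgue_on S) \<in> sets (lebesgue_on S)" using f A by (rule measurable_sets)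
  then have "f -` A \<inter> S \<in> sets lebesgue" by (simp only: iff space_lebesgue_on)
  moreover have "AE y in lebesgue. y \<in> S \<longrightarrow> f y = g y"
    using ae S by (subst (asm) AE_restrict_space_iff) auto
  then have "AE y in lebesgue. y \<in> f -` A \<inter> S \<longleftrightarrow> y \<in> g -` A \<inter> S" by (rule AE_mp) (rule AE_I2, auto)
  ultimately have "g -` A \<inter> S \<in> sets lebesgue"
    using completion.in_sets_AE[where A = "f -` A \<inter> S" and B = "g -` A \<inter> S" and M = lborel] by simp
  then show "g -` A \<inter> space (lebesgue_on S) \<in> sets (lebesgue_on S)"
    by (simp only: iff space_lebesgue_on Int_lower2)
qed simp

text \<open>Continuity belongs to the set because additivity of the integral needs integrable
  summands.\<close>

lemma subspace_L2_annihilator: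
  fixes F :: "'a::euclidean_space \<Rightarrow> 'b::euclidean_space"
  assumes "compact K" "continuous_on K F"
  shows "subspace {c. continuous_on K c \<and> (LINT y|lebesgue_on K. F y \<bullet> c y) = 0}"
proof -
  have int: "integrable (lebesgue_on K) (\<lambda>y. F y \<bullet> c y)" if "continuous_on K c" for c
    by (intro integrable_continuous_on_compact continuous_intros assms that)
  show ?thesis
    unfolding subspace_def
    by (auto simp: zero_fun_def plus_fun_def scaleR_fun_def inner_add_right int intro!: continuous_intros)
qed

text \<open>Passes from the basis functions to all of \<open>V\<close>, in particular to the
  polynomial that is to be shown zero.\<close>

lemma L2_annihilator:
  fixes F :: "'a::euclidean_space \<Rightarrow> 'b::euclidean_space"
  assumes "is_basis B V" "compact K" "continuous_on K F"
    and "\<And>c. c \<in> V \<Longrightarrow> continuous_on K c" "\<And>c. c \<in> B \<Longrightarrow> (LINT y|lebesgue_on K. F y \<bullet> c y) = 0"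
    and "c \<in> V"
  shows "(LINT y|lebesgue_on K. F y \<bullet> c y) = 0"
proof -
  have c: "c \<in> span B" using assms(1,6) by (simp add: is_basis_def)
  have "B \<subseteq> V" using assms(1) span_superset by (auto simp: is_basis_def)
  then have "c \<in> {c. continuous_on K c \<and> (LINT y|lebesgue_on K. F y \<bullet> c y) = 0}"
    by (intro span_elem_subspace[OF c _ subspace_L2_annihilator[OF assms(2,3)]]) (auto simp: assms(4,5))
  then show ?thesis by simp
qed

subsection \<open>Polynomial spaces\<close>

lemma zext_plus: "zext K (\<lambda>y. f y + g y) = zext K f + (zext K g :: _ \<Rightarrow> 'b::monoid_add)"
  by (auto simp: zext_def fun_eq_iff)

lemma zext_scaleR: "zext K (\<lambda>y. c *\<^sub>R f y) = c *\<^sub>R (zext K f :: _ \<Rightarrow> 'b::real_vector)"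
  by (auto simp: zext_def fun_eq_iff scaleR_fun_def)

lemma zext_sum_scaleR: "zext K (\<lambda>y. \<Sum>i\<in>I. c i *\<^sub>R f i y) = (\<Sum>i\<in>I. c i *\<^sub>R zext K (f i))"
  by (auto simp: zext_def fun_eq_iff sum_fun_apply scaleR_fun_def)

lemma zext_cong: "(\<And>y. y \<in> K \<Longrightarrow> f y = g y) \<Longrightarrow> zext K f = zext K g"
  by (auto simp: zext_def fun_eq_iff)

lemma zext_eqD: "zext K f = zext K g \<Longrightarrow> y \<in> K \<Longrightarrow> f y = g y"
  by (auto simp: zext_def fun_eq_iff split: if_splits)

lemma subspace_poly_space: "subspace (poly_space k K U)"
  by (simp add: poly_space_def)

lemma subspace_zext_poly_space:
  "subspace {f :: real^3 \<Rightarrow> 'b::real_vector. zext K f \<in> poly_space k K U}"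
proof -
  have "zext K 0 = (0 :: real^3 \<Rightarrow> 'b)" by (auto simp: zext_def)
  moreover have "zext K (f + g) = zext K f + zext K g" "zext K (c *\<^sub>R f) = c *\<^sub>R zext K f"
    for f g :: "real^3 \<Rightarrow> 'b" and c by (auto simp: zext_def scaleR_fun_def)
  ultimately show ?thesis
    using subspace_poly_space[of k K U] by (auto simp: subspace_def)
qed

lemma poly_space_const: "u \<in> U \<Longrightarrow> zext K (\<lambda>_. u) \<in> poly_space k K U"
  unfolding poly_space_def by (intro span_base CollectI exI[of _ "\<lambda>_. 0"] exI[of _ u]) simp

lemma poly_space_coord: "zext K (\<lambda>y. y $ i) \<in> poly_space 1 K (UNIV :: real set)"
proof -
  have "(\<Prod>j\<in>UNIV. (y $ j) ^ of_bool (j = i)) *\<^sub>R (1::real) = y $ i" for y :: "real^3"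
  proof -
    have "(\<Prod>j\<in>UNIV. (y $ j) ^ of_bool (j = i)) = (\<Prod>j\<in>UNIV. if j = i then y $ j else 1)"
      by (rule prod.cong) auto
    then show ?thesis by simp
  qed
  then show ?thesis
    unfolding poly_space_def
    by (intro span_base CollectI exI[of _ "\<lambda>j. of_bool (j = i)"] exI[of _ 1]) simp
qed

lemma poly_space_mono:
  assumes "k \<le> l" shows "poly_space k K U \<subseteq> poly_space l K U"
  unfolding poly_space_def using assms by (intro span_mono) fastforce

text \<open>The product is bilinear and exponents of monomials add; the span is exhausted first in
  \<open>g\<close>, with a monomial multiple in place of \<open>f\<close>, and then in
  \<open>f\<close>.\<close>

lemma poly_space_times:
  assumes "f \<in> poly_space k K (UNIV :: real set)" "g \<in> poly_space l K U"
  shows "(\<lambda>y. f y *\<^sub>R g y) \<in> poly_space (k + l) K U"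
proof -
  note sp = subspace_poly_space[of "k + l" K U]
  have gen: "(\<lambda>y. zext K (\<lambda>y. (\<Prod>i\<in>UNIV. (y $ i) ^ \<alpha> i) *\<^sub>R c) y *\<^sub>R
      zext K (\<lambda>y. (\<Prod>i\<in>UNIV. (y $ i) ^ \<beta> i) *\<^sub>R u) y) \<in> poly_space (k + l) K U"
    if "sum \<alpha> UNIV \<le> k" "sum \<beta> UNIV \<le> l" "u \<in> U" for \<alpha> \<beta> :: "3 \<Rightarrow> nat" and c :: real and u
  proof -
    have "zext K (\<lambda>y. (\<Prod>i\<in>UNIV. (y $ i) ^ (\<alpha> i + \<beta> i)) *\<^sub>R u) \<in> poly_space (k + l) K U"
      unfolding poly_space_def using that
      by (intro span_base CollectI exI[of _ "\<lambda>i. \<alpha> i + \<beta> i"] exI[of _ u]) (simp add: sum.distrib)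
    then have "c *\<^sub>R zext K (\<lambda>y. (\<Prod>i\<in>UNIV. (y $ i) ^ (\<alpha> i + \<beta> i)) *\<^sub>R u) \<in> poly_space (k + l) K U"
      by (rule subspace_scale[OF sp])
    also have "c *\<^sub>R zext K (\<lambda>y. (\<Prod>i\<in>UNIV. (y $ i) ^ (\<alpha> i + \<beta> i)) *\<^sub>R u) =
      (\<lambda>y. zext K (\<lambda>y. (\<Prod>i\<in>UNIV. (y $ i) ^ \<alpha> i) *\<^sub>R c) y *\<^sub>R
      zext K (\<lambda>y. (\<Prod>i\<in>UNIV. (y $ i) ^ \<beta> i) *\<^sub>R u) y)"
      by (auto simp: zext_def fun_eq_iff scaleR_fun_def power_add prod.distrib)
    finally show ?thesis .
  qed
  have add: "(\<lambda>y. f y + g y) \<in> poly_space (k + l) K U"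
    if "f \<in> poly_space (k + l) K U" "g \<in> poly_space (k + l) K U" for f g
    using subspace_add[OF sp that] by (simp add: plus_fun_def)
  have scale: "(\<lambda>y. c *\<^sub>R f y) \<in> poly_space (k + l) K U" if "f \<in> poly_space (k + l) K U" for f c
    using subspace_scale[OF sp that] by (simp add: scaleR_fun_def)
  have scale': "(\<lambda>y. (c * F y) *\<^sub>R f y) \<in> poly_space (k + l) K U"
    if "(\<lambda>y. F y *\<^sub>R f y) \<in> poly_space (k + l) K U" for F f c
    using scale[OF that, of c] by simp
  have zero: "(\<lambda>y. 0) \<in> poly_space (k + l) K U"
    using subspace_0[OF sp] by (simp add: zero_fun_def)
  have gen': "(\<lambda>y. zext K (\<lambda>y. (\<Prod>i\<in>UNIV. (y $ i) ^ \<alpha> i) *\<^sub>R c) y *\<^sub>R g y) \<in> poly_space (k + l) K U"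
    if \<alpha>: "sum \<alpha> UNIV \<le> k" for \<alpha> :: "3 \<Rightarrow> nat" and c :: real
  proof -
    have "g \<in> {g. (\<lambda>y. zext K (\<lambda>y. (\<Prod>i\<in>UNIV. (y $ i) ^ \<alpha> i) *\<^sub>R c) y *\<^sub>R g y) \<in> poly_space (k + l) K U}"
      using assms(2) unfolding poly_space_def[of l]
    proof (rule span_elem_subspace)
      fix g assume "g \<in> {zext K (\<lambda>x. (\<Prod>i\<in>UNIV. (x $ i) ^ \<alpha> i) *\<^sub>R u) |\<alpha> u. sum \<alpha> UNIV \<le> l \<and> u \<in> U}"
      then show "g \<in> {g. (\<lambda>y. zext K (\<lambda>y. (\<Prod>i\<in>UNIV. (y $ i) ^ \<alpha> i) *\<^sub>R c) y *\<^sub>R g y) \<in> poly_space (k + l) K U}"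
        using gen[OF \<alpha>] by auto
    next
      show "subspace {g. (\<lambda>y. zext K (\<lambda>y. (\<Prod>i\<in>UNIV. (y $ i) ^ \<alpha> i) *\<^sub>R c) y *\<^sub>R g y) \<in> poly_space (k + l) K U}"
        unfolding subspace_def
      proof (intro conjI ballI allI)
        fix a f assume "f \<in> {g. (\<lambda>y. zext K (\<lambda>y. (\<Prod>i\<in>UNIV. (y $ i) ^ \<alpha> i) *\<^sub>R c) y *\<^sub>R g y) \<in> poly_space (k + l) K U}"
        then show "a *\<^sub>R f \<in> {g. (\<lambda>y. zext K (\<lambda>y. (\<Prod>i\<in>UNIV. (y $ i) ^ \<alpha> i) *\<^sub>R c) y *\<^sub>R g y) \<in> poly_space (k + l) K U}"
          using scale'[of "zext K (\<lambda>y. (\<Prod>i\<in>UNIV. (y $ i) ^ \<alpha> i) *\<^sub>R c)" f a]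
          by (simp add: scaleR_fun_def mult.commute)
      qed (use add zero in \<open>simp_all add: scaleR_add_right\<close>)
    qed
    then show ?thesis by simp
  qed
  have "f \<in> {f. (\<lambda>y. f y *\<^sub>R g y) \<in> poly_space (k + l) K U}"
    using assms(1) unfolding poly_space_def[of k]
  proof (rule span_elem_subspace)
    fix f assume "f \<in> {zext K (\<lambda>x. (\<Prod>i\<in>UNIV. (x $ i) ^ \<alpha> i) *\<^sub>R u) |\<alpha> u. sum \<alpha> UNIV \<le> k \<and> u \<in> (UNIV :: real set)}"
    then show "f \<in> {f. (\<lambda>y. f y *\<^sub>R g y) \<in> poly_space (k + l) K U}" using gen' by auto
  next
    show "subspace {f. (\<lambda>y. f y *\<^sub>R g y) \<in> poly_space (k + l) K U}"
      unfolding subspace_def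
      using add scale' zero by (simp add: scaleR_fun_def scaleR_add_left)
  qed
  then show ?thesis by simp
qed

lemma zext_poly_space_times:
  assumes "zext K f \<in> poly_space k K (UNIV :: real set)" "zext K g \<in> poly_space l K U" "k + l = m"
  shows "zext K (\<lambda>y. f y *\<^sub>R g y) \<in> poly_space m K U"
proof -
  have "zext K (\<lambda>y. f y *\<^sub>R g y) = (\<lambda>y. zext K f y *\<^sub>R zext K g y)" by (auto simp: zext_def)
  then show ?thesis using poly_space_times[OF assms(1,2)] assms(3) by simp
qed

lemma zext_poly_space_sum:
  assumes "\<And>i. i \<in> I \<Longrightarrow> zext K (f i) \<in> poly_space k K U"
  shows "zext K (\<lambda>y. \<Sum>i\<in>I. f i y) \<in> poly_space k K U"
proof -
  have "(\<lambda>y. \<Sum>i\<in>I. f i y) = (\<Sum>i\<in>I. f i)" by (simp add: sum_fun_apply fun_eq_iff)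
  then show ?thesis using subspace_sum[OF subspace_zext_poly_space[of K k U], of I f] assms by simp
qed

lemma poly_space_0_const:
  assumes "subspace U" "f \<in> poly_space 0 K U"
  obtains u where "u \<in> U" "f = zext K (\<lambda>_. u)"
proof -
  have "f \<in> {f. \<exists>u\<in>U. f = zext K (\<lambda>_. u)}" (is "f \<in> ?A")
    using assms(2) unfolding poly_space_def
  proof (rule span_elem_subspace)
    fix g assume "g \<in> {zext K (\<lambda>x. (\<Prod>i\<in>UNIV. (x $ i) ^ \<alpha> i) *\<^sub>R u) |\<alpha> u. sum \<alpha> UNIV \<le> 0 \<and> u \<in> U}"
    then obtain \<alpha> u where g: "g = zext K (\<lambda>x. (\<Prod>i\<in>UNIV. (x $ i) ^ \<alpha> i) *\<^sub>R u)" "sum \<alpha> UNIV \<le> 0" "u \<in> U" by blast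
    have "g = zext K (\<lambda>_. u)" using g by simp
    then show "g \<in> ?A" using g(3) by blast
  next
    show "subspace ?A" unfolding subspace_def
    proof (intro conjI ballI allI)
      show "0 \<in> ?A" using subspace_0[OF assms(1)] by (auto simp: zext_def fun_eq_iff intro!: bexI[of _ 0])
    next
      fix f g assume "f \<in> ?A" "g \<in> ?A"
      then obtain u v where "u \<in> U" "v \<in> U" "f = zext K (\<lambda>_. u)" "g = zext K (\<lambda>_. v)" by blast
      then show "f + g \<in> ?A"
        using subspace_add[OF assms(1)] by (auto simp: zext_plus[symmetric] intro!: bexI[of _ "u + v"])
    next
      fix c f assume "f \<in> ?A"
      then obtain u where "u \<in> U" "f = zext K (\<lambda>_. u)" by blast
      then show "c *\<^sub>R f \<in> ?A"
        using subspace_scale[OF assms(1)] by (auto simp: zext_scaleR[symmetric] intro!: bexI[of _ "c *\<^sub>R u"])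
    qed
  qed
  then show ?thesis using that by blast
qed

subsection \<open>Symmetric matrices\<close>

lemma subspace_sym_matrices: "subspace sym_matrices"
  by (auto simp: subspace_def sym_matrices_def transpose_def vec_eq_iff)

lemma sym_prod_in_sym_matrices: "a \<odot> b \<in> sym_matrices"
  by (simp add: sym_matrices_def sym_prod_def transpose_def vec_eq_iff mult.commute add.commute)

lemma sym_prod_mult: "(a \<odot> b) *v w = (1/2) *\<^sub>R ((b \<bullet> w) *\<^sub>R a + (a \<bullet> w) *\<^sub>R b)"
  by (simp add: vec_eq_iff sym_prod_def matrix_vector_mult_def inner_vec_def sum_3 field_simps)

lemma sym_prod_scaleR: "(c *\<^sub>R a) \<odot> (d *\<^sub>R b) = (c * d) *\<^sub>R (a \<odot> b)"
  by (simp add: vec_eq_iff sym_prod_def field_simps)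

lemma sym_prod_commute: "a \<odot> b = b \<odot> a"
  by (simp add: vec_eq_iff sym_prod_def field_simps)

lemma sum_matrix_vector: "(\<Sum>i\<in>I. f i) *v w = (\<Sum>i\<in>I. f i *v w)" for f :: "'i \<Rightarrow> real^3^3"
  by (induction I rule: infinite_finite_induct) (auto simp: matrix_vector_mult_add_rdistrib)

subsection \<open>Four cyclic indices\<close>

lemma four_indices: "(UNIV :: 4 set) = {i, i + 1, i + 2, i + 3}" "distinct [i, i + 1, i + 2, i + 3]"
proof -
  show d: "distinct [i, i + 1, i + 2, i + 3]" by simp
  have "card (set [i, i + 1, i + 2, i + 3]) = card (UNIV :: 4 set)"
    unfolding distinct_card[OF d] by simp
  then have "set [i, i + 1, i + 2, i + 3] = UNIV" by (intro card_subset_eq) auto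
  then show "(UNIV :: 4 set) = {i, i + 1, i + 2, i + 3}" by simp
qed

text \<open>Listing the residues from \<open>0\<close> avoids the second name \<open>4\<close> of
  the same index.\<close>

lemma UNIV_4_from_0: "(UNIV :: 4 set) = {0, 1, 2, 3}"
  using four_indices(1)[of 0] by simp

lemma forall_4_from_0: "(\<forall>i::4. P i) \<longleftrightarrow> P 0 \<and> P 1 \<and> P 2 \<and> P 3"
  using UNIV_4_from_0 by (metis UNIV_I empty_iff insert_iff)

lemma sum_4_from_0: "(\<Sum>i\<in>(UNIV :: 4 set). f i) = f 0 + f 1 + f 2 + f 3"
  unfolding UNIV_4_from_0 by (simp add: add.assoc)

lemma mod_4_numerals: "(4 :: 4) = 0" "(5 :: 4) = 1" "(6 :: 4) = 2" "(7 :: 4) = 3"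
  by simp_all

text \<open>Adding a constant to both indices permutes the hypotheses among themselves, so it
  suffices to solve for the row \<open>a 0\<close>. The equations \<open>0\<close> will be the
  means; \<open>1\<close>, \<open>2\<close> and \<open>3\<close> will be the divergence at
  \<open>x (j + 1)\<close>, \<open>x (j + 2)\<close> and \<open>x (j + 3)\<close> paired with the
  gradient of \<open>bary j\<close>.\<close>

lemma cyclic_linear_system:
  fixes a :: "4 \<Rightarrow> 4 \<Rightarrow> real"
  assumes 0: "\<And>j. (\<Sum>m\<in>UNIV. a j m) + a j j = 0"
    and 1: "\<And>j. 2 * a j (j + 1) - 2 * a (j + 1) (j + 1) + a (j + 1) (j + 3) - a (j + 2) (j + 1) = 0"
    and 2: "\<And>j. 2 * a j (j + 2) - a (j + 1) (j + 2) + a (j + 2) (j + 1) - 2 * a (j + 2) (j + 2) = 0"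
    and 3: "\<And>j. 2 * a j (j + 3) - a (j + 1) (j + 3) - a (j + 2) (j + 3) = 0"
  shows "a i m = 0"
proof -
  have row: "a 0 m = 0"
    if 0: "\<And>j. (\<Sum>m\<in>UNIV. a j m) + a j j = 0"
      and 1: "\<And>j. 2 * a j (j + 1) - 2 * a (j + 1) (j + 1) + a (j + 1) (j + 3) - a (j + 2) (j + 1) = 0"
      and 2: "\<And>j. 2 * a j (j + 2) - a (j + 1) (j + 2) + a (j + 2) (j + 1) - 2 * a (j + 2) (j + 2) = 0"
      and 3: "\<And>j. 2 * a j (j + 3) - a (j + 1) (j + 3) - a (j + 2) (j + 3) = 0"
    for a :: "4 \<Rightarrow> 4 \<Rightarrow> real" and m
  proof -
    define e0 where "e0 j = (\<Sum>m\<in>UNIV. a j m) + a j j" for j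
    define e1 where "e1 j = 2 * a j (j + 1) - 2 * a (j + 1) (j + 1) + a (j + 1) (j + 3) - a (j + 2) (j + 1)" for j
    define e2 where "e2 j = 2 * a j (j + 2) - a (j + 1) (j + 2) + a (j + 2) (j + 1) - 2 * a (j + 2) (j + 2)" for j
    define e3 where "e3 j = 2 * a j (j + 3) - a (j + 1) (j + 3) - a (j + 2) (j + 3)" for j
    have z: "e0 j = 0" "e1 j = 0" "e2 j = 0" "e3 j = 0" for j
      unfolding e0_def e1_def e2_def e3_def by (rule 0 1 2 3)+
    note e = e0_def e1_def e2_def e3_def sum_4_from_0
    text \<open>The coefficients are rows of the inverse of the system matrix.\<close>
    have c0: "160 * a 0 0 = - 7 * e1 0 - e2 0 - 29 * e3 0 - 41 * e3 1 + 5 * e1 1 - 29 * e2 1 - 25 * e2 2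
        - 5 * e3 2 - 31 * e1 2 - 3 * e1 3 + 43 * e2 3 + 47 * e3 3 + 52 * e0 0 + 36 * e0 1 + 4 * e0 2
        - 60 * e0 3"
      unfolding e by (simp add: mod_4_numerals algebra_simps)
    have c1: "15 * a 0 1 = 7 * e1 0 + 11 * e2 0 + 14 * e3 0 + e3 1 + 5 * e1 1 + 4 * e2 1 - 10 * e2 2
        - 10 * e3 2 + e1 2 - 7 * e1 3 - 8 * e2 3 - 2 * e3 3 - 17 * e0 0 - e0 1 + 16 * e0 2
        + 5 * e0 3"
      unfolding e by (simp add: mod_4_numerals algebra_simps)
    have c2: "40 * a 0 2 = - 23 * e1 0 - 9 * e2 0 - 21 * e3 0 + 31 * e3 1 + 5 * e1 1 + 19 * e2 1
        + 15 * e2 2 - 5 * e3 2 + e1 2 + 13 * e1 3 - 13 * e2 3 - 17 * e3 3 + 28 * e0 0 - 36 * e0 1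
        - 4 * e0 2 + 20 * e0 3"
      unfolding e by (simp add: mod_4_numerals algebra_simps)
    have c3: "240 * a 0 3 = 47 * e1 0 - 119 * e2 0 - 11 * e3 0 - 79 * e3 1 - 125 * e1 1 - 91 * e2 1
        + 145 * e2 2 + 205 * e3 2 + 71 * e1 2 + 43 * e1 3 + 77 * e2 3 - 7 * e3 3 + 188 * e0 0
        + 124 * e0 1 - 244 * e0 2 - 20 * e0 3"
      unfolding e by (simp add: mod_4_numerals algebra_simps)
    have "\<forall>m. a 0 m = 0" unfolding forall_4_from_0 using c0 c1 c2 c3 by (simp add: z)
    then show ?thesis ..
  qed
  \<comment> \<open>The shifted array satisfies the same system, and its entry in row
    \<open>0\<close> and column \<open>m - i\<close> is \<open>a i m\<close>.\<close>
  have "(\<lambda>p q. a (p + i) (q + i)) 0 (m - i) = 0"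
  proof (rule row[of "\<lambda>p q. a (p + i) (q + i)" "m - i"])
    fix j
    have "(\<Sum>m\<in>UNIV. a (j + i) (m + i)) = (\<Sum>m\<in>UNIV. a (j + i) m)"
      by (rule sum.reindex_bij_witness[of _ "\<lambda>m. m - i" "\<lambda>m. m + i"]) auto
    then show "(\<Sum>m\<in>UNIV. a (j + i) (m + i)) + a (j + i) (j + i) = 0" using 0[of "j + i"] by simp
  qed (use 1[of "_ + i"] 2[of "_ + i"] 3[of "_ + i"] in \<open>simp_all add: add_ac\<close>)
  then show ?thesis by simp
qed

subsection \<open>The reference triangle\<close>

lemma compact_reference_triangle: "compact reference_triangle"
proof -
  have eq: "reference_triangle = {p. 0 \<le> fst p} \<inter> {p. 0 \<le> snd p} \<inter> {p. fst p + snd p \<le> 1}"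
    by (auto simp: reference_triangle_def)
  have "closed reference_triangle"
    unfolding eq by (intro closed_Int closed_Collect_le continuous_intros)
  moreover have "reference_triangle \<subseteq> cbox (0, 0) (1, 1)"
    by (auto simp: reference_triangle_def cbox_Pair_eq)
  ultimately show ?thesis using compact_cbox by (metis compact_Int_closed inf.absorb_iff2)
qed

lemma convex_reference_triangle: "convex reference_triangle"
proof (rule convexI)
  fix p q :: "real \<times> real" and u v :: real
  assume pq: "p \<in> reference_triangle" "q \<in> reference_triangle" and uv: "0 \<le> u" "0 \<le> v" "u + v = 1"
  obtain a b c d where p: "p = (a, b)" and q: "q = (c, d)" by (cases p; cases q)
  have "u * (a + b) + v * (c + d) \<le> u * 1 + v * 1"
    using pq uv by (intro add_mono mult_left_mono) (auto simp: reference_triangle_def p q)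
  then have "u * a + v * c + (u * b + v * d) \<le> 1" using uv by (simp add: algebra_simps)
  then show "u *\<^sub>R p + v *\<^sub>R q \<in> reference_triangle"
    using pq uv by (auto simp: reference_triangle_def p q)
qed

lemma interior_reference_triangle: "interior reference_triangle \<noteq> {}"
proof -
  let ?U = "{p :: real \<times> real. 0 < fst p} \<inter> {p. 0 < snd p} \<inter> {p. fst p + snd p < 1}"
  have "open ?U" by (intro open_Int open_Collect_less continuous_intros)
  moreover have "(1/4, 1/4) \<in> ?U" by simp
  moreover have "?U \<subseteq> reference_triangle" by (auto simp: reference_triangle_def)
  ultimately have "(1/4, 1/4) \<in> interior reference_triangle" by (rule interiorI)
  then show ?thesis by blast
qed

locale tetrahedron =
  fixes x n :: "4 \<Rightarrow> real^3" and e :: "4 \<Rightarrow> 4 \<Rightarrow> real^3"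
  assumes normal: "\<And>i. unit_outer_normal x i (n i)"
    and edge: "\<And>i j. i \<noteq> j \<Longrightarrow> unit_edge_vector x i j (e i j)"
begin

subsection \<open>Barycentric coordinates\<close>

definition height :: "4 \<Rightarrow> real" where
  "height i = n i \<bullet> (x (i + 1) - x i)"

definition bary_grad :: "4 \<Rightarrow> real^3" where
  "bary_grad i = (- 1 / height i) *\<^sub>R n i"

text \<open>Distance to the plane of \<open>face x i\<close>, which contains the base point
  \<open>x (i + 1)\<close>, divided by the height of \<open>x i\<close>. Building it from the normal
  makes positivity and the equation of the face direct consequences of
  \<open>unit_outer_normal\<close>.\<close>

definition bary :: "4 \<Rightarrow> real^3 \<Rightarrow> real" where
  "bary i y = bary_grad i \<bullet> (y - x (i + 1))"

lemma vertex_in_face: "j \<noteq> i \<Longrightarrow> x j \<in> face x i"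
  unfolding face_def by (rule hull_inc) auto

lemma height_pos: "height i > 0"
proof -
  have "i + 1 \<noteq> i" by simp
  then show ?thesis using normal[of i] vertex_in_face[of "i+1" i]
    unfolding unit_outer_normal_def height_def by blast
qed

lemma normal_vertices: "n i \<bullet> (x j - x k) = height i * (of_bool (k = i) - of_bool (j = i))"
proof -
  have same: "n i \<bullet> (x a - x b) = 0" if "a \<noteq> i" "b \<noteq> i" for a b
    using normal[of i] vertex_in_face that unfolding unit_outer_normal_def by blast
  have *: "n i \<bullet> (x a - x i) = height i" if "a \<noteq> i" for a
  proof -
    have "n i \<bullet> (x a - x i) = n i \<bullet> (x a - x (i + 1)) + height i"
      by (simp add: height_def inner_diff_right)
    then show ?thesis using same[OF that, of "i+1"] by simp
  qed
  have **: "n i \<bullet> (x i - x a) = - height i" if "a \<noteq> i" for a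
    using *[OF that] by (simp add: inner_diff_right)
  show ?thesis using same * ** by auto
qed

lemma bary_grad_vertices: "bary_grad i \<bullet> (x j - x k) = of_bool (j = i) - of_bool (k = i)"
  using height_pos[of i] by (simp add: bary_grad_def normal_vertices)

lemma bary_vertex: "bary i (x j) = of_bool (j = i)"
  by (simp add: bary_def bary_grad_vertices)

lemma bary_diff: "bary i y - bary i z = bary_grad i \<bullet> (y - z)"
  by (simp add: bary_def inner_diff_right)

lemma bary_add: "bary i (y + v) = bary i y + bary_grad i \<bullet> v"
  by (simp add: bary_def inner_diff_right inner_add_right)

text \<open>The gradients are biorthogonal to the three edges at \<open>x 0\<close>, so these edges
  are independent and span the whole space.\<close>

lemma bary_grad_separating:
  assumes "\<And>j. w \<bullet> (x j - x 0) = 0"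
  shows "w = 0"
proof -
  let ?f = "\<lambda>j::4. x j - x 0"
  have "c j = 0" if "(\<Sum>i\<in>{1,2,3}. c i *\<^sub>R ?f i) = 0" "j \<in> {1,2,3}" for c and j :: 4
  proof -
    have "0 = bary_grad j \<bullet> (\<Sum>i\<in>{1,2,3}. c i *\<^sub>R ?f i)" by (simp add: that)
    also have "\<dots> = c j"
      using that(2) by (auto simp: inner_sum_right inner_add_right bary_grad_vertices)
    finally show ?thesis by simp
  qed
  then have "\<forall>c. (\<Sum>i\<in>{1,2,3}. c i *\<^sub>R ?f i) = 0 \<longrightarrow> (\<forall>i\<in>{1,2,3}. c i = 0)" by blast
  note ind = independent_family[OF _ this]
  have "card (?f ` {1,2,3}) = 3" using card_image[OF ind(1)] by simp
  then have "dim (?f ` {1,2,3}) = DIM(real^3)" using ind(2)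
    by (simp add: dim_eq_card_independent)
  then have "span (?f ` {1,2,3}) = UNIV" by (simp only: dim_eq_full)
  then have "w \<in> span (?f ` {1,2,3})" by simp
  then have "w \<in> {v. w \<bullet> v = 0}"
    by (elim span_induct) (auto simp: assms subspace_hyperplane)
  then show ?thesis by simp
qed

lemma bary_grad_sum: "(\<Sum>i\<in>UNIV. bary_grad i) = 0"
  by (rule bary_grad_separating) (auto simp: inner_sum_left bary_grad_vertices sum_subtractf)

text \<open>This is the derivative of \<open>bary_expansion\<close>. The proof goes through the
  transpose: any \<open>w\<close> is the combination of the gradients with coefficients
  \<open>w \<bullet> x i\<close>, since both sides agree on all edges at \<open>x 0\<close>.\<close>

lemma vector_expansion: "v = (\<Sum>i\<in>UNIV. (bary_grad i \<bullet> v) *\<^sub>R x i)"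
proof -
  have "w \<bullet> v = w \<bullet> (\<Sum>i\<in>UNIV. (bary_grad i \<bullet> v) *\<^sub>R x i)" for w
  proof -
    have "(w - (\<Sum>i\<in>UNIV. (w \<bullet> x i) *\<^sub>R bary_grad i)) \<bullet> (x j - x 0) = 0" for j
    proof -
      have "(\<Sum>i\<in>UNIV. (w \<bullet> x i) *\<^sub>R bary_grad i) \<bullet> (x j - x 0)
        = (\<Sum>i\<in>UNIV. (if j = i then w \<bullet> x i else 0) - (if 0 = i then w \<bullet> x i else 0))"
        unfolding inner_sum_left inner_scaleR_left bary_grad_vertices
        by (rule sum.cong) auto
      also have "\<dots> = w \<bullet> (x j - x 0)" by (simp add: sum_subtractf inner_diff_right)
      finally show ?thesis by (simp only: inner_diff_left[of w] diff_self)
    qed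
    then have "w = (\<Sum>i\<in>UNIV. (w \<bullet> x i) *\<^sub>R bary_grad i)"
      using bary_grad_separating[of "w - (\<Sum>i\<in>UNIV. (w \<bullet> x i) *\<^sub>R bary_grad i)"] by simp
    then have "w \<bullet> v = (\<Sum>i\<in>UNIV. (w \<bullet> x i) *\<^sub>R bary_grad i) \<bullet> v" by (rule arg_cong[where f = "\<lambda>w. w \<bullet> v"])
    then show ?thesis by (simp only: inner_sum_left inner_sum_right inner_scaleR_left inner_scaleR_right mult.commute)
  qed
  then show ?thesis by (subst vector_eq_ldot[symmetric]) blast
qed

lemma bary_grad_eq_0: "(\<And>i. bary_grad i \<bullet> v = 0) \<Longrightarrow> v = 0"
  using vector_expansion[of v] by simp

lemma bary_sum: "(\<Sum>i\<in>UNIV. bary i y) = 1"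
proof -
  have "(\<Sum>i\<in>UNIV. bary i y) = (\<Sum>i\<in>UNIV. bary i (x 0)) + (\<Sum>i\<in>UNIV. bary_grad i) \<bullet> (y - x 0)"
    by (simp add: inner_sum_left sum.distrib[symmetric] bary_diff[symmetric])
  then show ?thesis by (simp add: bary_grad_sum bary_vertex)
qed

lemma bary_expansion: "(\<Sum>i\<in>UNIV. bary i y *\<^sub>R x i) = y"
proof -
  have "(\<Sum>i\<in>UNIV. bary i y *\<^sub>R x i) = (\<Sum>i\<in>UNIV. bary i (x 0) *\<^sub>R x i) + (\<Sum>i\<in>UNIV. (bary_grad i \<bullet> (y - x 0)) *\<^sub>R x i)"
    by (simp only: sum.distrib[symmetric] scaleR_add_left[symmetric] bary_diff[symmetric]) simp
  also have "(\<Sum>i\<in>UNIV. (bary_grad i \<bullet> (y - x 0)) *\<^sub>R x i) = y - x 0"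
    by (rule vector_expansion[symmetric])
  also have "(\<Sum>i\<in>UNIV. bary i (x 0) *\<^sub>R x i) = (\<Sum>i\<in>UNIV. if 0 = i then x i else 0)"
    by (rule sum.cong) (auto simp: bary_vertex)
  finally show ?thesis by simp
qed

text \<open>A point is the combination of the vertices weighted by its barycentric coordinates. A
  general index set \<open>J\<close> covers the tetrahedron and its faces at once.\<close>

lemma convex_hull_bary: "convex hull (x ` J) = {y. (\<forall>i. 0 \<le> bary i y) \<and> (\<forall>i. i \<notin> J \<longrightarrow> bary i y = 0)}" (is "_ = ?R")
proof
  have conv: "bary i (u *\<^sub>R y + v *\<^sub>R z) = u * bary i y + v * bary i z" if "u + v = 1" for i u v y z
  proof -
    have "u *\<^sub>R y + v *\<^sub>R z - x (i + 1) = u *\<^sub>R (y - x (i + 1)) + v *\<^sub>R (z - x (i + 1))"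
      using that by (simp add: algebra_simps flip: scaleR_add_left)
    then show ?thesis by (simp add: bary_def inner_add_right)
  qed
  have "convex ?R" by (rule convexI) (simp add: conv)
  moreover have "x ` J \<subseteq> ?R" by (auto simp: bary_vertex)
  ultimately show "convex hull (x ` J) \<subseteq> ?R" by (rule hull_minimal[rotated])
  show "?R \<subseteq> convex hull (x ` J)"
  proof
    fix y assume y: "y \<in> ?R"
    have "(\<Sum>i\<in>J. bary i y *\<^sub>R x i) \<in> convex hull (x ` J)"
    proof (rule convex_sum)
      have "(\<Sum>i\<in>UNIV. bary i y) = (\<Sum>i\<in>J. bary i y)"
        using y by (intro sum.mono_neutral_right) auto
      then show "(\<Sum>i\<in>J. bary i y) = 1" by (simp add: bary_sum)
    qed (use y in \<open>auto simp: hull_inc\<close>)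
    also have "(\<Sum>i\<in>J. bary i y *\<^sub>R x i) = (\<Sum>i\<in>UNIV. bary i y *\<^sub>R x i)"
      using y by (intro sum.mono_neutral_left) auto
    finally show "y \<in> convex hull (x ` J)" by (simp add: bary_expansion)
  qed
qed

lemma tetra_bary: "tetra x = {y. \<forall>i. 0 \<le> bary i y}"
  unfolding tetra_def convex_hull_bary by simp

lemma face_bary: "face x i = {y \<in> tetra x. bary i y = 0}"
  unfolding face_def convex_hull_bary tetra_bary by auto

subsection \<open>Polynomials in barycentric coordinates\<close>

lemma zext_bary: "zext K (bary i) \<in> poly_space 1 K (UNIV :: real set)"
proof -
  have "bary i = (\<lambda>y. (\<Sum>j\<in>UNIV. (bary_grad i $ j) *\<^sub>R (y $ j)) + bary i 0)"
  proof
    fix y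
    show "bary i y = (\<Sum>j\<in>UNIV. (bary_grad i $ j) *\<^sub>R (y $ j)) + bary i 0"
      using bary_diff[of i y 0] by (simp add: inner_vec_def)
  qed
  moreover have "zext K (\<lambda>y. (\<Sum>j\<in>UNIV. (bary_grad i $ j) *\<^sub>R (y $ j)) + bary i 0) \<in> poly_space 1 K (UNIV :: real set)"
    unfolding zext_plus
    by (intro subspace_add[OF subspace_poly_space] zext_poly_space_sum poly_space_const)
      (auto simp only: zext_scaleR intro!: subspace_scale[OF subspace_poly_space] poly_space_coord)
  ultimately show ?thesis by simp
qed

lemma zext_bary_scaleR: "u \<in> U \<Longrightarrow> zext K (\<lambda>y. bary i y *\<^sub>R u) \<in> poly_space 1 K U"
  by (rule zext_poly_space_times[OF zext_bary poly_space_const]) auto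

lemma zext_bary_bary_scaleR: "u \<in> U \<Longrightarrow> zext K (\<lambda>y. (bary i y * bary j y) *\<^sub>R u) \<in> poly_space 2 K U"
  using zext_poly_space_times[OF zext_bary zext_bary_scaleR, where m = 2] by simp

lemma coord_bary: "y $ k = (\<Sum>i\<in>UNIV. bary i y * x i $ k)"
  using arg_cong[OF bary_expansion[of y], of "\<lambda>v. v $ k"] by simp

text \<open>As the barycentric coordinates sum to 1, constants are linear forms in them too, and
  affine functions become homogeneous of degree 1.\<close>

lemma monomial_1:
  assumes "(\<Sum>i\<in>UNIV. \<alpha> i) \<le> 1"
  shows "\<exists>c. \<forall>y :: real^3. (\<Prod>i\<in>UNIV. (y $ i) ^ \<alpha> i) = (\<Sum>i\<in>UNIV. bary i y * c i)"
proof -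
  have "(\<alpha> = (\<lambda>_. 0)) \<or> (\<exists>k. \<forall>i. \<alpha> i = of_bool (i = k))"
  proof (cases "\<forall>i. \<alpha> i = 0")
    case False
    then obtain k where k: "\<alpha> k > 0" by auto
    have "(\<Sum>i\<in>UNIV. \<alpha> i) = \<alpha> k + (\<Sum>i\<in>UNIV - {k}. \<alpha> i)" by (simp add: sum.remove)
    then have "\<alpha> k = 1" "(\<Sum>i\<in>UNIV - {k}. \<alpha> i) = 0" using assms k by linarith+
    then have "\<forall>i. \<alpha> i = of_bool (i = k)" by auto
    then show ?thesis by blast
  qed auto
  then show ?thesis
  proof
    assume "\<alpha> = (\<lambda>_. 0)"
    then show ?thesis using bary_sum by (intro exI[of _ "\<lambda>_. 1"]) simp
  next
    assume "\<exists>k. \<forall>i. \<alpha> i = of_bool (i = k)"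
    then obtain k where k: "\<forall>i. \<alpha> i = of_bool (i = k)" ..
    have "(\<Prod>i\<in>UNIV. (y $ i) ^ \<alpha> i) = (\<Prod>i\<in>UNIV. if i = k then y $ i else 1)" for y :: "real^3"
      using k by (intro prod.cong) auto
    then show ?thesis by (intro exI[of _ "\<lambda>i. x i $ k"]) (simp add: coord_bary[symmetric])
  qed
qed

text \<open>A monomial of degree at most 2 is a product of two of degree at most 1; expanding the
  product gives a form homogeneous of degree 2.\<close>

lemma monomial_2:
  assumes "(\<Sum>i\<in>UNIV. \<alpha> i) \<le> 2"
  shows "\<exists>c. \<forall>y :: real^3. (\<Prod>i\<in>UNIV. (y $ i) ^ \<alpha> i) = (\<Sum>i\<in>UNIV. \<Sum>j\<in>UNIV. c i j * (bary i y * bary j y))"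
proof -
  have "\<exists>\<beta> \<gamma>. (\<forall>i. \<alpha> i = \<beta> i + \<gamma> i) \<and> (\<Sum>i\<in>UNIV. \<beta> i) \<le> 1 \<and> (\<Sum>i\<in>UNIV. \<gamma> i) \<le> 1"
  proof (cases "\<forall>i. \<alpha> i = 0")
    case True
    then show ?thesis by (intro exI[of _ "\<lambda>_. 0"]) simp
  next
    case False
    then obtain k where k: "\<alpha> k > 0" by auto
    \<comment> \<open>One factor \<open>y $ k\<close> is split off; the remaining exponents have sum
      at most 1.\<close>
    define \<beta> where "\<beta> i = (of_bool (i = k) :: nat)" for i
    have "\<alpha> i = \<beta> i + (\<alpha> i - \<beta> i)" for i using k by (auto simp: \<beta>_def)
    moreover have "sum \<beta> UNIV = 1" by (simp add: \<beta>_def)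
    moreover from calculation have "sum \<alpha> UNIV = sum \<beta> UNIV + (\<Sum>i\<in>UNIV. \<alpha> i - \<beta> i)"
      by (metis (mono_tags, lifting) sum.cong sum.distrib)
    ultimately show ?thesis using assms by (intro exI[of _ \<beta>] exI[of _ "\<lambda>i. \<alpha> i - \<beta> i"]) auto
  qed
  then obtain \<beta> \<gamma> where \<alpha>: "\<And>i. \<alpha> i = \<beta> i + \<gamma> i" and \<beta>\<gamma>: "sum \<beta> UNIV \<le> 1" "sum \<gamma> UNIV \<le> 1" by blast
  obtain b where b: "\<And>y :: real^3. (\<Prod>i\<in>UNIV. (y $ i) ^ \<beta> i) = (\<Sum>i\<in>UNIV. bary i y * b i)"
    using monomial_1[OF \<beta>\<gamma>(1)] by blast
  obtain c where c: "\<And>y :: real^3. (\<Prod>i\<in>UNIV. (y $ i) ^ \<gamma> i) = (\<Sum>i\<in>UNIV. bary i y * c i)"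
    using monomial_1[OF \<beta>\<gamma>(2)] by blast
  have "(\<Prod>i\<in>UNIV. (y $ i) ^ \<alpha> i) = (\<Sum>i\<in>UNIV. \<Sum>j\<in>UNIV. (b i * c j) * (bary i y * bary j y))" for y :: "real^3"
  proof -
    have "(\<Prod>i\<in>UNIV. (y $ i) ^ \<alpha> i) = (\<Sum>i\<in>UNIV. bary i y * b i) * (\<Sum>j\<in>UNIV. bary j y * c j)"
      by (simp only: \<alpha> power_add prod.distrib b c)
    also have "\<dots> = (\<Sum>i\<in>UNIV. \<Sum>j\<in>UNIV. (b i * c j) * (bary i y * bary j y))"
      unfolding sum_product by (intro sum.cong refl) (simp only: mult_ac)
    finally show ?thesis .
  qed
  then show ?thesis by (intro exI[of _ "\<lambda>i j. b i * c j"]) simp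
qed

lemma poly_space_1_bary:
  assumes "subspace U" "f \<in> poly_space 1 K U"
  obtains w where "\<And>i. w i \<in> U" "f = zext K (\<lambda>y. \<Sum>i\<in>UNIV. bary i y *\<^sub>R w i)"
proof -
  have "f \<in> {f. \<exists>w. (\<forall>i. w i \<in> U) \<and> f = zext K (\<lambda>y. \<Sum>i\<in>UNIV. bary i y *\<^sub>R w i)}" (is "f \<in> ?A")
    using assms(2) unfolding poly_space_def
  proof (rule span_elem_subspace)
    fix g assume "g \<in> {zext K (\<lambda>x. (\<Prod>i\<in>UNIV. (x $ i) ^ \<alpha> i) *\<^sub>R u) |\<alpha> u. sum \<alpha> UNIV \<le> 1 \<and> u \<in> U}"
    then obtain \<alpha> u where g: "g = zext K (\<lambda>x. (\<Prod>i\<in>UNIV. (x $ i) ^ \<alpha> i) *\<^sub>R u)" "sum \<alpha> UNIV \<le> 1" "u \<in> U" by blast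
    obtain c where c: "\<And>y :: real^3. (\<Prod>i\<in>UNIV. (y $ i) ^ \<alpha> i) = (\<Sum>i\<in>UNIV. bary i y * c i)"
      using monomial_1[OF g(2)] by blast
    have "g = zext K (\<lambda>y. \<Sum>i\<in>UNIV. bary i y *\<^sub>R (c i *\<^sub>R u))"
      by (simp add: g(1) c scaleR_sum_left)
    moreover have "c i *\<^sub>R u \<in> U" for i using assms(1) g(3) by (rule subspace_scale)
    ultimately show "g \<in> ?A" by (intro CollectI exI[of _ "\<lambda>i. c i *\<^sub>R u"]) blast
  next
    show "subspace ?A" unfolding subspace_def
    proof (intro conjI ballI allI)
      show "0 \<in> ?A" using subspace_0[OF assms(1)] by (auto simp: zext_def fun_eq_iff intro!: exI[of _ "\<lambda>_. 0"])
    next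
      fix f g assume "f \<in> ?A" "g \<in> ?A"
      then obtain w w' where "\<forall>i. w i \<in> U" "f = zext K (\<lambda>y. \<Sum>i\<in>UNIV. bary i y *\<^sub>R w i)"
        "\<forall>i. w' i \<in> U" "g = zext K (\<lambda>y. \<Sum>i\<in>UNIV. bary i y *\<^sub>R w' i)" by blast
      then show "f + g \<in> ?A"
        by (auto simp: zext_plus[symmetric] scaleR_add_right sum.distrib
            intro!: exI[of _ "\<lambda>i. w i + w' i"] subspace_add[OF assms(1)])
    next
      fix c f assume "f \<in> ?A"
      then obtain w where "\<forall>i. w i \<in> U" "f = zext K (\<lambda>y. \<Sum>i\<in>UNIV. bary i y *\<^sub>R w i)" by blast
      then show "c *\<^sub>R f \<in> ?A"
        by (auto simp: zext_scaleR[symmetric] scaleR_sum_right mult.commute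
            intro!: exI[of _ "\<lambda>i. c *\<^sub>R w i"] subspace_scale[OF assms(1)])
    qed
  qed
  then show ?thesis using that by blast
qed

lemma poly_space_2_bary:
  assumes "f \<in> poly_space 2 K (UNIV :: real set)"
  obtains c where "f = zext K (\<lambda>y. \<Sum>i\<in>UNIV. \<Sum>j\<in>UNIV. c i j * (bary i y * bary j y))"
proof -
  have "f \<in> {f. \<exists>c. f = zext K (\<lambda>y. \<Sum>i\<in>UNIV. \<Sum>j\<in>UNIV. c i j * (bary i y * bary j y))}" (is "f \<in> ?A")
    using assms unfolding poly_space_def
  proof (rule span_elem_subspace)
    fix g assume "g \<in> {zext K (\<lambda>x. (\<Prod>i\<in>UNIV. (x $ i) ^ \<alpha> i) *\<^sub>R u) |\<alpha> u. sum \<alpha> UNIV \<le> 2 \<and> u \<in> (UNIV::real set)}"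
    then obtain \<alpha> u where g: "g = zext K (\<lambda>x. (\<Prod>i\<in>UNIV. (x $ i) ^ \<alpha> i) *\<^sub>R u)" "sum \<alpha> UNIV \<le> 2" by blast
    obtain c where c: "\<And>y :: real^3. (\<Prod>i\<in>UNIV. (y $ i) ^ \<alpha> i) = (\<Sum>i\<in>UNIV. \<Sum>j\<in>UNIV. c i j * (bary i y * bary j y))"
      using monomial_2[OF g(2)] by blast
    have "g = zext K (\<lambda>y. \<Sum>i\<in>UNIV. \<Sum>j\<in>UNIV. (u * c i j) * (bary i y * bary j y))"
      by (simp add: g(1) c sum_distrib_left sum_distrib_right mult_ac)
    then show "g \<in> ?A" by (intro CollectI exI[of _ "\<lambda>i j. u * c i j"])
  next
    show "subspace ?A" unfolding subspace_def
    proof (intro conjI ballI allI)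
      show "0 \<in> ?A" by (auto simp: zext_def fun_eq_iff intro!: exI[of _ "\<lambda>_ _. 0"])
    next
      fix f g assume "f \<in> ?A" "g \<in> ?A"
      then obtain w w' where "f = zext K (\<lambda>y. \<Sum>i\<in>UNIV. \<Sum>j\<in>UNIV. w i j * (bary i y * bary j y))"
        "g = zext K (\<lambda>y. \<Sum>i\<in>UNIV. \<Sum>j\<in>UNIV. w' i j * (bary i y * bary j y))" by blast
      then show "f + g \<in> ?A"
        by (auto simp: zext_plus[symmetric] distrib_right sum.distrib
            intro!: exI[of _ "\<lambda>i j. w i j + w' i j"])
    next
      fix c f assume "f \<in> ?A"
      then obtain w where "f = zext K (\<lambda>y. \<Sum>i\<in>UNIV. \<Sum>j\<in>UNIV. w i j * (bary i y * bary j y))" by blast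
      then show "c *\<^sub>R f \<in> ?A"
        by (auto simp: zext_scaleR[symmetric] sum_distrib_left mult.assoc
            intro!: exI[of _ "\<lambda>i j. c * w i j"])
    qed
  qed
  then show ?thesis using that by blast
qed

text \<open>The case \<open>j = k\<close> is the vertex itself, so vertices and midpoints are
  handled as one kind of sample point.\<close>

lemma midpoint_bary: "bary i ((1/2) *\<^sub>R x j + (1/2) *\<^sub>R x k) = (of_bool (j = i) + of_bool (k = i)) / 2"
proof -
  have "bary i (x k + (1/2) *\<^sub>R (x j - x k)) = (of_bool (j = i) + of_bool (k = i)) / 2"
    unfolding bary_add inner_scaleR_right bary_grad_vertices bary_vertex by (simp add: field_simps)
  moreover have "x k + (1/2) *\<^sub>R (x j - x k) = (1/2) *\<^sub>R x j + (1/2) *\<^sub>R x k"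
    by (simp add: scaleR_diff_right flip: scaleR_add_left)
  ultimately show ?thesis by simp
qed

subsection \<open>The basis tensors\<close>

text \<open>The edge vector is orthogonal to the gradients of \<open>bary i\<close> and
  \<open>bary j\<close>, and all gradients sum to zero; so its two remaining components are
  opposite. Having norm 1, it is not zero.\<close>

lemma edge_parallel:
  assumes "distinct [i, j, k, l]" "(UNIV :: 4 set) = {i, j, k, l}"
  obtains c where "c \<noteq> 0" "e i j = c *\<^sub>R (x k - x l)"
proof -
  have ij: "unit_edge_vector x i j (e i j)" using edge assms(1) by simp
  have "n i \<bullet> e i j = 0" "n j \<bullet> e i j = 0"
    using orthogonal_edge[OF normal] ij by blast+
  then have 0: "bary_grad i \<bullet> e i j = 0" "bary_grad j \<bullet> e i j = 0" by (simp_all add: bary_grad_def)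
  have sum: "(\<Sum>m\<in>UNIV. F m) = F i + F j + F k + F l" for F :: "4 \<Rightarrow> 'b::ab_group_add"
    unfolding assms(2) using assms(1) by (simp add: add.assoc)
  have "(\<Sum>m\<in>UNIV. bary_grad m) \<bullet> e i j = 0" by (simp add: bary_grad_sum)
  then have kl: "bary_grad l \<bullet> e i j = - (bary_grad k \<bullet> e i j)"
    by (simp add: sum inner_add_left 0 add_eq_0_iff)
  have "e i j = (bary_grad k \<bullet> e i j) *\<^sub>R (x k - x l)"
    using vector_expansion[of "e i j"] by (simp add: sum 0 kl algebra_simps)
  moreover have "e i j \<noteq> 0" using ij by (auto simp: unit_edge_vector_def)
  ultimately show ?thesis using that by (metis scale_eq_0_iff)
qed

abbreviation side :: "4 \<Rightarrow> 4 \<Rightarrow> real^3" where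
  "side i j \<equiv> x j - x i"

text \<open>Signs and lengths of the unit edge vectors cancel against the normal components in the
  denominator; each edge difference has normal component \<open>height i\<close>.\<close>

lemma T_nn_vertices: "T_nn n e i = (1 / (height i)\<^sup>2) *\<^sub>R (side i (i + 2) \<odot> side i (i + 3))"
proof -
  obtain c where c: "c \<noteq> 0" "e (i + 1) (i + 2) = c *\<^sub>R side i (i + 3)"
    using edge_parallel[of "i+1" "i+2" "i+3" i] four_indices[of i] by auto
  obtain d where d: "d \<noteq> 0" "e (i + 1) (i + 3) = d *\<^sub>R side i (i + 2)"
    using edge_parallel[of "i+1" "i+3" "i+2" i] four_indices[of i] by auto
  have "n i \<bullet> side i (i + 3) = height i" "n i \<bullet> side i (i + 2) = height i"
    using four_indices(2)[of i] by (auto simp: normal_vertices)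
  then show ?thesis using c d height_pos[of i]
    by (simp add: T_nn_def sym_prod_scaleR sym_prod_commute[of "side i (i + 2)"] power2_eq_square)
qed

lemma T5_vertices: obtains c where "c \<noteq> 0" "T5 e = c *\<^sub>R (side 3 0 \<odot> side 1 2)"
proof -
  obtain c where c: "c \<noteq> 0" "e 1 2 = c *\<^sub>R side 3 0"
    using edge_parallel[of 1 2 0 3] four_indices[of 0] by auto
  obtain d where d: "d \<noteq> 0" "e 3 4 = d *\<^sub>R side 1 2"
    by (rule edge_parallel[of 3 4 2 1]) (use UNIV_4 in auto)
  show ?thesis using that[of "c * d"] c d by (simp add: T5_def sym_prod_scaleR)
qed

lemma T6_vertices: obtains c where "c \<noteq> 0" "T6 e = c *\<^sub>R (side 2 0 \<odot> side 1 3)"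
proof -
  obtain c where c: "c \<noteq> 0" "e 1 3 = c *\<^sub>R side 2 0"
    using edge_parallel[of 1 3 0 2] four_indices[of 0] by auto
  obtain d where d: "d \<noteq> 0" "e 2 4 = d *\<^sub>R side 1 3"
    by (rule edge_parallel[of 2 4 3 1]) (use UNIV_4 in auto)
  show ?thesis using that[of "c * d"] c d by (simp add: T6_def sym_prod_scaleR)
qed

lemma T_nn_nn: "n j \<bullet> (T_nn n e i *v n j) = of_bool (i = j)"
proof (cases "i = j")
  case True
  have "n i \<bullet> side i (i + 3) = height i" "n i \<bullet> side i (i + 2) = height i"
    using four_indices(2)[of i] by (auto simp: normal_vertices)
  then show ?thesis using True height_pos[of i]
    by (simp add: T_nn_vertices scaleR_matrix_vector_assoc[symmetric] inner_sym_prod power2_eq_square)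
next
  case False
  then show ?thesis using nn_components(1)[OF normal edge False] by simp
qed

lemmas T5_nn = nn_components(2)[OF normal edge]

lemmas T6_nn = nn_components(3)[OF normal edge]

text \<open>Coordinates adapted to the tetrahedron: the gradients span the space and pair with edges
  to integers, so the entries of edge products do not depend on the shape.\<close>

definition gram :: "real^3^3 \<Rightarrow> 4 \<Rightarrow> 4 \<Rightarrow> real" where
  "gram A i j = bary_grad i \<bullet> (A *v bary_grad j)"

lemma gram_sym_prod:
  "gram (a \<odot> b) i j = ((bary_grad i \<bullet> a) * (bary_grad j \<bullet> b) + (bary_grad i \<bullet> b) * (bary_grad j \<bullet> a)) / 2"
  by (simp add: gram_def sym_prod_mult inner_add_right inner_commute field_simps)

lemma gram_diff: "gram (A - B) i j = gram A i j - gram B i j"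
  by (simp add: gram_def matrix_vector_mult_diff_rdistrib inner_diff_right)

lemma gram_scaleR: "gram (c *\<^sub>R A) i j = c * gram A i j"
  by (simp add: gram_def scaleR_matrix_vector_assoc[symmetric])

lemma gram_sum: "(\<Sum>j\<in>UNIV. gram A i j) = 0"
proof -
  have "(\<Sum>j\<in>UNIV. gram A i j) = bary_grad i \<bullet> (A *v (\<Sum>j\<in>UNIV. bary_grad j))"
    by (simp add: gram_def inner_sum_right linear_sum[OF matrix_vector_mul_linear])
  then show ?thesis by (simp add: bary_grad_sum)
qed

lemma gram_commute: "A \<in> sym_matrices \<Longrightarrow> gram A i j = gram A j i"
  by (metis (mono_tags, lifting) dot_lmul_matrix gram_def inner_commute mem_Collect_eq sym_matrices_def
      transpose_matrix_vector)

lemma gram_eq_0: 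
  assumes "\<And>i j. gram A i j = 0" shows "A = 0"
proof -
  have *: "A *v bary_grad j = 0" for j
    using assms by (intro bary_grad_eq_0) (simp add: gram_def)
  have "A $ k = 0" for k
  proof (rule bary_grad_eq_0)
    fix j show "bary_grad j \<bullet> A $ k = 0"
      using arg_cong[OF *[of j], of "\<lambda>v. v $ k"] by (simp add: matrix_vector_mul_component inner_commute)
  qed
  then show ?thesis by (simp add: vec_eq_iff)
qed

text \<open>With zero diagonal and zero row sums, entries of complementary index pairs agree and the
  three resulting values sum to zero. Two parameters remain, the entries \<open>0 2\<close> and
  \<open>0 3\<close>; each of the two edge products has 1/2 in one of these places and 0 in the
  other.\<close>

lemma sym_zero_diagonal:
  assumes "A \<in> sym_matrices" "\<And>i. gram A i i = 0"
  shows "A = (2 * gram A 0 2) *\<^sub>R (side 3 0 \<odot> side 1 2) + (2 * gram A 0 3) *\<^sub>R (side 2 0 \<odot> side 1 3)"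
proof -
  note c = gram_commute[OF assms(1)]
  have r: "gram A 0 1 + gram A 0 2 + gram A 0 3 = 0" "gram A 0 1 + gram A 1 2 + gram A 1 3 = 0"
    "gram A 0 2 + gram A 1 2 + gram A 2 3 = 0" "gram A 0 3 + gram A 1 3 + gram A 2 3 = 0"
    using gram_sum[of A 0] gram_sum[of A 1] gram_sum[of A 2] gram_sum[of A 3] assms(2)
      c[of 1 0] c[of 2 0] c[of 3 0] c[of 2 1] c[of 3 1] c[of 3 2] by (simp_all add: sum_4_from_0)
  have "A - (2 * gram A 0 2) *\<^sub>R (side 3 0 \<odot> side 1 2) - (2 * gram A 0 3) *\<^sub>R (side 2 0 \<odot> side 1 3) = 0" (is "?B = 0")
  proof (rule gram_eq_0)
    have *: "\<forall>i j. gram ?B i j = 0"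
      unfolding forall_4_from_0 gram_diff gram_scaleR gram_sym_prod bary_grad_vertices
      using r assms(2) c[of 1 0] c[of 2 0] c[of 3 0] c[of 2 1] c[of 3 1] c[of 3 2]
      by (simp, (intro conjI; linarith)?)
    then show "gram ?B i j = 0" for i j by blast
  qed
  then show ?thesis by (simp add: algebra_simps)
qed

text \<open>The coefficients of the \<open>T_nn\<close> are forced to be the normal-normal
  components; subtracting them leaves a matrix with zero Gram diagonal.\<close>

lemma T_span_sym:
  assumes "A \<in> sym_matrices"
  obtains c r s where "A = (\<Sum>i\<in>UNIV. c i *\<^sub>R T_nn n e i) + r *\<^sub>R T5 e + s *\<^sub>R T6 e"
proof -
  define c where "c i = n i \<bullet> (A *v n i)" for i
  define B where "B = A - (\<Sum>i\<in>UNIV. c i *\<^sub>R T_nn n e i)"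
  have "n j \<bullet> (B *v n j) = 0" for j
    by (simp add: B_def matrix_vector_mult_diff_rdistrib inner_diff_right sum_matrix_vector
        inner_sum_right scaleR_matrix_vector_assoc[symmetric] T_nn_nn c_def)
  then have diag: "gram B j j = 0" for j
    by (simp only: gram_def bary_grad_def matrix_vector_mult_scaleR inner_scaleR_left inner_scaleR_right)
  have "B \<in> sym_matrices" unfolding B_def T_nn_vertices
    by (intro subspace_diff[OF subspace_sym_matrices] subspace_sum[OF subspace_sym_matrices]
        subspace_scale[OF subspace_sym_matrices] assms sym_prod_in_sym_matrices)
  note B = sym_zero_diagonal[OF this diag]
  obtain c5 where 5: "c5 \<noteq> 0" "T5 e = c5 *\<^sub>R (side 3 0 \<odot> side 1 2)" by (rule T5_vertices)
  obtain c6 where 6: "c6 \<noteq> 0" "T6 e = c6 *\<^sub>R (side 2 0 \<odot> side 1 3)" by (rule T6_vertices)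
  have "A = (\<Sum>i\<in>UNIV. c i *\<^sub>R T_nn n e i) + B" by (simp add: B_def)
  also have "\<dots> = (\<Sum>i\<in>UNIV. c i *\<^sub>R T_nn n e i) +
      ((2 * gram B 0 2) *\<^sub>R (side 3 0 \<odot> side 1 2) + (2 * gram B 0 3) *\<^sub>R (side 2 0 \<odot> side 1 3))"
    by (rule arg_cong[OF B])
  also have "\<dots> = (\<Sum>i\<in>UNIV. c i *\<^sub>R T_nn n e i) + (2 * gram B 0 2 / c5) *\<^sub>R T5 e + (2 * gram B 0 3 / c6) *\<^sub>R T6 e"
    using 5 6 by (simp add: add.assoc)
  finally show ?thesis by (rule that)
qed

lemma T_independent:
  assumes "(\<Sum>i\<in>UNIV. c i *\<^sub>R T_nn n e i) + r *\<^sub>R T5 e + s *\<^sub>R T6 e = 0"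
  shows "c i = 0" "r = 0" "s = 0"
proof -
  have 0: "c j = 0" for j
  proof -
    have "0 = n j \<bullet> (((\<Sum>i\<in>UNIV. c i *\<^sub>R T_nn n e i) + r *\<^sub>R T5 e + s *\<^sub>R T6 e) *v n j)"
      by (simp add: assms)
    then show ?thesis
      by (simp add: matrix_vector_mult_add_rdistrib inner_add_right sum_matrix_vector
        inner_sum_right scaleR_matrix_vector_assoc[symmetric] T_nn_nn T5_nn T6_nn)
  qed
  then show "c i = 0" .
  obtain c5 where 5: "c5 \<noteq> 0" "T5 e = c5 *\<^sub>R (side 3 0 \<odot> side 1 2)" by (rule T5_vertices)
  obtain c6 where 6: "c6 \<noteq> 0" "T6 e = c6 *\<^sub>R (side 2 0 \<odot> side 1 3)" by (rule T6_vertices)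
  have eq: "(r * c5) *\<^sub>R (side 3 0 \<odot> side 1 2) - (- s * c6) *\<^sub>R (side 2 0 \<odot> side 1 3) = 0"
    using assms 0 5 6 by simp
  \<comment> \<open>The entry \<open>0 2\<close> sees only the first product and \<open>0 3\<close>
    only the second.\<close>
  have "gram ((r * c5) *\<^sub>R (side 3 0 \<odot> side 1 2) - (- s * c6) *\<^sub>R (side 2 0 \<odot> side 1 3)) 0 2 = 0"
    "gram ((r * c5) *\<^sub>R (side 3 0 \<odot> side 1 2) - (- s * c6) *\<^sub>R (side 2 0 \<odot> side 1 3)) 0 3 = 0"
    unfolding eq by (simp_all add: gram_def)
  then show "r = 0" "s = 0" using 5 6
    unfolding gram_diff gram_scaleR gram_sym_prod bary_grad_vertices by simp_all
qed

lemma T_nn_sym: "T_nn n e i \<in> sym_matrices"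
  unfolding T_nn_vertices by (intro subspace_scale[OF subspace_sym_matrices] sym_prod_in_sym_matrices)

subsection \<open>The space and its dimension\<close>

text \<open>Affine part plus a bubble that vanishes on face \<open>i\<close>. The representation is
  made unique by \<open>b i i = 0\<close>, since \<open>bary i\<close> already occurs in the bubble
  through \<open>(\<Sum>m. bary m y) = 1\<close>; this leaves 3 + 4 parameters for each
  \<open>i\<close>.\<close>

definition X_coeff :: "(4 \<Rightarrow> 4 \<Rightarrow> real) \<Rightarrow> (4 \<Rightarrow> 4 \<Rightarrow> real) \<Rightarrow> 4 \<Rightarrow> real^3 \<Rightarrow> real" where
  "X_coeff b a i y = (\<Sum>m\<in>UNIV. b i m * bary m y) + bary i y * (\<Sum>m\<in>UNIV. a i m * bary m y)"

definition X_fun :: "(4 \<Rightarrow> 4 \<Rightarrow> real) \<Rightarrow> (4 \<Rightarrow> 4 \<Rightarrow> real) \<Rightarrow> real \<Rightarrow> real \<Rightarrow> real^3 \<Rightarrow> real^3^3" where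
  "X_fun b a r s y = (\<Sum>i\<in>UNIV. X_coeff b a i y *\<^sub>R T_nn n e i) + r *\<^sub>R T5 e + s *\<^sub>R T6 e"

section \<open>Quadratic polynomials with affine trace on a face\<close>

lemma vertex_in_tetra: "x j \<in> tetra x"
  by (simp add: tetra_bary bary_vertex)

lemma midpoint_in_tetra: "(1/2) *\<^sub>R x j + (1/2) *\<^sub>R x k \<in> tetra x"
  by (simp add: tetra_bary midpoint_bary)

text \<open>Vertices and edge midpoints of the face determine all symmetrised coefficients whose
  indices both differ from \<open>i\<close>; they vanish, and every remaining term contains
  \<open>bary i\<close>.\<close>

lemma quadratic_vanishing_on_face:
  assumes "\<And>y. y \<in> face x i \<Longrightarrow> (\<Sum>m\<in>UNIV. \<Sum>l\<in>UNIV. c m l * (bary m y * bary l y)) = 0"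
  shows "\<exists>a. \<forall>y. (\<Sum>m\<in>UNIV. \<Sum>l\<in>UNIV. c m l * (bary m y * bary l y)) = bary i y * (\<Sum>m\<in>UNIV. a m * bary m y)"
proof -
  \<comment> \<open>Values of the form see only the symmetric part of the coefficients.\<close>
  define d where "d m l = (c m l + c l m) / 2" for m l
  have sym: "(\<Sum>m\<in>UNIV. \<Sum>l\<in>UNIV. c m l * (bary m y * bary l y))
    = (\<Sum>m\<in>UNIV. \<Sum>l\<in>UNIV. d m l * (bary m y * bary l y))" for y
  proof -
    have "(\<Sum>m\<in>UNIV. \<Sum>l\<in>UNIV. c m l * (bary m y * bary l y)) = (\<Sum>m\<in>UNIV. \<Sum>l\<in>UNIV. c l m * (bary m y * bary l y))"
      by (subst sum.swap) (simp add: mult.commute)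
    then have "(\<Sum>m\<in>UNIV. \<Sum>l\<in>UNIV. c m l * (bary m y * bary l y)) =
      ((\<Sum>m\<in>UNIV. \<Sum>l\<in>UNIV. c m l * (bary m y * bary l y)) + (\<Sum>m\<in>UNIV. \<Sum>l\<in>UNIV. c l m * (bary m y * bary l y))) / 2"
      by simp
    also have "\<dots> = (\<Sum>m\<in>UNIV. \<Sum>l\<in>UNIV. d m l * (bary m y * bary l y))"
      by (simp add: d_def sum.distrib[symmetric] sum_divide_distrib field_simps)
    finally show ?thesis .
  qed
  have mid: "d j j / 4 + d k k / 4 + d j k / 2 = 0" if "j \<noteq> i" "k \<noteq> i" for j k
  proof -
    let ?y = "(1/2) *\<^sub>R x j + (1/2) *\<^sub>R x k"
    have "?y \<in> face x i" using that midpoint_in_tetra by (simp add: face_bary midpoint_bary)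
    then have "0 = (\<Sum>m\<in>UNIV. \<Sum>l\<in>UNIV. d m l * (bary m ?y * bary l ?y))" using assms sym by simp
    also have "\<dots> = (\<Sum>m\<in>UNIV. \<Sum>l\<in>UNIV. (if j = m then if j = l then d m l / 4 else 0 else 0)
      + (if k = m then if k = l then d m l / 4 else 0 else 0)
      + (if j = m then if k = l then d m l / 4 else 0 else 0)
      + (if k = m then if j = l then d m l / 4 else 0 else 0))"
      unfolding midpoint_bary by (intro sum.cong refl) (simp add: field_simps)
    also have "\<dots> = d j j / 4 + d k k / 4 + d j k / 4 + d k j / 4"
    proof -
      have "(\<Sum>m\<in>UNIV. \<Sum>l\<in>UNIV. if p = m then if q = l then F m l else 0 else 0) = F p q"
        for p q :: 4 and F :: "4 \<Rightarrow> 4 \<Rightarrow> real"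
      proof -
        have "(\<Sum>l\<in>UNIV. if p = m then if q = l then F m l else 0 else 0) = (if p = m then F m q else 0)" for m
          by simp
        then show ?thesis by simp
      qed
      then show ?thesis by (simp only: sum.distrib)
    qed
    also have "d k j = d j k" by (simp add: d_def add.commute)
    finally show ?thesis by simp
  qed
  have d0: "d j k = 0" if "j \<noteq> i" "k \<noteq> i" for j k
    using mid[OF that] mid[of j j] mid[of k k] that by simp
  \<comment> \<open>Row and column \<open>i\<close> of \<open>d\<close> are collected, with the
    diagonal entry counted once.\<close>
  define a where "a l = d i l + (if l = i then 0 else d l i)" for l
  have "(\<Sum>m\<in>UNIV. \<Sum>l\<in>UNIV. c m l * (bary m y * bary l y)) = bary i y * (\<Sum>m\<in>UNIV. a m * bary m y)" for y
  proof -
    have "(\<Sum>m\<in>UNIV. \<Sum>l\<in>UNIV. d m l * (bary m y * bary l y)) =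
      (\<Sum>m\<in>UNIV. \<Sum>l\<in>UNIV. (if i = m then d m l * (bary m y * bary l y) else 0) +
        (if i = l then if m = i then 0 else d m l * (bary m y * bary l y) else 0))"
      by (intro sum.cong refl) (auto simp: d0)
    also have "\<dots> = (\<Sum>m\<in>UNIV. \<Sum>l\<in>UNIV. if i = m then d m l * (bary m y * bary l y) else 0) +
        (\<Sum>m\<in>UNIV. \<Sum>l\<in>UNIV. if i = l then if m = i then 0 else d m l * (bary m y * bary l y) else 0)"
      by (simp only: sum.distrib)
    also have "(\<Sum>m\<in>UNIV. \<Sum>l\<in>UNIV. if i = m then d m l * (bary m y * bary l y) else 0)
      = (\<Sum>l\<in>UNIV. d i l * (bary i y * bary l y))"
      by (subst sum.swap) simp
    also have "(\<Sum>m\<in>UNIV. \<Sum>l\<in>UNIV. if i = l then if m = i then 0 else d m l * (bary m y * bary l y) else 0)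
      = (\<Sum>m\<in>UNIV. if m = i then 0 else d m i * (bary m y * bary i y))"
      by simp
    also have "(\<Sum>l\<in>UNIV. d i l * (bary i y * bary l y)) + (\<Sum>m\<in>UNIV. if m = i then 0 else d m i * (bary m y * bary i y))
      = bary i y * (\<Sum>m\<in>UNIV. a m * bary m y)"
      unfolding sum_distrib_left sum.distrib[symmetric]
      by (intro sum.cong refl) (auto simp: a_def algebra_simps)
    finally show ?thesis by (simp add: sym)
  qed
  then show ?thesis by blast
qed

text \<open>Subtracting an affine polynomial with the same trace leaves a quadratic that vanishes on
  the face and hence has the factor \<open>bary i\<close>.\<close>

lemma quadratic_affine_on_face:
  assumes p: "p \<in> poly_space 2 (tetra x) (UNIV :: real set)"
    and q: "zext (face x i) p \<in> poly_space 1 (face x i) (UNIV :: real set)"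
  obtains b a where "b i = 0"
    "p = zext (tetra x) (\<lambda>y. (\<Sum>m\<in>UNIV. b m * bary m y) + bary i y * (\<Sum>m\<in>UNIV. a m * bary m y))"
proof -
  obtain c where c: "p = zext (tetra x) (\<lambda>y. \<Sum>i\<in>UNIV. \<Sum>j\<in>UNIV. c i j * (bary i y * bary j y))"
    using poly_space_2_bary[OF p] .
  obtain w where w: "zext (face x i) p = zext (face x i) (\<lambda>y. \<Sum>i\<in>UNIV. bary i y *\<^sub>R w i)"
    using poly_space_1_bary[OF subspace_UNIV q] .
  \<comment> \<open>Multiplication by the sum of the barycentric coordinates, which is 1, lifts the
    affine polynomial to degree 2.\<close>
  have hom: "(\<Sum>m\<in>UNIV. w m * bary m y) = (\<Sum>m\<in>UNIV. \<Sum>l\<in>UNIV. w m * (bary m y * bary l y))" for y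
    by (simp add: sum_distrib_left[symmetric] bary_sum)
  have split: "(\<Sum>m\<in>UNIV. \<Sum>l\<in>UNIV. (c m l - w m) * (bary m y * bary l y)) =
    (\<Sum>i\<in>UNIV. \<Sum>j\<in>UNIV. c i j * (bary i y * bary j y)) - (\<Sum>m\<in>UNIV. w m * bary m y)" for y
    unfolding hom by (simp add: left_diff_distrib sum_subtractf)
  have vanish: "(\<Sum>m\<in>UNIV. \<Sum>l\<in>UNIV. (c m l - w m) * (bary m y * bary l y)) = 0" if "y \<in> face x i" for y
  proof -
    have "p y = (\<Sum>m\<in>UNIV. bary m y *\<^sub>R w m)" by (rule zext_eqD[OF w that])
    moreover have "y \<in> tetra x" using that by (simp add: face_bary)
    ultimately show ?thesis unfolding split by (simp add: c zext_def mult.commute)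
  qed
  obtain a where a: "\<And>y. (\<Sum>m\<in>UNIV. \<Sum>l\<in>UNIV. (c m l - w m) * (bary m y * bary l y)) = bary i y * (\<Sum>m\<in>UNIV. a m * bary m y)"
    using quadratic_vanishing_on_face[of i "\<lambda>m l. c m l - w m", OF vanish] by blast
  \<comment> \<open>The normalisation \<open>b i = 0\<close> moves the term
    \<open>w i * bary i y\<close> into the bubble, where it adds \<open>w i\<close> to each
    coefficient.\<close>
  define b where "b = w(i := 0)"
  have "(\<Sum>i\<in>UNIV. \<Sum>j\<in>UNIV. c i j * (bary i y * bary j y)) =
    (\<Sum>m\<in>UNIV. b m * bary m y) + bary i y * (\<Sum>m\<in>UNIV. (a m + w i) * bary m y)" for y
  proof -
    have "(\<Sum>m\<in>UNIV. w m * bary m y) = (\<Sum>m\<in>UNIV. b m * bary m y + (if i = m then w m * bary m y else 0))"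
      by (intro sum.cong refl) (simp add: b_def)
    also have "\<dots> = (\<Sum>m\<in>UNIV. b m * bary m y) + w i * bary i y" by (simp add: sum.distrib)
    finally have 1: "(\<Sum>m\<in>UNIV. w m * bary m y) = (\<Sum>m\<in>UNIV. b m * bary m y) + w i * bary i y" .
    have 2: "(\<Sum>m\<in>UNIV. (a m + w i) * bary m y) = (\<Sum>m\<in>UNIV. a m * bary m y) + w i"
      by (simp add: distrib_right sum.distrib sum_distrib_left[symmetric] bary_sum)
    show ?thesis using a[of y] split[of y] 1 unfolding 2 by (simp add: algebra_simps)
  qed
  then show ?thesis using that[of b "\<lambda>m. a m + w i"] c by (simp add: b_def)
qed

section \<open>Coordinates on the space\<close>

lemma nn_component_T_nn:
  "nn_component (n i) (\<lambda>y. (\<Sum>j\<in>UNIV. p j y *\<^sub>R T_nn n e j)) y = p i y"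
  by (simp add: nn_component_def sum_matrix_vector inner_sum_right scaleR_matrix_vector_assoc[symmetric] T_nn_nn)

lemma zext_X_coeff: "zext K (X_coeff b a i) \<in> poly_space 2 K (UNIV :: real set)"
proof -
  have "X_coeff b a i = (\<lambda>y. (\<Sum>m\<in>UNIV. bary m y *\<^sub>R b i m) + (\<Sum>m\<in>UNIV. (bary i y * bary m y) *\<^sub>R a i m))"
    by (simp add: X_coeff_def fun_eq_iff sum_distrib_left mult_ac)
  moreover have "poly_space 1 K (UNIV :: real set) \<subseteq> poly_space 2 K UNIV" by (rule poly_space_mono) simp
  ultimately show ?thesis
    by (auto simp only: zext_plus intro!: subspace_add[OF subspace_poly_space] zext_poly_space_sum
        zext_bary_bary_scaleR zext_bary_scaleR)
qed

text \<open>On face \<open>i\<close> only the coefficient of \<open>T_nn n e i\<close> contributes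
  to the normal-normal trace, so the condition of \<open>P21\<close> acts on each coefficient
  separately.\<close>

lemma X_space_eq: "X_space x n e = {zext (tetra x) (X_fun b a r s) | b a r s. \<forall>i. b i i = 0}" (is "_ = ?R")
proof (intro subset_antisym subsetI)
  fix \<tau> assume "\<tau> \<in> X_space x n e"
  then obtain \<sigma> \<rho> where \<tau>: "\<tau> = \<sigma> + \<rho>" and \<sigma>: "\<sigma> \<in> P2_P0nn x n e" "\<sigma> \<in> P21 x n" and \<rho>: "\<rho> \<in> P00 x e"
    by (auto simp: X_space_def)
  obtain p where p: "\<sigma> = (\<lambda>y. \<Sum>i\<in>UNIV. p i y *\<^sub>R T_nn n e i)" "\<And>i. p i \<in> poly_space 2 (tetra x) UNIV"
    using \<sigma>(1) by (auto simp: P2_P0nn_def)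
  define R where "R i b a \<longleftrightarrow> b i = 0 \<and>
    p i = zext (tetra x) (\<lambda>y. (\<Sum>m\<in>UNIV. b m * bary m y) + bary i y * (\<Sum>m\<in>UNIV. a m * bary m y))" for i b a
  have "\<exists>b a. R i b a" for i
  proof -
    have "nn_component (n i) \<sigma> = p i" unfolding p(1) by (rule ext) (rule nn_component_T_nn)
    moreover have "zext (face x i) (nn_component (n i) \<sigma>) \<in> poly_space 1 (face x i) UNIV"
      using \<sigma>(2) unfolding P21_def by blast
    ultimately have "zext (face x i) (p i) \<in> poly_space 1 (face x i) UNIV" by simp
    then show ?thesis by (rule quadratic_affine_on_face[OF p(2)]) (auto simp: R_def)
  qed
  then obtain b a where "\<And>i. R i (b i) (a i)" by metis
  then have ba: "\<And>i. b i i = 0"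
    "\<And>i. p i = zext (tetra x) (\<lambda>y. (\<Sum>m\<in>UNIV. b i m * bary m y) + bary i y * (\<Sum>m\<in>UNIV. a i m * bary m y))"
    by (simp_all add: R_def)
  obtain u where u: "u \<in> span {T5 e, T6 e}" "\<rho> = zext (tetra x) (\<lambda>_. u)"
    using \<rho> unfolding P00_def by (auto elim: poly_space_0_const[OF subspace_span])
  obtain r s where "u = r *\<^sub>R T5 e + s *\<^sub>R T6 e"
    using u(1) by (auto simp: span_insert) (metis add.commute diff_add_cancel)
  then have "\<tau> = zext (tetra x) (X_fun b a r s)"
    unfolding \<tau> p(1) ba(2) u(2) by (auto simp: fun_eq_iff zext_def X_fun_def X_coeff_def add.assoc)
  then show "\<tau> \<in> ?R" using ba(1) by blast
next
  fix \<tau> assume "\<tau> \<in> ?R"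
  then obtain b a r s where \<tau>: "\<tau> = zext (tetra x) (X_fun b a r s)" and b: "\<And>i. b i i = 0" by blast
  define p where "p i = zext (tetra x) (X_coeff b a i)" for i
  define \<sigma> where "\<sigma> = (\<lambda>y. \<Sum>i\<in>UNIV. p i y *\<^sub>R T_nn n e i)"
  define \<rho> where "\<rho> = zext (tetra x) (\<lambda>_. r *\<^sub>R T5 e + s *\<^sub>R T6 e)"
  have "\<tau> = \<sigma> + \<rho>"
    by (auto simp: \<tau> \<sigma>_def \<rho>_def p_def zext_def fun_eq_iff X_fun_def add.assoc)
  moreover have "\<sigma> \<in> P2_P0nn x n e"
    using zext_X_coeff by (auto simp: P2_P0nn_def \<sigma>_def p_def)
  moreover have "\<rho> \<in> P00 x e"
    unfolding P00_def \<rho>_def by (intro poly_space_const span_add span_scale span_base) auto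
  moreover have "\<sigma> \<in> P21 x n"
  proof -
    have "\<sigma> = zext (tetra x) (\<lambda>y. \<Sum>i\<in>UNIV. X_coeff b a i y *\<^sub>R T_nn n e i)"
      by (auto simp: \<sigma>_def p_def zext_def fun_eq_iff)
    also have "\<dots> \<in> poly_space 2 (tetra x) sym_matrices"
      by (rule zext_poly_space_sum,
          rule zext_poly_space_times[OF zext_X_coeff poly_space_const[OF T_nn_sym, where k = 0]]) simp
    finally have "\<sigma> \<in> poly_space 2 (tetra x) sym_matrices" .
    moreover have "zext (face x i) (nn_component (n i) \<sigma>) \<in> poly_space 1 (face x i) UNIV" for i
    proof -
      have "zext (face x i) (nn_component (n i) \<sigma>) = zext (face x i) (\<lambda>y. \<Sum>m\<in>UNIV. bary m y *\<^sub>R b i m)"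
        by (rule zext_cong)
          (auto simp: \<sigma>_def nn_component_T_nn p_def face_bary X_coeff_def zext_def mult.commute)
      also have "\<dots> \<in> poly_space 1 (face x i) UNIV"
        by (intro zext_poly_space_sum zext_bary_scaleR) simp
      finally show ?thesis .
    qed
    ultimately show ?thesis by (simp add: P21_def)
  qed
  ultimately show "\<tau> \<in> X_space x n e" by (auto simp: X_space_def)
qed

section \<open>Linear structure and independent elements\<close>

lemma X_fun_add: "X_fun b a r s y + X_fun b' a' r' s' y =
  X_fun (\<lambda>i m. b i m + b' i m) (\<lambda>i m. a i m + a' i m) (r + r') (s + s') y"
  by (simp add: X_fun_def X_coeff_def sum.distrib algebra_simps)

lemma X_fun_scaleR: "c *\<^sub>R X_fun b a r s y = X_fun (\<lambda>i m. c * b i m) (\<lambda>i m. c * a i m) (c * r) (c * s) y"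
proof -
  have "c * X_coeff b a i y = X_coeff (\<lambda>i m. c * b i m) (\<lambda>i m. c * a i m) i y" for i
    by (simp add: X_coeff_def sum_distrib_left algebra_simps)
  then show ?thesis by (simp add: X_fun_def scaleR_add_right scaleR_sum_right)
qed

lemma subspace_X_space: "subspace (X_space x n e)"
  unfolding subspace_def
proof (intro conjI ballI allI)
  have "0 = zext (tetra x) (X_fun (\<lambda>_ _. 0) (\<lambda>_ _. 0) 0 0)"
    by (auto simp: zext_def X_fun_def X_coeff_def fun_eq_iff)
  then show "0 \<in> X_space x n e" unfolding X_space_eq by force
next
  fix u v assume "u \<in> X_space x n e" "v \<in> X_space x n e"
  then obtain b a r s b' a' r' s' where "u = zext (tetra x) (X_fun b a r s)" "\<forall>i. b i i = 0"
    "v = zext (tetra x) (X_fun b' a' r' s')" "\<forall>i. b' i i = 0" unfolding X_space_eq by blast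
  then have "u + v = zext (tetra x) (X_fun (\<lambda>i m. b i m + b' i m) (\<lambda>i m. a i m + a' i m) (r + r') (s + s'))"
    "\<forall>i. b i i + b' i i = 0"
    by (auto simp: fun_eq_iff zext_def X_fun_add)
  then show "u + v \<in> X_space x n e" unfolding X_space_eq by blast
next
  fix c u assume "u \<in> X_space x n e"
  then obtain b a r s where "u = zext (tetra x) (X_fun b a r s)" "\<forall>i. b i i = 0" unfolding X_space_eq by blast
  then have "c *\<^sub>R u = zext (tetra x) (X_fun (\<lambda>i m. c * b i m) (\<lambda>i m. c * a i m) (c * r) (c * s))"
    "\<forall>i. c * b i i = 0"
    by (auto simp: fun_eq_iff zext_def X_fun_scaleR scaleR_fun_def)
  then show "c *\<^sub>R u \<in> X_space x n e" unfolding X_space_eq by blast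
qed

lemma P0_subset_X_space: "poly_space 0 (tetra x) sym_matrices \<subseteq> X_space x n e"
proof
  fix f assume "f \<in> poly_space 0 (tetra x) sym_matrices"
  then obtain A where A: "A \<in> sym_matrices" "f = zext (tetra x) (\<lambda>_. A)"
    by (rule poly_space_0_const[OF subspace_sym_matrices])
  obtain c r s where c: "A = (\<Sum>i\<in>UNIV. c i *\<^sub>R T_nn n e i) + r *\<^sub>R T5 e + s *\<^sub>R T6 e"
    using T_span_sym[OF A(1)] .
  \<comment> \<open>A constant in normal form: \<open>c i\<close> times the sum of the other
    barycentric coordinates, plus \<open>bary i\<close> times \<open>c i\<close>, the latter written
    with all four coefficients equal to \<open>c i\<close>.\<close>
  define b where "b i m = (if m = i then 0 else c i)" for i m
  define a where "a i m = c i" for i m :: 4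
  have "X_coeff b a i y = c i" for i y
  proof -
    have "(\<Sum>m\<in>UNIV. b i m * bary m y) = (\<Sum>m\<in>UNIV. c i * bary m y - (if i = m then c i * bary m y else 0))"
      by (intro sum.cong refl) (simp add: b_def)
    also have "\<dots> = c i - c i * bary i y" by (simp add: sum_subtractf sum_distrib_left[symmetric] bary_sum)
    finally show ?thesis by (simp add: X_coeff_def a_def sum_distrib_left[symmetric] bary_sum)
  qed
  then have "f = zext (tetra x) (X_fun b a r s)" by (simp add: A(2) X_fun_def[abs_def] c)
  moreover have "\<forall>i. b i i = 0" by (simp add: b_def)
  ultimately show "f \<in> X_space x n e" unfolding X_space_eq by blast
qed

text \<open>Each scalar coefficient vanishes on the tetrahedron. Its values at the vertices other
  than \<open>x i\<close> give \<open>b i m\<close>, the value at \<open>x i\<close> gives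
  \<open>a i i\<close>, and the midpoints of the edges at \<open>x i\<close> give the other
  \<open>a i m\<close>.\<close>

lemma X_fun_eq_0:
  assumes "zext (tetra x) (X_fun b a r s) = 0" "\<And>i. b i i = 0"
  shows "b i m = 0" "a i m = 0" "r = 0" "s = 0"
proof -
  have 0: "X_fun b a r s y = 0" if "y \<in> tetra x" for y
    using fun_cong[OF assms(1), of y] that by (simp add: zext_def)
  have p: "X_coeff b a i y = 0" if "y \<in> tetra x" for i y
    using T_independent(1)[of "\<lambda>i. X_coeff b a i y" r s i] 0[OF that] by (simp add: X_fun_def)
  show "r = 0" "s = 0"
    using T_independent(2,3)[of "\<lambda>i. X_coeff b a i (x 0)" r s] 0[OF vertex_in_tetra] by (auto simp: X_fun_def)
  have vertex: "X_coeff b a i (x m) = b i m + (if m = i then a i i else 0)" for i m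
    by (simp add: X_coeff_def bary_vertex)
  show b: "b i m = 0" for i m
    using p[OF vertex_in_tetra, of i m] vertex[of i m] assms(2)[of i] by (cases "m = i") auto
  have ii: "a i i = 0" for i
    using p[OF vertex_in_tetra, of i i] vertex[of i i] b by simp
  show "a i m = 0"
  proof (cases "m = i")
    case False
    let ?y = "(1/2) *\<^sub>R x i + (1/2) *\<^sub>R x m"
    have "X_coeff b a i ?y = (1/2) * (\<Sum>l\<in>UNIV. (if i = l then a i l / 2 else 0) + (if m = l then a i l / 2 else 0))"
      unfolding X_coeff_def midpoint_bary b using False
      by (simp, intro sum.cong refl) auto
    also have "\<dots> = a i m / 4" by (simp add: sum.distrib ii)
    finally show ?thesis using p[OF midpoint_in_tetra, of i i m] by simp
  qed (simp add: ii)
qed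

lemma X_fun_sum:
  "(\<Sum>k\<in>K. c k *\<^sub>R zext T (X_fun (b k) (a k) (r k) (s k))) =
    zext T (X_fun (\<lambda>i m. \<Sum>k\<in>K. c k * b k i m) (\<lambda>i m. \<Sum>k\<in>K. c k * a k i m)
      (\<Sum>k\<in>K. c k * r k) (\<Sum>k\<in>K. c k * s k))"
proof (induction K rule: infinite_finite_induct)
  case (insert k K)
  then show ?case
    by (simp add: fun_eq_iff zext_def scaleR_fun_def X_fun_add X_fun_scaleR)
qed (auto simp: fun_eq_iff zext_def X_fun_def X_coeff_def)

lemma X_space_independent:
  obtains B where "B \<subseteq> X_space x n e" "independent B" "finite B" "card B = 30"
proof -
  \<comment> \<open>One index per free parameter: 12 off-diagonal entries of \<open>b\<close>, 16
    entries of \<open>a\<close>, and a truth value for \<open>T5\<close> and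
    \<open>T6\<close>.\<close>
  define J :: "((4 \<times> 4) + (4 \<times> 4) + bool) set"
    where "J = (SIGMA i:UNIV. - {i}) <+> (UNIV <+> UNIV)"
  define b where "b k i m = (of_bool (k = Inl (i, m)) :: real)" for k :: "(4 \<times> 4) + (4 \<times> 4) + bool" and i m
  define a where "a k i m = (of_bool (k = Inr (Inl (i, m))) :: real)" for k :: "(4 \<times> 4) + (4 \<times> 4) + bool" and i m
  define r where "r k = (of_bool (k = Inr (Inr True)) :: real)" for k :: "(4 \<times> 4) + (4 \<times> 4) + bool"
  define s where "s k = (of_bool (k = Inr (Inr False)) :: real)" for k :: "(4 \<times> 4) + (4 \<times> 4) + bool"
  define f where "f k = zext (tetra x) (X_fun (b k) (a k) (r k) (s k))" for k
  have fin: "finite J" by simp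
  have delta: "(\<Sum>k\<in>J. c k * of_bool (k = k0)) = (if k0 \<in> J then c k0 else 0)" for c :: "_ \<Rightarrow> real" and k0
    using fin by (simp add: of_bool_def if_distrib cong: if_cong)
  have "c k = 0" if zero: "(\<Sum>k\<in>J. c k *\<^sub>R f k) = 0" and k: "k \<in> J" for c k
  proof -
    have eq0: "zext (tetra x) (X_fun (\<lambda>i m. \<Sum>k\<in>J. c k * b k i m) (\<lambda>i m. \<Sum>k\<in>J. c k * a k i m)
      (\<Sum>k\<in>J. c k * r k) (\<Sum>k\<in>J. c k * s k)) = 0"
      using zero unfolding f_def X_fun_sum .
    have diag: "(\<Sum>k\<in>J. c k * b k i i) = 0" for i
      unfolding b_def delta by (auto simp: J_def)
    note z = X_fun_eq_0[OF eq0 diag]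
    from k consider i m where "k = Inl (i, m)" | i m where "k = Inr (Inl (i, m))"
      | "k = Inr (Inr True)" | "k = Inr (Inr False)"
      by (cases k; auto; metis (full_types) old.sum.exhaust surj_pair)
    then show ?thesis
    proof cases
      case 1 then show ?thesis using z(1)[of i m] k unfolding b_def delta by simp
    next
      case 2 then show ?thesis using z(2)[of i m] k unfolding a_def delta by simp
    next
      case 3 then show ?thesis using z(3) k unfolding r_def delta by simp
    next
      case 4 then show ?thesis using z(4) k unfolding s_def delta by simp
    qed
  qed
  then have "\<forall>c. (\<Sum>k\<in>J. c k *\<^sub>R f k) = 0 \<longrightarrow> (\<forall>k\<in>J. c k = 0)" by blast
  note ind = independent_family[OF fin this]
  have "card J = 30"
    unfolding J_def by (simp add: card_Plus card_Diff_singleton Compl_eq_Diff_UNIV)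
  then have "card (f ` J) = 30" using card_image[OF ind(1)] by simp
  moreover have "f k \<in> X_space x n e" if "k \<in> J" for k
  proof -
    have "\<forall>i. b k i i = 0" using that by (auto simp: b_def J_def)
    then show ?thesis unfolding X_space_eq f_def by blast
  qed
  ultimately show ?thesis using that[of "f ` J"] ind(2) fin by blast
qed

section \<open>Upper bounds for the number of functionals\<close>

lemma face_basis_card:
  assumes "is_basis B (poly_space 1 (face x i) (UNIV :: real set))"
  shows "finite B \<and> card B \<le> 3"
proof (rule basis_card_le[OF assms])
  let ?S = "(\<lambda>m. zext (face x i) (bary m)) ` (- {i})"
  show "poly_space 1 (face x i) (UNIV :: real set) \<subseteq> span ?S"
  proof
    fix f assume "f \<in> poly_space 1 (face x i) (UNIV :: real set)"
    then obtain w where f: "f = zext (face x i) (\<lambda>y. \<Sum>m\<in>UNIV. bary m y *\<^sub>R w m)"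
      by (rule poly_space_1_bary[OF subspace_UNIV])
    have "f = zext (face x i) (\<lambda>y. \<Sum>m\<in>- {i}. w m *\<^sub>R bary m y)"
      unfolding f
    proof (rule zext_cong)
      fix y assume "y \<in> face x i"
      then show "(\<Sum>m\<in>UNIV. bary m y *\<^sub>R w m) = (\<Sum>m\<in>- {i}. w m *\<^sub>R bary m y)"
        by (intro sum.mono_neutral_cong_right) (auto simp: face_bary)
    qed
    then show "f \<in> span ?S"
      by (simp only: zext_sum_scaleR) (intro span_sum span_scale span_base imageI)
  qed
  show "card ?S \<le> 3"
    by (rule order_trans[OF card_image_le]) (auto simp: Compl_eq_Diff_UNIV card_Diff_singleton)
qed simp

lemma const_basis_card:
  assumes "is_basis B (poly_space 0 (tetra x) sym_matrices)"
  shows "finite B \<and> card B \<le> 6"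
proof (rule basis_card_le[OF assms])
  let ?S = "insert (zext (tetra x) (\<lambda>_. T5 e)) (insert (zext (tetra x) (\<lambda>_. T6 e)) (range (\<lambda>i. zext (tetra x) (\<lambda>_. T_nn n e i))))"
  show "poly_space 0 (tetra x) sym_matrices \<subseteq> span ?S"
  proof
    fix f assume "f \<in> poly_space 0 (tetra x) sym_matrices"
    then obtain A where A: "A \<in> sym_matrices" "f = zext (tetra x) (\<lambda>_. A)"
      by (rule poly_space_0_const[OF subspace_sym_matrices])
    obtain c r s where c: "A = (\<Sum>i\<in>UNIV. c i *\<^sub>R T_nn n e i) + r *\<^sub>R T5 e + s *\<^sub>R T6 e"
      using T_span_sym[OF A(1)] .
    have "f = (\<Sum>i\<in>UNIV. c i *\<^sub>R zext (tetra x) (\<lambda>_. T_nn n e i)) +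
      r *\<^sub>R zext (tetra x) (\<lambda>_. T5 e) + s *\<^sub>R zext (tetra x) (\<lambda>_. T6 e)"
      unfolding A(2) c by (simp only: zext_plus zext_sum_scaleR zext_scaleR)
    also have "\<dots> \<in> span ?S" by (intro span_add span_sum span_scale span_base) auto
    finally show "f \<in> span ?S" .
  qed
  have "card (range (\<lambda>i::4. zext (tetra x) (\<lambda>_. T_nn n e i))) \<le> 4"
    by (rule order_trans[OF card_image_le]) auto
  then show "card ?S \<le> 6"
    by (intro order_trans[OF card_insert_le_m1]) (auto intro!: order_trans[OF card_insert_le_m1])
qed simp

lemma vector_basis_card:
  assumes "is_basis B (poly_space 1 (tetra x) (UNIV :: (real^3) set))"
  shows "finite B \<and> card B \<le> 12"
proof (rule basis_card_le[OF assms])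
  let ?S = "range (\<lambda>(m, k). zext (tetra x) (\<lambda>y. bary m y *\<^sub>R (axis k 1 :: real^3)))"
  show "poly_space 1 (tetra x) (UNIV :: (real^3) set) \<subseteq> span ?S"
  proof
    fix f assume "f \<in> poly_space 1 (tetra x) (UNIV :: (real^3) set)"
    then obtain w where f: "f = zext (tetra x) (\<lambda>y. \<Sum>m\<in>UNIV. bary m y *\<^sub>R w m)"
      by (rule poly_space_1_bary[OF subspace_UNIV])
    have "(\<Sum>m\<in>UNIV. bary m y *\<^sub>R w m) = (\<Sum>m\<in>UNIV. \<Sum>k\<in>UNIV. (w m $ k) *\<^sub>R (bary m y *\<^sub>R axis k 1))" for y
    proof (rule sum.cong[OF refl])
      fix m
      have "bary m y *\<^sub>R w m = bary m y *\<^sub>R (\<Sum>k\<in>UNIV. (w m $ k) *\<^sub>R axis k 1)"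
        using basis_expansion[of "w m"] by (simp add: scalar_mult_eq_scaleR)
      then show "bary m y *\<^sub>R w m = (\<Sum>k\<in>UNIV. (w m $ k) *\<^sub>R (bary m y *\<^sub>R axis k 1))"
        by (simp add: scaleR_sum_right mult.commute)
    qed
    then have "f = (\<Sum>m\<in>UNIV. \<Sum>k\<in>UNIV. (w m $ k) *\<^sub>R zext (tetra x) (\<lambda>y. bary m y *\<^sub>R axis k 1))"
      unfolding f by (auto simp: zext_def fun_eq_iff sum_fun_apply scaleR_fun_def)
    also have "\<dots> \<in> span ?S" by (intro span_sum span_scale span_base) auto
    finally show "f \<in> span ?S" .
  qed
  show "card ?S \<le> 12"
    by (rule order_trans[OF card_image_le]) auto
qed simp

text \<open>Four times 3 face moments, 6 constant and 12 divergence moments.\<close>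

lemma dof_index_card:
  assumes Q: "\<And>i. is_basis (Q i) (poly_space 1 (face x i) UNIV)"
    and C: "is_basis C (poly_space 0 (tetra x) sym_matrices)"
    and V: "is_basis V (poly_space 1 (tetra x) UNIV)"
  shows "finite (dof_index Q C V)" "card (dof_index Q C V) \<le> 30"
proof -
  have eq: "dof_index Q C V = (\<lambda>(i, q). Face_Moment i q) ` (SIGMA i:UNIV. Q i) \<union> Const_Moment ` C \<union> Div_Moment ` V"
    by (auto simp: dof_index_def)
  note fin = face_basis_card[OF Q] const_basis_card[OF C] vector_basis_card[OF V]
  then show "finite (dof_index Q C V)" unfolding eq by auto
  have "card ((\<lambda>(i, q). Face_Moment i q) ` (SIGMA i:UNIV. Q i)) \<le> card (SIGMA i:UNIV. Q i)"
    using fin by (intro card_image_le) auto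
  also have "\<dots> = (\<Sum>i\<in>UNIV. card (Q i))" using fin by (intro card_SigmaI) auto
  also have "\<dots> \<le> (\<Sum>i\<in>(UNIV :: 4 set). 3)" using fin by (intro sum_mono) auto
  finally have "card ((\<lambda>(i, q). Face_Moment i q) ` (SIGMA i:UNIV. Q i)) \<le> 12" by simp
  moreover have "card (Const_Moment ` C) \<le> 6" using fin card_image_le[of C Const_Moment] by linarith
  moreover have "card (Div_Moment ` V) \<le> 12" using fin card_image_le[of V Div_Moment] by linarith
  ultimately show "card (dof_index Q C V) \<le> 30"
    unfolding eq using card_Un_le[of "(\<lambda>(i, q). Face_Moment i q) ` (SIGMA i:UNIV. Q i) \<union> Const_Moment ` C" "Div_Moment ` V"]
      card_Un_le[of "(\<lambda>(i, q). Face_Moment i q) ` (SIGMA i:UNIV. Q i)" "Const_Moment ` C"] by linarith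
qed

subsection \<open>The mass matrix of the barycentric coordinates\<close>

lemma continuous_bary [continuous_intros]: "continuous_on S (bary i)"
  unfolding bary_def by (intro continuous_intros)

lemma compact_tetra: "compact (tetra x)"
  unfolding tetra_def by (intro finite_imp_compact_convex_hull) simp

lemma convex_tetra: "convex (tetra x)"
  unfolding tetra_def by (rule convex_convex_hull)

lemma interior_tetra: "interior (tetra x) \<noteq> {}"
proof -
  let ?U = "{y. \<forall>i\<in>UNIV. 0 < bary i y}"
  have "open ?U"
    using open_INT[of "UNIV :: 4 set" "\<lambda>i. {y. 0 < bary i y}"]
    by (auto simp: Collect_all_eq intro!: open_Collect_less continuous_intros)
  moreover have "?U \<subseteq> tetra x" by (auto simp: tetra_bary less_imp_le)
  \<comment> \<open>The barycentre, with all coordinates equal to 1/4.\<close>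
  moreover define c where "c = x 0 + (\<Sum>j\<in>UNIV. (1/4) *\<^sub>R (x j - x 0))"
  have "c \<in> ?U"
  proof -
    have "bary i c = 1/4" for i
      unfolding c_def
      by (simp only: bary_add bary_vertex inner_sum_right inner_scaleR_right bary_grad_vertices)
        (simp add: right_diff_distrib sum_subtractf of_bool_def if_distrib[of "\<lambda>c. c / 4"] cong: if_cong)
    then have "0 < bary i c" for i by (metis zero_less_divide_1_iff zero_less_numeral)
    then show ?thesis by simp
  qed
  ultimately have "c \<in> interior (tetra x)" by (intro interiorI[of ?U]) auto
  then show ?thesis by blast
qed

text \<open>The plane through the midpoint of the edge from \<open>x i\<close> to \<open>x m\<close> and the other two vertices cuts the
  tetrahedron into two halves, each an affine image of the whole. Splitting the integrals of
  \<open>\<lambda>\<^sub>i \<lambda>\<^sub>m\<close> and \<open>\<lambda>\<^sub>i\<^sup>2\<close> accordingly determines their ratio.\<close>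

definition halving :: "4 \<Rightarrow> 4 \<Rightarrow> real^3 \<Rightarrow> real^3" where
  "halving i m y = y + (bary m y / 2) *\<^sub>R (x i - x m)"

lemma bary_halving:
  "i \<noteq> m \<Longrightarrow> bary l (halving i m y) = bary l y + (if l = i then bary m y / 2 else if l = m then - bary m y / 2 else 0)"
  by (auto simp: halving_def bary_add bary_grad_vertices)

lemma halving_image:
  assumes "i \<noteq> m"
  shows "halving i m ` tetra x = {y \<in> tetra x. bary m y \<le> bary i y}"
proof (intro subset_antisym subsetI)
  fix z assume "z \<in> halving i m ` tetra x"
  then obtain y where y: "y \<in> tetra x" "z = halving i m y" by blast
  have "0 \<le> bary l y" for l using y(1) by (simp add: tetra_bary)
  then show "z \<in> {y \<in> tetra x. bary m y \<le> bary i y}"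
    using assms unfolding y(2) tetra_bary by (auto simp: bary_halving)
next
  fix z assume "z \<in> {y \<in> tetra x. bary m y \<le> bary i y}"
  then have z: "\<And>l. 0 \<le> bary l z" "bary m z \<le> bary i z" by (auto simp: tetra_bary)
  \<comment> \<open>\<open>halving\<close> halves the coordinate \<open>m\<close>; so the preimage
    of \<open>z\<close> has twice the coordinate, and the shift to undo is \<open>bary m z\<close>
    along \<open>x i - x m\<close>.\<close>
  define y where "y = z + (- bary m z) *\<^sub>R (x i - x m)"
  have b: "bary l y = bary l z - bary m z * (of_bool (i = l) - of_bool (m = l))" for l
    unfolding y_def bary_add inner_scaleR_right bary_grad_vertices by simp
  have "y \<in> tetra x" using z assms by (auto simp: tetra_bary b)
  moreover have "halving i m y = z"
    using assms b[of m] by (simp add: halving_def) (simp add: y_def)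
  ultimately show "z \<in> halving i m ` tetra x" by blast
qed

text \<open>The gradient of \<open>bary m\<close> pairs with \<open>x i - x m\<close> to -1, so the
  determinant is 1 - 1/2.\<close>

lemma integral_halving:
  fixes f :: "real^3 \<Rightarrow> real"
  assumes "i \<noteq> m" "continuous_on (tetra x) f"
  shows "integral {y \<in> tetra x. bary m y \<le> bary i y} f = integral (tetra x) (\<lambda>y. f (halving i m y)) / 2"
proof -
  have deriv: "(halving i m has_derivative (\<lambda>v. v + (bary_grad m \<bullet> v) *\<^sub>R ((1/2) *\<^sub>R (x i - x m)))) (at y)" for y
    unfolding halving_def[abs_def] bary_def by (auto intro!: derivative_eq_intros)
  have "inj (halving i m)"
  proof (rule injI)
    fix y z assume eq: "halving i m y = halving i m z"
    have "bary m y = bary m z"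
      using arg_cong[OF eq, of "bary m"] assms(1) by (simp add: bary_halving)
    then show "y = z" using eq by (simp add: halving_def)
  qed
  then have inj: "inj_on (halving i m) (tetra x)" by (rule inj_on_subset) simp
  have "continuous_on (halving i m ` tetra x) f"
    using assms(2) by (rule continuous_on_subset) (auto simp: halving_image[OF assms(1)])
  from integral_affine_image[OF compact_tetra deriv inj this]
  show ?thesis
    unfolding halving_image[OF assms(1)] det_rank_one inner_scaleR_right bary_grad_vertices
    using assms(1) by simp
qed

lemma integral_split:
  fixes f :: "real^3 \<Rightarrow> real"
  assumes "i \<noteq> m" "continuous_on (tetra x) f"
  shows "integral (tetra x) f =
    (integral (tetra x) (\<lambda>y. f (halving i m y)) + integral (tetra x) (\<lambda>y. f (halving m i y))) / 2"
proof -
  let ?A = "{y \<in> tetra x. bary m y \<le> bary i y}" and ?B = "{y \<in> tetra x. bary i y \<le> bary m y}"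
  have int: "f integrable_on halving i m ` tetra x" if "i \<noteq> m" for i m
  proof -
    have "compact (halving i m ` tetra x)"
      unfolding halving_def[abs_def] by (intro compact_continuous_image compact_tetra continuous_intros) simp
    moreover have "continuous_on (halving i m ` tetra x) f"
      using assms(2) by (rule continuous_on_subset) (auto simp: halving_image[OF that])
    ultimately show ?thesis
      using integral_continuous_on_compact(1) set_lebesgue_integral_eq_integral(1) by blast
  qed
  \<comment> \<open>The halves overlap only in the plane where the two coordinates are
    equal.\<close>
  have "negligible (?A \<inter> ?B)"
  proof (rule negligible_subset)
    let ?a = "bary_grad m - bary_grad i"
    have "?a \<bullet> (x m - x i) = 2" using assms(1) by (simp add: inner_diff_left bary_grad_vertices del: inner_diff_right)
    then have "?a \<noteq> 0" by auto
    then show "negligible {y. ?a \<bullet> y = bary_grad m \<bullet> x (m + 1) - bary_grad i \<bullet> x (i + 1)}"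
      by (intro negligible_hyperplane) simp
    show "?A \<inter> ?B \<subseteq> {y. ?a \<bullet> y = bary_grad m \<bullet> x (m + 1) - bary_grad i \<bullet> x (i + 1)}"
      by (auto simp: bary_def inner_diff_left inner_diff_right)
  qed
  moreover have "f integrable_on ?A" using int[OF assms(1)] unfolding halving_image[OF assms(1)] .
  moreover have "f integrable_on ?B" using int[OF assms(1)[symmetric]] unfolding halving_image[OF assms(1)[symmetric]] .
  ultimately have "integral (?A \<union> ?B) f = integral ?A f + integral ?B f" by (intro integral_Un)
  moreover have "?A \<union> ?B = tetra x" by auto
  ultimately show ?thesis
    using integral_halving[OF assms] integral_halving[OF assms(1)[symmetric] assms(2)] by simp
qed

definition mass :: "4 \<Rightarrow> 4 \<Rightarrow> real" where
  "mass i m = (LINT y|lebesgue_on (tetra x). bary i y * bary m y)"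

lemma integrable_mass: "integrable (lebesgue_on (tetra x)) (\<lambda>y. bary i y * bary m y)"
  by (intro integrable_continuous_on_compact compact_tetra continuous_intros)

lemma mass_relations:
  assumes "i \<noteq> m"
  shows "mass m m = mass i i" "mass i m = mass i i / 2"
proof -
  have split: "(LINT y|lebesgue_on (tetra x). f y) =
    ((LINT y|lebesgue_on (tetra x). f (halving i m y)) + (LINT y|lebesgue_on (tetra x). f (halving m i y))) / 2"
    if "continuous_on UNIV f" for f :: "real^3 \<Rightarrow> real"
  proof -
    have "continuous_on (tetra x) (halving i m)" for i m
      unfolding halving_def[abs_def] by (intro continuous_intros) simp
    then have "continuous_on (tetra x) (\<lambda>y. f (halving i m y))" for i m
      using continuous_on_compose2[OF that] by blast
    then show ?thesis
      using integral_split[OF assms continuous_on_subset[OF that]]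
      by (simp add: integral_continuous_on_compact(2)[OF compact_tetra, symmetric] continuous_on_subset[OF that])
  qed
  note int = integrable_mass
  have 1: "mass i m = (mass i m / 2 + mass m m / 4 + (mass i m / 2 + mass i i / 4)) / 2"
  proof -
    have eq: "bary i (halving i m y) * bary m (halving i m y) = (bary i y * bary m y) / 2 + (bary m y * bary m y) / 4"
      "bary i (halving m i y) * bary m (halving m i y) = (bary i y * bary m y) / 2 + (bary i y * bary i y) / 4" for y
      using assms by (simp_all add: bary_halving field_simps)
    then show ?thesis
      using split[of "\<lambda>y. bary i y * bary m y"] unfolding eq mass_def
      by (simp add: int continuous_on_mult continuous_bary)
  qed
  have 2: "mass i i = (mass i i + mass i m + mass m m / 4 + mass i i / 4) / 2"
  proof -
    have eq: "bary i (halving i m y) * bary i (halving i m y) = (bary i y * bary i y) + (bary i y * bary m y) + (bary m y * bary m y) / 4"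
      "bary i (halving m i y) * bary i (halving m i y) = (bary i y * bary i y) / 4" for y
      using assms by (simp_all add: bary_halving field_simps)
    then show ?thesis
      using split[of "\<lambda>y. bary i y * bary i y"] unfolding eq mass_def
      by (simp add: int continuous_on_mult continuous_bary)
  qed
  \<comment> \<open>The entries \<open>mass i m\<close> recur on both sides because each half is an
    affine copy of the whole; clearing them leaves two linear relations.\<close>
  from 1 2 have "4 * mass i m = mass i i + mass m m" "3 * mass i i = 4 * mass i m + mass m m" by simp_all
  then show "mass m m = mass i i" "mass i m = mass i i / 2" by simp_all
qed

lemma mass_pos: "mass i i > 0"
proof -
  have c: "continuous_on (tetra x) (\<lambda>y. bary i y * bary i y)" by (intro continuous_intros)
  have "mass i i \<ge> 0" unfolding mass_def by (intro integral_nonneg_AE AE_I2) simp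
  moreover have "mass i i \<noteq> 0"
  proof
    assume "mass i i = 0"
    then have "bary i (x i) * bary i (x i) = 0"
      unfolding mass_def
      by (intro integral_continuous_nonneg_eq_0[OF compact_tetra convex_tetra interior_tetra c _ _ vertex_in_tetra]) auto
    then show False by (simp add: bary_vertex)
  qed
  ultimately show ?thesis by linarith
qed

lemma mass_eq: "mass i m = (if i = m then mass 0 0 else mass 0 0 / 2)"
proof -
  have diag: "mass j j = mass 0 0" for j
  proof (cases "0 = j")
    case False
    then show ?thesis by (rule mass_relations(1))
  qed simp
  then show ?thesis using mass_relations(2)[of i m] diag[of i] by auto
qed

subsection \<open>The degrees of freedom\<close>

abbreviation jac :: "4 \<Rightarrow> real" where
  "jac i \<equiv> norm (cross3 (x (i + 2) - x (i + 1)) (x (i + 3) - x (i + 1)))"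

text \<open>A vanishing cross product would make the two edges collinear, which contradicts their
  pairings with two of the gradients.\<close>

lemma jac_pos: "jac i > 0"
proof -
  let ?a = "x (i + 2) - x (i + 1)" and ?b = "x (i + 3) - x (i + 1)"
  have g: "bary_grad (i + 2) \<bullet> ?a = 1" "bary_grad (i + 2) \<bullet> ?b = 0" "bary_grad (i + 3) \<bullet> ?b = 1"
    using four_indices(2)[of i] by (auto simp: bary_grad_vertices)
  have "cross3 ?a ?b \<noteq> 0"
  proof
    assume "cross3 ?a ?b = 0"
    then have "collinear {0, ?a, ?b}" by (simp add: cross_eq_0)
    then consider "?a = 0" | "?b = 0" | c where "?b = c *\<^sub>R ?a" by (auto simp: collinear_lemma)
    then show False
    proof cases
      case 1 then show False using g(1) by (simp only: inner_zero_right)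
    next
      case 2 then show False using g(3) by (simp only: inner_zero_right)
    next
      case (3 c)
      have "c = 0" using g(1,2) unfolding 3 by (simp only: inner_scaleR_right)
      then show False using g(3) unfolding 3 by simp
    qed
  qed
  then show ?thesis using zero_less_norm_iff by blast
qed

lemma bary_face_param:
  "bary j (face_param x i (s, t)) = of_bool (i + 1 = j) + s * (of_bool (i + 2 = j) - of_bool (i + 1 = j))
    + t * (of_bool (i + 3 = j) - of_bool (i + 1 = j))"
  unfolding face_param_def prod.case bary_add bary_vertex inner_scaleR_right bary_grad_vertices by simp

lemma face_param_in_face:
  assumes "p \<in> reference_triangle" shows "face_param x i p \<in> face x i"
proof -
  obtain s t where p: "p = (s, t)" "0 \<le> s" "0 \<le> t" "s + t \<le> 1"
    using assms by (auto simp: reference_triangle_def)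
  have "0 \<le> bary j (face_param x i p)" for j
    unfolding p(1) bary_face_param using p(2-4) four_indices(2)[of i]
    by (cases "i + 1 = j"; cases "i + 2 = j"; cases "i + 3 = j") auto
  moreover have "bary i (face_param x i p) = 0"
    unfolding p(1) bary_face_param by simp
  ultimately show ?thesis by (simp add: face_bary tetra_bary)
qed

lemma continuous_face_param: "continuous_on S (face_param x i)"
  unfolding face_param_def case_prod_unfold by (intro continuous_intros)

lemma face_integrand:
  assumes "continuous_on (face x i) f"
  shows "continuous_on reference_triangle (\<lambda>p. f (face_param x i p) * jac i)"
    "integrable (lebesgue_on reference_triangle) (\<lambda>p. f (face_param x i p) * jac i)"
proof -
  show c: "continuous_on reference_triangle (\<lambda>p. f (face_param x i p) * jac i)"
    by (intro continuous_on_mult continuous_on_const continuous_on_compose2[OF assms continuous_face_param])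
      (auto simp: face_param_in_face)
  then show "integrable (lebesgue_on reference_triangle) (\<lambda>p. f (face_param x i p) * jac i)"
    by (rule integrable_continuous_on_compact[OF compact_reference_triangle])
qed

lemma face_integral_cong:
  assumes "\<And>y. y \<in> face x i \<Longrightarrow> f y = g y"
  shows "face_integral x i f = face_integral x i g"
  unfolding face_integral_def
  by (rule Bochner_Integration.integral_cong) (auto simp: assms face_param_in_face)

lemma face_integral_add:
  assumes "continuous_on (face x i) f" "continuous_on (face x i) g"
  shows "face_integral x i (\<lambda>y. f y + g y) = face_integral x i f + face_integral x i g"
  using face_integrand(2)[OF assms(1)] face_integrand(2)[OF assms(2)]
  by (simp add: face_integral_def distrib_right)

lemma face_integral_cmult: "face_integral x i (\<lambda>y. c * f y) = c * face_integral x i f"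
  by (simp add: face_integral_def mult.assoc)

lemma face_integral_nonneg_eq_0:
  assumes "continuous_on (face x i) f" "\<And>y. y \<in> face x i \<Longrightarrow> f y \<ge> 0" "face_integral x i f = 0"
    and p: "p \<in> reference_triangle"
  shows "f (face_param x i p) = 0"
proof -
  have "f (face_param x i p) * jac i = 0"
  proof (rule integral_continuous_nonneg_eq_0[OF compact_reference_triangle convex_reference_triangle
        interior_reference_triangle face_integrand(1)[OF assms(1)] _ _ p])
    show "(LINT p|lebesgue_on reference_triangle. f (face_param x i p) * jac i) = 0"
      using assms(3) by (simp add: face_integral_def)
  qed (simp add: assms(2) face_param_in_face)
  moreover have "jac i \<noteq> 0" using jac_pos[of i] by simp
  ultimately show ?thesis by (simp only: mult_eq_0_iff) blast
qed

lemma face_area_pos: "face_area x i > 0"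
proof -
  have "face_area x i \<ge> 0"
    unfolding face_area_def face_integral_def by (intro integral_nonneg_AE AE_I2) simp
  moreover have "face_area x i \<noteq> 0"
  proof
    assume "face_area x i = 0"
    then show False
      using face_integral_nonneg_eq_0[of i "\<lambda>_. 1" "(0, 0)"]
      by (simp add: face_area_def reference_triangle_def)
  qed
  ultimately show ?thesis by linarith
qed

section \<open>Values of the functionals in terms of the coefficients\<close>

lemma poly_space_1_continuous:
  fixes f :: "real^3 \<Rightarrow> 'u::real_normed_vector"
  assumes "f \<in> poly_space 1 K UNIV"
  shows "continuous_on K f"
proof -
  obtain w where w: "f = zext K (\<lambda>y. \<Sum>i\<in>UNIV. bary i y *\<^sub>R w i)"
    using poly_space_1_bary[OF subspace_UNIV assms] .
  have "continuous_on K (\<lambda>y. \<Sum>i\<in>UNIV. bary i y *\<^sub>R w i)" by (intro continuous_intros)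
  then show ?thesis by (subst continuous_on_cong[OF refl]) (auto simp: w zext_def)
qed

lemma poly_space_0_continuous:
  assumes "f \<in> poly_space 0 K sym_matrices"
  shows "continuous_on K f"
proof -
  obtain A where "f = zext K (\<lambda>_. A)" using poly_space_0_const[OF subspace_sym_matrices assms] .
  then show ?thesis by (subst continuous_on_cong[OF refl, of K f "\<lambda>_. A"]) (auto simp: zext_def)
qed

text \<open>\<open>X_coeff b a i\<close> on face \<open>i\<close>, where the bubble
  vanishes.\<close>

definition trace_coeff :: "(4 \<Rightarrow> 4 \<Rightarrow> real) \<Rightarrow> 4 \<Rightarrow> real^3 \<Rightarrow> real" where
  "trace_coeff b i y = (\<Sum>m\<in>UNIV. b i m * bary m y)"

lemma continuous_trace_coeff [continuous_intros]: "continuous_on S (trace_coeff b i)"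
  unfolding trace_coeff_def by (intro continuous_intros)

lemma continuous_X_coeff [continuous_intros]: "continuous_on S (X_coeff b a i)"
  unfolding X_coeff_def by (intro continuous_intros)

lemma continuous_X_fun [continuous_intros]: "continuous_on S (X_fun b a r s)"
  unfolding X_fun_def by (intro continuous_intros)

lemma face_moment:
  "dof_value x n (Face_Moment i q) (zext (tetra x) (X_fun b a r s)) =
    face_area x i * face_integral x i (\<lambda>y. trace_coeff b i y * q y)"
proof -
  have "nn_component (n i) (zext (tetra x) (X_fun b a r s)) y = trace_coeff b i y" if "y \<in> face x i" for y
    using that by (simp add: nn_component_def zext_def face_bary X_fun_def matrix_vector_mult_add_rdistrib
        inner_add_right sum_matrix_vector inner_sum_right scaleR_matrix_vector_assoc[symmetric] T_nn_nn
        T5_nn T6_nn X_coeff_def trace_coeff_def)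
  then show ?thesis
    unfolding dof_value.simps face_inner_def
    by (intro arg_cong[where f = "\<lambda>c. face_area x i * c"] face_integral_cong) simp
qed

lemma const_moment:
  "dof_value x n (Const_Moment c) (zext (tetra x) (X_fun b a r s)) =
    (LINT y|lebesgue_on (tetra x). X_fun b a r s y \<bullet> c y)"
  unfolding dof_value.simps L2_inner_def
  by (rule Bochner_Integration.integral_cong) (auto simp: zext_def)

definition coeff_grad :: "(4 \<Rightarrow> 4 \<Rightarrow> real) \<Rightarrow> (4 \<Rightarrow> 4 \<Rightarrow> real) \<Rightarrow> 4 \<Rightarrow> real^3 \<Rightarrow> real^3" where
  "coeff_grad b a i y = (\<Sum>m\<in>UNIV. b i m *\<^sub>R bary_grad m) + (\<Sum>m\<in>UNIV. a i m * bary m y) *\<^sub>R bary_grad i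
    + bary i y *\<^sub>R (\<Sum>m\<in>UNIV. a i m *\<^sub>R bary_grad m)"

text \<open>Divergence of \<open>X_fun\<close>: for a constant tensor \<open>T\<close>, the row-wise
  divergence of \<open>p T\<close> is \<open>T\<close> applied to the gradient of \<open>p\<close>,
  and the constant part drops out.\<close>

definition div_fun :: "(4 \<Rightarrow> 4 \<Rightarrow> real) \<Rightarrow> (4 \<Rightarrow> 4 \<Rightarrow> real) \<Rightarrow> real^3 \<Rightarrow> real^3" where
  "div_fun b a y = (\<Sum>i\<in>UNIV. T_nn n e i *v coeff_grad b a i y)"

lemma bary_has_derivative: "(bary i has_derivative (\<lambda>v. bary_grad i \<bullet> v)) (at y)"
  unfolding bary_def by (auto intro!: derivative_eq_intros)

lemma X_coeff_has_derivative: "(X_coeff b a i has_derivative (\<lambda>v. coeff_grad b a i y \<bullet> v)) (at y)"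
  unfolding X_coeff_def
  by (rule has_derivative_eq_rhs, (rule derivative_eq_intros bary_has_derivative refl)+)
    (simp add: coeff_grad_def inner_add_left inner_sum_left fun_eq_iff algebra_simps sum_distrib_left)

lemma X_fun_has_derivative:
  "(X_fun b a r s has_derivative (\<lambda>v. \<Sum>i\<in>UNIV. (coeff_grad b a i y \<bullet> v) *\<^sub>R T_nn n e i)) (at y)"
  unfolding X_fun_def
  by (rule has_derivative_eq_rhs, (rule derivative_eq_intros X_coeff_has_derivative refl)+) simp

text \<open>Near an interior point the extension by zero agrees with the polynomial, and the
  derivative within the tetrahedron is the ordinary one.\<close>

lemma div_on_X_fun:
  assumes "y \<in> interior (tetra x)"
  shows "div_on (tetra x) (zext (tetra x) (X_fun b a r s)) y = div_fun b a y"
proof -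
  have "(zext (tetra x) (X_fun b a r s) has_derivative (\<lambda>v. \<Sum>i\<in>UNIV. (coeff_grad b a i y \<bullet> v) *\<^sub>R T_nn n e i)) (at y)"
    by (rule has_derivative_transform_within_open[OF X_fun_has_derivative open_interior assms])
      (use interior_subset in \<open>auto simp: zext_def\<close>)
  from frechet_derivative_at[OF this]
  have D: "frechet_derivative (zext (tetra x) (X_fun b a r s)) (at y within tetra x) =
    (\<lambda>v. \<Sum>i\<in>UNIV. (coeff_grad b a i y \<bullet> v) *\<^sub>R T_nn n e i)"
    by (simp add: at_within_interior[OF assms])
  have "(\<Sum>j\<in>UNIV. (\<Sum>i\<in>UNIV. (coeff_grad b a i y \<bullet> axis j 1) *\<^sub>R T_nn n e i) $ k $ j) = div_fun b a y $ k" for k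
  proof -
    have "(\<Sum>j\<in>UNIV. (\<Sum>i\<in>UNIV. (coeff_grad b a i y \<bullet> axis j 1) *\<^sub>R T_nn n e i) $ k $ j) =
      (\<Sum>i\<in>UNIV. \<Sum>j\<in>UNIV. T_nn n e i $ k $ j * coeff_grad b a i y $ j)"
      by (subst sum.swap) (simp add: inner_axis mult.commute)
    then show ?thesis by (simp add: div_fun_def matrix_vector_mult_def)
  qed
  then show ?thesis unfolding div_on_def D by (simp add: vec_eq_iff)
qed

lemma continuous_div_fun [continuous_intros]: "continuous_on S (div_fun b a)"
proof -
  have "continuous_on S (coeff_grad b a i)" for i
    unfolding coeff_grad_def by (intro continuous_intros)
  then have "continuous_on S (\<lambda>y. T_nn n e i *v coeff_grad b a i y)" for i
    by (rule bounded_linear.continuous_on[OF matrix_vector_mul_bounded_linear])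
  then show ?thesis unfolding div_fun_def[abs_def] by (intro continuous_on_sum)
qed

lemma div_moment:
  assumes "continuous_on (tetra x) v"
  shows "dof_value x n (Div_Moment v) (zext (tetra x) (X_fun b a r s)) =
    (LINT y|lebesgue_on (tetra x). div_fun b a y \<bullet> v y)"
proof -
  let ?F = "\<lambda>y. div_on (tetra x) (zext (tetra x) (X_fun b a r s)) y \<bullet> v y"
  have ae: "AE y in lebesgue_on (tetra x). div_fun b a y \<bullet> v y = ?F y"
    by (rule AE_mp[OF AE_interior_convex[OF compact_tetra convex_tetra]]) (simp add: div_on_X_fun)
  have "integrable (lebesgue_on (tetra x)) (\<lambda>y. div_fun b a y \<bullet> v y)"
    by (intro integrable_continuous_on_compact compact_tetra continuous_intros assms)
  then have meas: "(\<lambda>y. div_fun b a y \<bullet> v y) \<in> borel_measurable (lebesgue_on (tetra x))" by simp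
  have "tetra x \<in> sets lebesgue" using compact_tetra by (simp add: lmeasurable_compact fmeasurableD)
  note meas' = borel_measurable_AE_cong_lebesgue_on[OF this meas ae]
  show ?thesis
    unfolding dof_value.simps L2_inner_def using integral_cong_AE[OF meas meas' ae] by simp
qed

section \<open>Linearity of the functionals\<close>

lemma zext_X_fun_add: "zext (tetra x) (X_fun b a r s) + zext (tetra x) (X_fun b' a' r' s') =
  zext (tetra x) (X_fun (\<lambda>i m. b i m + b' i m) (\<lambda>i m. a i m + a' i m) (r + r') (s + s'))"
  by (auto simp: fun_eq_iff zext_def X_fun_add)

lemma zext_X_fun_scaleR: "c *\<^sub>R zext (tetra x) (X_fun b a r s) =
  zext (tetra x) (X_fun (\<lambda>i m. c * b i m) (\<lambda>i m. c * a i m) (c * r) (c * s))"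
  by (auto simp: fun_eq_iff zext_def X_fun_scaleR scaleR_fun_def)

text \<open>Linearity is checked on coefficients, on which the elements of the space depend
  linearly; the outer \<open>zext\<close> supplies the zero values off the space that
  \<open>dual_space\<close> prescribes.\<close>

lemma dual_space_X_spaceI:
  assumes "\<And>b a r s b' a' r' s'. F (zext (tetra x) (X_fun (\<lambda>i m. b i m + b' i m) (\<lambda>i m. a i m + a' i m) (r + r') (s + s')))
      = F (zext (tetra x) (X_fun b a r s)) + F (zext (tetra x) (X_fun b' a' r' s'))"
    and "\<And>c b a r s. F (zext (tetra x) (X_fun (\<lambda>i m. c * b i m) (\<lambda>i m. c * a i m) (c * r) (c * s)))
      = c * F (zext (tetra x) (X_fun b a r s))"
  shows "zext (X_space x n e) F \<in> dual_space (X_space x n e)"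
  unfolding dual_space_def
proof (intro CollectI conjI ballI allI impI)
  have z: "zext (X_space x n e) F w = F w" if "w \<in> X_space x n e" for w
    using that by (simp add: zext_def)
  fix u v assume uv: "u \<in> X_space x n e" "v \<in> X_space x n e"
  then obtain b a r s b' a' r' s' where "u = zext (tetra x) (X_fun b a r s)"
    "v = zext (tetra x) (X_fun b' a' r' s')" unfolding X_space_eq by blast
  then show "zext (X_space x n e) F (u + v) = zext (X_space x n e) F u + zext (X_space x n e) F v"
    unfolding z[OF uv(1)] z[OF uv(2)] z[OF subspace_add[OF subspace_X_space uv]]
    by (simp add: zext_X_fun_add assms(1))
next
  have z: "zext (X_space x n e) F w = F w" if "w \<in> X_space x n e" for w
    using that by (simp add: zext_def)
  fix c u assume u: "u \<in> X_space x n e"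
  then obtain b a r s where "u = zext (tetra x) (X_fun b a r s)" unfolding X_space_eq by blast
  then show "zext (X_space x n e) F (c *\<^sub>R u) = c * zext (X_space x n e) F u"
    unfolding z[OF u] z[OF subspace_scale[OF subspace_X_space u]]
    by (simp add: zext_X_fun_scaleR assms(2))
qed (simp add: zext_def)

lemma coeff_grad_add: "coeff_grad (\<lambda>i m. b i m + b' i m) (\<lambda>i m. a i m + a' i m) i y =
  coeff_grad b a i y + coeff_grad b' a' i y"
  by (simp add: coeff_grad_def sum.distrib algebra_simps)

lemma coeff_grad_cmult: "coeff_grad (\<lambda>i m. c * b i m) (\<lambda>i m. c * a i m) i y = c *\<^sub>R coeff_grad b a i y"
proof -
  have "(\<Sum>m\<in>UNIV. c * a i m * bary m y) = c * (\<Sum>m\<in>UNIV. a i m * bary m y)"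
    by (simp add: sum_distrib_left mult.assoc)
  moreover have "(\<Sum>m\<in>UNIV. (c * d i m) *\<^sub>R bary_grad m) = c *\<^sub>R (\<Sum>m\<in>UNIV. d i m *\<^sub>R bary_grad m)" for d
    by (simp add: scaleR_sum_right)
  ultimately show ?thesis by (simp add: coeff_grad_def scaleR_add_right mult.commute)
qed

lemma div_fun_add: "div_fun (\<lambda>i m. b i m + b' i m) (\<lambda>i m. a i m + a' i m) y = div_fun b a y + div_fun b' a' y"
  by (simp add: div_fun_def coeff_grad_add matrix_vector_right_distrib sum.distrib)

lemma div_fun_cmult: "div_fun (\<lambda>i m. c * b i m) (\<lambda>i m. c * a i m) y = c *\<^sub>R div_fun b a y"
  by (simp add: div_fun_def coeff_grad_cmult matrix_vector_mult_scaleR scaleR_sum_right)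

lemma trace_coeff_add: "trace_coeff (\<lambda>i m. b i m + b' i m) i y = trace_coeff b i y + trace_coeff b' i y"
  by (simp add: trace_coeff_def distrib_right sum.distrib)

lemma trace_coeff_cmult: "trace_coeff (\<lambda>i m. c * b i m) i y = c * trace_coeff b i y"
  by (simp add: trace_coeff_def sum_distrib_left mult.assoc)

lemma face_moment_dual:
  assumes "continuous_on (face x i) q"
  shows "zext (X_space x n e) (dof_value x n (Face_Moment i q)) \<in> dual_space (X_space x n e)"
  by (rule dual_space_X_spaceI)
    (simp_all only: face_moment trace_coeff_add trace_coeff_cmult distrib_right mult.assoc
      face_integral_add[OF continuous_on_mult[OF continuous_trace_coeff assms] continuous_on_mult[OF continuous_trace_coeff assms]]
      distrib_left face_integral_cmult mult.left_commute)

lemma const_moment_dual: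
  assumes "continuous_on (tetra x) c"
  shows "zext (X_space x n e) (dof_value x n (Const_Moment c)) \<in> dual_space (X_space x n e)"
proof -
  have int: "integrable (lebesgue_on (tetra x)) (\<lambda>y. X_fun b a r s y \<bullet> c y)" for b a r s
    by (intro integrable_continuous_on_compact compact_tetra continuous_intros assms)
  show ?thesis
    by (rule dual_space_X_spaceI)
      (simp_all add: const_moment X_fun_add[symmetric] X_fun_scaleR[symmetric] inner_add_left int del: dof_value.simps)
qed

lemma div_moment_dual:
  assumes "continuous_on (tetra x) v"
  shows "zext (X_space x n e) (dof_value x n (Div_Moment v)) \<in> dual_space (X_space x n e)"
proof -
  have int: "integrable (lebesgue_on (tetra x)) (\<lambda>y. div_fun b a y \<bullet> v y)" for b a
    by (intro integrable_continuous_on_compact compact_tetra continuous_intros assms)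
  show ?thesis
    by (rule dual_space_X_spaceI)
      (simp_all add: div_moment[OF assms] div_fun_add div_fun_cmult inner_add_left int del: dof_value.simps)
qed

lemma dof_dual:
  assumes Q: "\<And>i. is_basis (Q i) (poly_space 1 (face x i) UNIV)"
    and C: "is_basis C (poly_space 0 (tetra x) sym_matrices)"
    and V: "is_basis V (poly_space 1 (tetra x) UNIV)"
    and d: "d \<in> dof_index Q C V"
  shows "zext (X_space x n e) (dof_value x n d) \<in> dual_space (X_space x n e)"
proof -
  have B: "B \<subseteq> W" if "is_basis B W" for B W :: "'v::real_vector set"
    using that span_superset by (auto simp: is_basis_def)
  consider i q where "d = Face_Moment i q" "q \<in> Q i" | c where "d = Const_Moment c" "c \<in> C"
    | v where "d = Div_Moment v" "v \<in> V"
    using d by (auto simp: dof_index_def)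
  then show ?thesis
  proof cases
    case 1
    then have "q \<in> poly_space 1 (face x i) UNIV" using B[OF Q[of i]] by blast
    then show ?thesis unfolding 1(1) by (intro face_moment_dual poly_space_1_continuous)
  next
    case 2
    then have "c \<in> poly_space 0 (tetra x) sym_matrices" using B[OF C] by blast
    then show ?thesis unfolding 2(1) by (intro const_moment_dual poly_space_0_continuous)
  next
    case 3
    then have "v \<in> poly_space 1 (tetra x) UNIV" using B[OF V] by blast
    then show ?thesis unfolding 3(1) by (intro div_moment_dual poly_space_1_continuous)
  qed
qed

subsection \<open>Unisolvence\<close>

text \<open>The trace is affine, hence an admissible test function; the integral of its square is
  zero, and its values at the three vertices of the face are the coefficients.\<close>

lemma trace_coeff_vanishes:
  assumes Q: "is_basis Q (poly_space 1 (face x i) UNIV)" and b: "b i i = 0"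
    and 0: "\<And>q. q \<in> Q \<Longrightarrow> face_integral x i (\<lambda>y. trace_coeff b i y * q y) = 0"
  shows "b i m = 0"
proof -
  define A where "A = {q. continuous_on (face x i) q \<and> face_integral x i (\<lambda>y. trace_coeff b i y * q y) = 0}"
  have "subspace A"
    unfolding subspace_def
  proof (intro conjI ballI allI)
    show "0 \<in> A" by (simp add: A_def zero_fun_def face_integral_def)
  next
    fix p q assume "p \<in> A" "q \<in> A"
    then show "p + q \<in> A"
      using face_integral_add[of i "\<lambda>y. trace_coeff b i y * p y" "\<lambda>y. trace_coeff b i y * q y"]
      by (auto simp: A_def plus_fun_def distrib_left intro!: continuous_intros)
  next
    fix c q assume "q \<in> A"
    then show "c *\<^sub>R q \<in> A"
      using face_integral_cmult[of i c "\<lambda>y. trace_coeff b i y * q y"]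
      by (auto simp: A_def scaleR_fun_def mult.left_commute intro!: continuous_intros)
  qed
  moreover have "Q \<subseteq> A"
  proof
    fix q assume q: "q \<in> Q"
    then have "q \<in> poly_space 1 (face x i) UNIV" using Q span_base[of q Q] by (simp add: is_basis_def)
    then show "q \<in> A" using 0[OF q] poly_space_1_continuous by (auto simp: A_def)
  qed
  ultimately have "span Q \<subseteq> A" by (intro span_minimal)
  moreover have "zext (face x i) (trace_coeff b i) \<in> poly_space 1 (face x i) UNIV"
  proof -
    have eq: "trace_coeff b i = (\<lambda>y. \<Sum>m\<in>UNIV. bary m y *\<^sub>R b i m)"
      by (simp add: trace_coeff_def fun_eq_iff mult.commute)
    show ?thesis unfolding eq by (intro zext_poly_space_sum zext_bary_scaleR) simp
  qed
  ultimately have "face_integral x i (\<lambda>y. trace_coeff b i y * zext (face x i) (trace_coeff b i) y) = 0"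
    using Q by (auto simp: is_basis_def A_def)
  moreover have "face_integral x i (\<lambda>y. trace_coeff b i y * zext (face x i) (trace_coeff b i) y)
    = face_integral x i (\<lambda>y. trace_coeff b i y * trace_coeff b i y)"
    by (rule face_integral_cong) (simp add: zext_def)
  ultimately have sq: "face_integral x i (\<lambda>y. trace_coeff b i y * trace_coeff b i y) = 0" by simp
  have "continuous_on (face x i) (\<lambda>y. trace_coeff b i y * trace_coeff b i y)" by (intro continuous_intros)
  from face_integral_nonneg_eq_0[OF this _ sq]
  have *: "trace_coeff b i (face_param x i p) = 0" if "p \<in> reference_triangle" for p using that by simp
  have vertex: "trace_coeff b i (x l) = b i l" for l
  proof -
    have "trace_coeff b i (x l) = (\<Sum>m\<in>UNIV. if l = m then b i m else 0)"
      unfolding trace_coeff_def by (rule sum.cong) (auto simp: bary_vertex)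
    then show ?thesis by simp
  qed
  \<comment> \<open>The corners of the reference triangle are mapped to the vertices of the
    face.\<close>
  have "b i (i + 1) = 0" "b i (i + 2) = 0" "b i (i + 3) = 0"
    using *[of "(0, 0)"] *[of "(1, 0)"] *[of "(0, 1)"]
    by (simp_all add: reference_triangle_def face_param_def vertex)
  moreover have "m \<in> {i, i + 1, i + 2, i + 3}" using four_indices(1)[of i] by blast
  ultimately show ?thesis using b by auto
qed

text \<open>Testing with the constant tensor \<open>M\<close>, the integral of \<open>X_fun\<close>,
  gives \<open>M \<bullet> M = 0\<close>. Independence of the six tensors then separates the
  integrals of the coefficients from \<open>r\<close> and \<open>s\<close>, which appear multiplied
  by the volume.\<close>

lemma const_moments_vanish:
  assumes C: "is_basis C (poly_space 0 (tetra x) sym_matrices)"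
    and 0: "\<And>c. c \<in> C \<Longrightarrow> (LINT y|lebesgue_on (tetra x). X_fun b a r s y \<bullet> c y) = 0"
  shows "(LINT y|lebesgue_on (tetra x). X_coeff b a i y) = 0" "r = 0" "s = 0"
proof -
  let ?L = "lebesgue_on (tetra x)"
  define M where "M = (LINT y|?L. X_fun b a r s y)"
  define vol where "vol = (LINT y|?L. (1 :: real))"
  have int: "integrable ?L (X_fun b a r s)"
    by (intro integrable_continuous_on_compact compact_tetra continuous_intros)
  have const: "(LINT y|?L. c) = vol *\<^sub>R c" for c :: "real^3^3"
    unfolding vol_def by simp
  have "M = (\<Sum>i\<in>UNIV. (LINT y|?L. X_coeff b a i y) *\<^sub>R T_nn n e i) + (vol * r) *\<^sub>R T5 e + (vol * s) *\<^sub>R T6 e"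
  proof -
    have 1: "integrable ?L (\<lambda>y. X_coeff b a i y *\<^sub>R A)" for i and A :: "real^3^3"
      by (intro integrable_continuous_on_compact compact_tetra continuous_intros)
    have 2: "integrable ?L (\<lambda>_. A)" for A :: "real^3^3"
      by (intro integrable_continuous_on_compact compact_tetra continuous_intros)
    have 3: "integrable ?L (X_coeff b a i)" for i
      by (intro integrable_continuous_on_compact compact_tetra continuous_intros)
    have "M = (LINT y|?L. (\<Sum>i\<in>UNIV. X_coeff b a i y *\<^sub>R T_nn n e i)) + (LINT y|?L. r *\<^sub>R T5 e) + (LINT y|?L. s *\<^sub>R T6 e)"
      unfolding M_def X_fun_def
      by (subst Bochner_Integration.integral_add, (intro Bochner_Integration.integrable_add Bochner_Integration.integrable_sum 1 2)+)+ simp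
    also have "(LINT y|?L. (\<Sum>i\<in>UNIV. X_coeff b a i y *\<^sub>R T_nn n e i)) = (\<Sum>i\<in>UNIV. (LINT y|?L. X_coeff b a i y) *\<^sub>R T_nn n e i)"
      using Bochner_Integration.integral_sum[OF 1] 3 by simp
    finally show ?thesis by (simp only: const scaleR_scaleR)
  qed
  note M = this
  have "M \<in> sym_matrices"
    unfolding M T5_def T6_def
    by (intro subspace_add[OF subspace_sym_matrices] subspace_sum[OF subspace_sym_matrices]
        subspace_scale[OF subspace_sym_matrices] T_nn_sym sym_prod_in_sym_matrices)
  then have "zext (tetra x) (\<lambda>_. M) \<in> poly_space 0 (tetra x) sym_matrices" by (rule poly_space_const)
  from L2_annihilator[OF C compact_tetra continuous_X_fun poly_space_0_continuous 0 this]
  have "(LINT y|?L. X_fun b a r s y \<bullet> zext (tetra x) (\<lambda>_. M) y) = 0" .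
  moreover have "(LINT y|?L. X_fun b a r s y \<bullet> zext (tetra x) (\<lambda>_. M) y) = (LINT y|?L. X_fun b a r s y \<bullet> M)"
    by (rule Bochner_Integration.integral_cong) (auto simp: zext_def)
  moreover have "(LINT y|?L. X_fun b a r s y \<bullet> M) = M \<bullet> M"
    unfolding M_def by (rule integral_inner_left) (rule int)
  ultimately have "M = 0" by simp
  note T = T_independent[OF this[unfolded M]]
  show "(LINT y|?L. X_coeff b a i y) = 0" by (rule T(1))
  have "vol \<noteq> 0"
    using integral_continuous_nonneg_eq_0[OF compact_tetra convex_tetra interior_tetra continuous_on_const _ _ vertex_in_tetra]
    unfolding vol_def by (metis zero_le_one zero_neq_one)
  then show "r = 0" "s = 0" using T(2,3) by simp_all
qed

text \<open>The gradient of a quadratic is affine and thus interpolated from its vertex values. This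
  shows that the divergence is an admissible test function.\<close>

lemma coeff_grad_vertices: "coeff_grad b a i y = (\<Sum>k\<in>UNIV. bary k y *\<^sub>R coeff_grad b a i (x k))"
proof -
  have 1: "(\<Sum>m\<in>UNIV. a i m * bary m (x k)) = a i k" for k
  proof -
    have "(\<Sum>m\<in>UNIV. a i m * bary m (x k)) = (\<Sum>m\<in>UNIV. if k = m then a i m else 0)"
      by (rule sum.cong) (auto simp: bary_vertex)
    then show ?thesis by simp
  qed
  have 2: "(\<Sum>k\<in>UNIV. bary k y *\<^sub>R (bary i (x k) *\<^sub>R w)) = bary i y *\<^sub>R w" for w :: "real^3"
  proof -
    have "(\<Sum>k\<in>UNIV. bary k y *\<^sub>R (bary i (x k) *\<^sub>R w)) = (\<Sum>k\<in>UNIV. if i = k then bary k y *\<^sub>R w else 0)"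
      by (rule sum.cong) (auto simp: bary_vertex)
    then show ?thesis by simp
  qed
  have 3: "(\<Sum>k\<in>UNIV. bary k y *\<^sub>R w) = w" for w :: "real^3"
    by (simp add: scaleR_sum_left[symmetric] bary_sum)
  show ?thesis
    unfolding coeff_grad_def scaleR_add_right sum.distrib 2 3 1
    by (simp add: scaleR_sum_left mult.commute)
qed

lemma div_fun_vertices: "div_fun b a y = (\<Sum>k\<in>UNIV. bary k y *\<^sub>R div_fun b a (x k))"
proof -
  have "div_fun b a y = (\<Sum>i\<in>UNIV. \<Sum>k\<in>UNIV. bary k y *\<^sub>R (T_nn n e i *v coeff_grad b a i (x k)))"
    unfolding div_fun_def
    by (subst coeff_grad_vertices) (simp add: linear_sum[OF matrix_vector_mul_linear] matrix_vector_mult_scaleR)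
  then show ?thesis by (subst (asm) sum.swap) (simp add: div_fun_def scaleR_sum_right)
qed

lemma div_moments_vanish:
  assumes V: "is_basis V (poly_space 1 (tetra x) UNIV)"
    and 0: "\<And>v. v \<in> V \<Longrightarrow> (LINT y|lebesgue_on (tetra x). div_fun b a y \<bullet> v y) = 0"
  shows "div_fun b a (x k) = 0"
proof -
  let ?L = "lebesgue_on (tetra x)"
  have "zext (tetra x) (div_fun b a) = zext (tetra x) (\<lambda>y. \<Sum>k\<in>UNIV. bary k y *\<^sub>R div_fun b a (x k))"
    by (rule zext_cong) (rule div_fun_vertices)
  also have "\<dots> \<in> poly_space 1 (tetra x) UNIV" by (intro zext_poly_space_sum zext_bary_scaleR) simp
  finally have "zext (tetra x) (div_fun b a) \<in> poly_space 1 (tetra x) UNIV" .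
  from L2_annihilator[OF V compact_tetra continuous_div_fun poly_space_1_continuous 0 this]
  have "(LINT y|?L. div_fun b a y \<bullet> zext (tetra x) (div_fun b a) y) = 0" .
  moreover have "(LINT y|?L. div_fun b a y \<bullet> zext (tetra x) (div_fun b a) y) = (LINT y|?L. div_fun b a y \<bullet> div_fun b a y)"
    by (rule Bochner_Integration.integral_cong) (auto simp: zext_def)
  ultimately have zero: "(LINT y|?L. div_fun b a y \<bullet> div_fun b a y) = 0" by simp
  have "continuous_on (tetra x) (\<lambda>y. div_fun b a y \<bullet> div_fun b a y)" by (intro continuous_intros)
  from integral_continuous_nonneg_eq_0[OF compact_tetra convex_tetra interior_tetra this inner_ge_zero zero vertex_in_tetra]
  have "div_fun b a (x k) \<bullet> div_fun b a (x k) = 0" .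
  then show ?thesis by simp
qed

text \<open>Four means, and three components of the divergence at each of the four vertices, match
  the 16 unknowns; their coefficients become pure numbers after rescaling.\<close>

lemma bubble_coefficients_vanish:
  assumes b: "\<And>i m. b i m = 0" and int: "\<And>i. (LINT y|lebesgue_on (tetra x). X_coeff b a i y) = 0"
    and div: "\<And>k. div_fun b a (x k) = 0"
  shows "a i m = 0"
proof -
  \<comment> \<open>The rescaling absorbs the factor \<open>1 / (height i)\<^sup>2\<close> of
    \<open>T_nn_vertices\<close>, so that only the numbers \<open>\<gamma>\<close> remain.\<close>
  define \<alpha> where "\<alpha> i m = a i m / (height i)\<^sup>2" for i m
  define \<gamma> where "\<gamma> i j l = gram (side i (i + 2) \<odot> side i (i + 3)) j l" for i j l
  have 0: "(\<Sum>m\<in>UNIV. \<alpha> i m) + \<alpha> i i = 0" for i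
  proof -
    \<comment> \<open>By \<open>mass_eq\<close> the off-diagonal mass entries are \<open>K\<close>
      and the diagonal ones \<open>2 * K\<close>; the doubled diagonal produces the extra
      summand.\<close>
    define K where "K = mass 0 0 / 2"
    have "X_coeff b a i y = (\<Sum>m\<in>UNIV. a i m * (bary i y * bary m y))" for y
      by (simp add: X_coeff_def b sum_distrib_left mult_ac)
    then have "0 = (\<Sum>m\<in>UNIV. a i m * mass i m)"
      using int[of i] by (simp add: mass_def integrable_mass)
    also have "(\<Sum>m\<in>UNIV. a i m * mass i m) = (\<Sum>m\<in>UNIV. K * a i m + (if i = m then K * a i m else 0))"
      by (rule sum.cong) (auto simp: mass_eq[of i] K_def)
    also have "\<dots> = K * ((\<Sum>m\<in>UNIV. a i m) + a i i)"
      by (simp add: sum.distrib sum_distrib_left distrib_left)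
    finally have "(\<Sum>m\<in>UNIV. a i m) + a i i = 0" using mass_pos[of 0] by (simp add: K_def)
    then show ?thesis unfolding \<alpha>_def
      by (simp add: sum_divide_distrib[symmetric] add_divide_distrib[symmetric])
  qed
  have eq: "(\<Sum>i\<in>UNIV. \<alpha> i k * \<gamma> i j i + (if i = k then \<Sum>m\<in>UNIV. \<alpha> i m * \<gamma> i j m else 0)) = 0" for j k
  proof -
    have grad: "coeff_grad b a i (x k) = a i k *\<^sub>R bary_grad i + (if i = k then \<Sum>m\<in>UNIV. a i m *\<^sub>R bary_grad m else 0)" for i
    proof -
      have "(\<Sum>m\<in>UNIV. a i m * bary m (x k)) = (\<Sum>m\<in>UNIV. if k = m then a i m else 0)"
        by (rule sum.cong) (auto simp: bary_vertex)
      then show ?thesis by (auto simp: coeff_grad_def b bary_vertex)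
    qed
    have g: "bary_grad j \<bullet> (T_nn n e i *v bary_grad l) = \<gamma> i j l / (height i)\<^sup>2" for i l
      unfolding T_nn_vertices gram_def[symmetric] gram_scaleR \<gamma>_def by simp
    have "0 = bary_grad j \<bullet> div_fun b a (x k)" by (simp add: div)
    also have "\<dots> = (\<Sum>i\<in>UNIV. \<alpha> i k * \<gamma> i j i + (if i = k then \<Sum>m\<in>UNIV. \<alpha> i m * \<gamma> i j m else 0))"
      unfolding div_fun_def inner_sum_right grad
      by (intro sum.cong refl)
        (simp add: matrix_vector_right_distrib inner_add_right matrix_vector_mult_scaleR g
          linear_sum[OF matrix_vector_mul_linear] inner_sum_right \<alpha>_def)
    finally show ?thesis by simp
  qed
  \<comment> \<open>In \<open>eq\<close> the first instance is the vertex \<open>k\<close>, the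
    second the gradient index \<open>j\<close>; doubling the equations clears the halves coming from
    the symmetric product.\<close>
  have 1: "\<forall>j. 2 * \<alpha> j (j + 1) - 2 * \<alpha> (j + 1) (j + 1) + \<alpha> (j + 1) (j + 3) - \<alpha> (j + 2) (j + 1) = 0"
    unfolding forall_4_from_0
    using eq[of 1 0] eq[of 2 1] eq[of 3 2] eq[of 0 3]
    by (simp add: sum_4_from_0 \<gamma>_def gram_sym_prod bary_grad_vertices mod_4_numerals, (intro conjI; linarith)?)
  have 2: "\<forall>j. 2 * \<alpha> j (j + 2) - \<alpha> (j + 1) (j + 2) + \<alpha> (j + 2) (j + 1) - 2 * \<alpha> (j + 2) (j + 2) = 0"
    unfolding forall_4_from_0
    using eq[of 2 0] eq[of 3 1] eq[of 0 2] eq[of 1 3]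
    by (simp add: sum_4_from_0 \<gamma>_def gram_sym_prod bary_grad_vertices mod_4_numerals, (intro conjI; linarith)?)
  have 3: "\<forall>j. 2 * \<alpha> j (j + 3) - \<alpha> (j + 1) (j + 3) - \<alpha> (j + 2) (j + 3) = 0"
    unfolding forall_4_from_0
    using eq[of 3 0] eq[of 0 1] eq[of 1 2] eq[of 2 3]
    by (simp add: sum_4_from_0 \<gamma>_def gram_sym_prod bary_grad_vertices mod_4_numerals, (intro conjI; linarith)?)
  have "\<alpha> i m = 0" by (rule cyclic_linear_system[of \<alpha>, OF 0 1[rule_format] 2[rule_format] 3[rule_format]])
  then show ?thesis using height_pos[of i] by (simp add: \<alpha>_def)
qed

lemma unisolvence:
  assumes Q: "\<And>i. is_basis (Q i) (poly_space 1 (face x i) UNIV)"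
    and C: "is_basis C (poly_space 0 (tetra x) sym_matrices)"
    and V: "is_basis V (poly_space 1 (tetra x) UNIV)"
    and \<tau>: "\<tau> \<in> X_space x n e"
    and 0: "\<And>d. d \<in> dof_index Q C V \<Longrightarrow> dof_value x n d \<tau> = 0"
  shows "\<tau> = 0"
proof -
  obtain b a r s where \<tau>_eq: "\<tau> = zext (tetra x) (X_fun b a r s)" and bii: "\<And>i. b i i = 0"
    using \<tau> unfolding X_space_eq by blast
  have Qi: "face_integral x i (\<lambda>y. trace_coeff b i y * q y) = 0" if "q \<in> Q i" for i q
  proof -
    have "Face_Moment i q \<in> dof_index Q C V" using that by (auto simp: dof_index_def)
    from 0[OF this] show ?thesis unfolding \<tau>_eq face_moment using face_area_pos[of i] by simp
  qed
  have b: "b i m = 0" for i m by (rule trace_coeff_vanishes[OF Q bii Qi])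
  have Ci: "(LINT y|lebesgue_on (tetra x). X_fun b a r s y \<bullet> c y) = 0" if "c \<in> C" for c
  proof -
    have "Const_Moment c \<in> dof_index Q C V" using that by (auto simp: dof_index_def)
    from 0[OF this] show ?thesis unfolding \<tau>_eq const_moment .
  qed
  note c = const_moments_vanish[OF C Ci]
  have Vi: "(LINT y|lebesgue_on (tetra x). div_fun b a y \<bullet> v y) = 0" if v: "v \<in> V" for v
  proof -
    have "Div_Moment v \<in> dof_index Q C V" using v by (auto simp: dof_index_def)
    moreover have "continuous_on (tetra x) v"
      using V v span_base[of v V] by (intro poly_space_1_continuous) (simp add: is_basis_def)
    ultimately show ?thesis using 0 unfolding \<tau>_eq by (metis div_moment)
  qed
  have a: "a i m = 0" for i m
    by (rule bubble_coefficients_vanish[OF b c(1) div_moments_vanish[OF V Vi]])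
  show ?thesis
    unfolding \<tau>_eq using a b c(2,3) by (auto simp: zext_def X_fun_def X_coeff_def fun_eq_iff)
qed

end

theorem proposition9:
  fixes x n :: "4 \<Rightarrow> real^3" and e :: "4 \<Rightarrow> 4 \<Rightarrow> real^3"
  assumes "nondegenerate x"
    and "\<And>i. unit_outer_normal x i (n i)"
    and "\<And>i j. i \<noteq> j \<Longrightarrow> unit_edge_vector x i j (e i j)"
    and "\<And>i j. i \<noteq> j \<Longrightarrow> e i j = e j i"
  shows "poly_space 0 (tetra x) sym_matrices \<subseteq> X_space x n e \<and>
    dim (X_space x n e) = 30 \<and>
    (\<forall>Q C V.
       (\<forall>i. is_basis (Q i) (poly_space 1 (face x i) UNIV)) \<and>
       is_basis C (poly_space 0 (tetra x) sym_matrices) \<and>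
       is_basis V (poly_space 1 (tetra x) UNIV) \<longrightarrow>
       is_basis_family (\<lambda>d. zext (X_space x n e) (dof_value x n d)) (dof_index Q C V)
         (dual_space (X_space x n e)))"
proof -
  interpret tetrahedron x n e by unfold_locales (use assms(2,3) in auto)
  obtain B where B: "B \<subseteq> X_space x n e" "independent B" "finite B" "card B = 30"
    by (rule X_space_independent)
  have main: "is_basis_family (\<lambda>d. zext (X_space x n e) (dof_value x n d)) (dof_index Q C V)
         (dual_space (X_space x n e))" "dim (X_space x n e) = card B"
    if Q: "\<And>i. is_basis (Q i) (poly_space 1 (face x i) UNIV)"
      and C: "is_basis C (poly_space 0 (tetra x) sym_matrices)"
      and V: "is_basis V (poly_space 1 (tetra x) UNIV)" for Q C V
  proof -
    have ker: "v = 0" if v: "v \<in> X_space x n e"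
      and "\<And>d. d \<in> dof_index Q C V \<Longrightarrow> zext (X_space x n e) (dof_value x n d) v = 0" for v
    proof (rule unisolvence[OF Q C V v])
      fix d assume "d \<in> dof_index Q C V"
      then show "dof_value x n d v = 0" using that(2)[of d] v by (simp add: zext_def)
    qed
    have card: "card (dof_index Q C V) \<le> card B" using dof_index_card(2)[OF Q C V] B(4) by simp
    note D = dual_basis_family[OF subspace_X_space dof_index_card(1)[OF Q C V] dof_dual[OF Q C V] ker B(1-3) card]
    show "is_basis_family (\<lambda>d. zext (X_space x n e) (dof_value x n d)) (dof_index Q C V)
         (dual_space (X_space x n e))" by (rule D(1))
    show "dim (X_space x n e) = card B" by (rule D(2))
  qed
  \<comment> \<open>The dimension is obtained along with the dual basis, so some bases of the test
    spaces have to be exhibited.\<close>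
  have "\<forall>i. \<exists>B. is_basis B (poly_space 1 (face x i) (UNIV :: real set))"
    using is_basis_exists[OF subspace_poly_space] by blast
  then obtain Q where Q: "\<And>i. is_basis (Q i) (poly_space 1 (face x i) (UNIV :: real set))"
    by metis
  obtain C where C: "is_basis C (poly_space 0 (tetra x) sym_matrices)"
    using is_basis_exists[OF subspace_poly_space] by blast
  obtain V where V: "is_basis V (poly_space 1 (tetra x) (UNIV :: (real^3) set))"
    using is_basis_exists[OF subspace_poly_space] by blast
  have "dim (X_space x n e) = 30" using main(2)[OF Q C V] B(4) by simp
  then show ?thesis using P0_subset_X_space main(1) by blast
qed

end
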